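(* Let $q\ge 3$ and let $E:\{\pm1\}^k\to\{\pm1\}^n$ be a $(q,\delta,\varepsilon)$-locally decodable code. Then \[ k\le n^{1-\frac2q}\cdot\frac{2^{O(q)}\log^4 n}{\varepsilon^6\delta^2}. \]
   Context: A code $E:\{\pm1\}^k\to\{\pm1\}^n$ is $(q,\delta,\varepsilon)$-locally decodable if there is a randomized algorithm $\mathsf{Dec}$ which, given an index $i\in[k]$ and oracle access to a string $y\in\{\pm1\}^n$, makes at most $q$ queries to $y$ and satisfies: for every $b\in\{\pm1\}^k$ and every $y\in\{\pm1\}^n$ differing from $E(b)$ in at most $\delta n$ coordinates, $\Pr[\mathsf{Dec}^y(i)=b_i]\ge\frac12+\varepsilon$. The code need not be linear. $2^{O(q)}$ denotes a quantity at most $2^{cq}$ for an absolute constant $c$.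
   Formalization: The formal theorem assumes n ≥ 2, δ > 0 and ε > 0: at n = 1 the bound is 0 since log 1 = 0, while the identity code with k = n = 1 is locally decodable (δ = ε = 1/2), and for δ = 0 or ε = 0 the bound divides by zero. *)

theory Defs
  imports "HOL-Probability.Probability"
begin

text \<open>The cube \<open>{\<plusminus>1}\<^sup>m\<close>, with coordinates indexed by \<open>{..<m}\<close>.\<close>

definition cube :: "nat \<Rightarrow> (nat \<Rightarrow> real) set" where
  "cube m = {..<m} \<rightarrow>\<^sub>E {-1, 1}"

definition hamming :: "nat \<Rightarrow> (nat \<Rightarrow> real) \<Rightarrow> (nat \<Rightarrow> real) \<Rightarrow> nat" where
  "hamming n x y = card {j. j < n \<and> x j \<noteq> y j}"

text \<open>
  A deterministic oracle algorithm is an adaptive decision tree: \<open>Query j s t\<close> reads coordinate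
  \<open>j\<close> of the oracle string and continues with \<open>s\<close> if it is \<open>1\<close> and with \<open>t\<close> if it is \<open>-1\<close>.
  A randomized oracle algorithm is a probability distribution on such trees.
\<close>

datatype dtree = Output real | Query nat dtree dtree

primrec run :: "dtree \<Rightarrow> (nat \<Rightarrow> real) \<Rightarrow> real" where
  "run (Output a) y = a"
| "run (Query j s t) y = (if y j = 1 then run s y else run t y)"

primrec queries :: "dtree \<Rightarrow> (nat \<Rightarrow> real) \<Rightarrow> nat list" where
  "queries (Output a) y = []"
| "queries (Query j s t) y = j # (if y j = 1 then queries s y else queries t y)"

definition query_bounded :: "nat \<Rightarrow> nat \<Rightarrow> dtree pmf \<Rightarrow> bool" where
  "query_bounded q n D \<longleftrightarrow>
     (\<forall>t\<in>set_pmf D. \<forall>y\<in>cube n. set (queries t y) \<subseteq> {..<n} \<and> length (queries t y) \<le> q)"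

definition locally_decodable ::
  "nat \<Rightarrow> real \<Rightarrow> real \<Rightarrow> nat \<Rightarrow> nat \<Rightarrow> ((nat \<Rightarrow> real) \<Rightarrow> (nat \<Rightarrow> real)) \<Rightarrow> bool" where
  "locally_decodable q \<delta> \<epsilon> k n E \<longleftrightarrow>
     (\<exists>Dec :: nat \<Rightarrow> dtree pmf. \<forall>i<k.
        query_bounded q n (Dec i) \<and>
        (\<forall>b\<in>cube k. \<forall>y\<in>cube n. real (hamming n y (E b)) \<le> \<delta> * real n \<longrightarrow>
           measure_pmf.prob (Dec i) {t. run t y = b i} \<ge> 1 / 2 + \<epsilon>))"

end

theory Submission
  imports Defs
begin

text \<open>
  For every message index \<open>i\<close> the decoder yields a large matching of sets \<open>C\<close> of size at most \<open>q\<close> whose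
  characters \<open>E(b)\<^sub>C\<close> correlate with \<open>b\<^sub>i\<close>. The hyperedges \<open>(i, C)\<close> are grouped greedily around heavy
  subsets \<open>Q \<subseteq> C\<close>; by Cauchy--Schwarz over the groups, pairs \<open>(i, C)\<close>, \<open>(j, C')\<close> with the same \<open>Q\<close> and
  \<open>i \<noteq> j\<close> satisfy a correlated system of parities on \<open>(C - Q) \<union> (C' - Q)\<close>. These are the edges of a Kikuchi
  graph whose vertices are tuples of total length about \<open>n powr (1 - 2 / q)\<close>. The greedy choice controls
  the codegrees, so after pruning every label \<open>i\<close> has degree comparable to the mean. The signs \<open>b\<^sub>i\<close> being
  random, the trace method bounds the expected norm of the signed adjacency matrix, and comparing
  this with the correlation bounds \<open>k\<close>. Odd and even \<open>q\<close> are treated alike.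
\<close>

section \<open>Averages over the cube\<close>

text \<open>The code is an arbitrary map: \<open>E b\<close> may depend on all of \<open>b\<close>,
  and each correlation holds only on average over \<open>b\<close>. Hence the test vector built from
  \<open>E b\<close> counts as adversarial, a norm bound uniform in it is required, and the only
  usable randomness is in the edge signs. A pair carries two signs, so the labels are cut by a set
  \<open>L\<close>: \<open>b i\<close> with \<open>i\<close> in \<open>L\<close> is random, while
  \<open>b j\<close> with \<open>j\<close> outside \<open>L\<close> is absorbed into a frozen
  coefficient. Pairs are formed because a single hyperedge of odd size cannot be split evenly
  between row and column, whereas two remainders of common size \<open>s\<close> can. With
  \<open>w = l / n\<close>, the mean number of edges of one label at a vertex is of order
  \<open>\<kappa> n \<Delta>(t) w^s\<close>. A pair always agrees with itself everywhere; this
  contribution stays below the mean as soon as \<open>n^2 w^q \<ge> 1\<close>, and that is the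
  origin of the exponent \<open>1 - 2 / q\<close>. The norm is about (degree) times
  \<open>sqrt (|L| log N)\<close>, where \<open>log N = l s log n\<close>. The group size
  \<open>\<kappa> \<Delta>(t)\<close> occurs in both the correlation and the degree and cancels, so
  no case distinction on the sizes of the groups is needed.\<close>

lemma finite_cube [simp]: "finite (cube k)"
  unfolding cube_def by (intro finite_PiE) auto

lemma card_cube: "card (cube k) = 2 ^ k"
  unfolding cube_def by (subst card_PiE) (auto simp: numeral_2_eq_2)

lemma cube_nonempty: "cube k \<noteq> {}"
  using card_cube[of k] by (metis card.empty power_not_zero zero_neq_numeral)

lemma cube_values: "b \<in> cube k \<Longrightarrow> i < k \<Longrightarrow> b i = -1 \<or> b i = 1"
  unfolding cube_def by (auto dest: PiE_mem)

lemma cube_square: "b \<in> cube k \<Longrightarrow> i < k \<Longrightarrow> b i * b i = 1"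
  using cube_values by fastforce

definition flip :: "nat \<Rightarrow> (nat \<Rightarrow> real) \<Rightarrow> nat \<Rightarrow> real" where
  "flip i b = b(i := - b i)"

lemma flip_flip [simp]: "flip i (flip i b) = b"
  by (auto simp: flip_def)

lemma flip_same [simp]: "flip i b i = - b i"
  by (simp add: flip_def)

lemma flip_other [simp]: "j \<noteq> i \<Longrightarrow> flip i b j = b j"
  by (simp add: flip_def)

lemma flip_in_cube: "i < k \<Longrightarrow> b \<in> cube k \<Longrightarrow> flip i b \<in> cube k"
  unfolding cube_def flip_def by (auto simp: PiE_iff extensional_def)

lemma sum_cube_flip:
  assumes "i < k"
  shows "(\<Sum>b\<in>cube k. f (flip i b)) = (\<Sum>b\<in>cube k. f b)"
  by (rule sum.reindex_bij_witness[of _ "flip i" "flip i"]) (auto simp: flip_in_cube assms)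

lemma sum_cube_odd:
  fixes f :: "(nat \<Rightarrow> real) \<Rightarrow> real"
  assumes "i < k" "\<And>b. b \<in> cube k \<Longrightarrow> f (flip i b) = - f b"
  shows "(\<Sum>b\<in>cube k. f b) = 0"
proof -
  have "(\<Sum>b\<in>cube k. f b) = (\<Sum>b\<in>cube k. f (flip i b))"
    by (rule sum_cube_flip[OF assms(1), symmetric])
  also have "\<dots> = - (\<Sum>b\<in>cube k. f b)"
    by (simp add: assms(2) sum_negf)
  finally show ?thesis by simp
qed

section \<open>Products of signs along words of labels\<close>

lemma prod_list_eq_prod_count:
  fixes b :: "nat \<Rightarrow> real"
  assumes "set is \<subseteq> {..<k}"
  shows "prod_list (map b is) = (\<Prod>i<k. b i ^ count_list is i)"
  using assms
proof (induction "is")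
  case (Cons a "is")
  have "(\<Prod>i<k. b i ^ count_list (a # is) i) = (\<Prod>i<k. (if i = a then b i else 1) * b i ^ count_list is i)"
    by (intro prod.cong) auto
  also have "\<dots> = b a * (\<Prod>i<k. b i ^ count_list is i)"
    using Cons.prems by (simp add: prod.distrib)
  finally show ?case using Cons by simp
qed simp

lemma prod_list_flip:
  "prod_list (map (flip i b) is) = (-1) ^ count_list is i * prod_list (map b is)"
  by (induction "is") (auto simp: flip_def)

text \<open>If some letter occurs an odd number of times, flipping it negates the word and preserves
  \<open>\<psi>\<close>, so both sums vanish; otherwise the word is constantly 1. This lets bounded
  coefficients that ignore \<open>L\<close> be dropped from moment computations.\<close>

lemma sum_cube_word_dominates:
  assumes "set is \<subseteq> L" "L \<subseteq> {..<k}"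
    and psi: "\<And>b. b \<in> cube k \<Longrightarrow> \<bar>\<psi> b\<bar> \<le> 1"
    and inv: "\<And>i b. i \<in> L \<Longrightarrow> b \<in> cube k \<Longrightarrow> \<psi> (flip i b) = (\<psi> b :: real)"
  shows "\<bar>\<Sum>b\<in>cube k. prod_list (map b is) * \<psi> b\<bar> \<le> (\<Sum>b\<in>cube k. prod_list (map b is))"
proof (cases "\<exists>i\<in>set is. odd (count_list is i)")
  case True
  then obtain i where i: "i \<in> set is" "odd (count_list is i)" by auto
  then have ik: "i < k" "i \<in> L" using assms by auto
  have "(\<Sum>b\<in>cube k. prod_list (map b is) * \<psi> b) = 0"
    by (rule sum_cube_odd[OF ik(1)]) (simp add: prod_list_flip i inv ik)
  moreover have "(\<Sum>b\<in>cube k. prod_list (map b is)) = 0"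
    by (rule sum_cube_odd[OF ik(1)]) (simp add: prod_list_flip i)
  ultimately show ?thesis by simp
next
  case False
  have one: "prod_list (map b is) = 1" if b: "b \<in> cube k" for b
  proof -
    have "b i ^ count_list is i = 1" if "i < k" for i
    proof (cases "i \<in> set is")
      case True
      with False have "even (count_list is i)" by auto
      then show ?thesis using cube_values[OF b \<open>i < k\<close>] by auto
    next
      case False
      then show ?thesis by (simp add: count_list_0_iff)
    qed
    then show ?thesis
      using assms by (subst prod_list_eq_prod_count[where k = k]) auto
  qed
  have "\<bar>\<Sum>b\<in>cube k. prod_list (map b is) * \<psi> b\<bar> \<le> (\<Sum>b\<in>cube k. \<bar>\<psi> b\<bar>)"
    by (rule order_trans[OF sum_abs]) (simp add: one)
  also have "\<dots> \<le> (\<Sum>b\<in>cube k. prod_list (map b is))"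
    by (rule sum_mono) (simp add: one psi)
  finally show ?thesis .
qed

lemma sum_words_prod_list:
  fixes f :: "'a \<Rightarrow> 'b::comm_semiring_1"
  assumes "finite A"
  shows "(\<Sum>xs | set xs \<subseteq> A \<and> length xs = m. prod_list (map f xs)) = (\<Sum>a\<in>A. f a) ^ m"
proof (induction m)
  case (Suc m)
  let ?W = "{xs. set xs \<subseteq> A \<and> length xs = m}"
  have "(\<Sum>xs | set xs \<subseteq> A \<and> length xs = Suc m. prod_list (map f xs))
      = (\<Sum>(xs, a)\<in>?W \<times> A. prod_list (map f (a # xs)))"
    by (subst lists_length_Suc_eq, subst sum.reindex) (auto simp: inj_on_def case_prod_unfold)
  also have "\<dots> = (\<Sum>xs\<in>?W. \<Sum>a\<in>A. f a * prod_list (map f xs))"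
    by (simp add: sum.cartesian_product)
  also have "\<dots> = (\<Sum>a\<in>A. f a) * (\<Sum>xs\<in>?W. prod_list (map f xs))"
    by (subst sum.swap) (simp add: sum_product)
  finally show ?case using Suc by simp
next
  case 0
  have "{xs. set xs \<subseteq> A \<and> length xs = 0} = {[]}" by auto
  then show ?case by simp
qed

section \<open>Even moments of Rademacher sums\<close>

lemma two_pow_fact_le: "2 ^ j * fact j \<le> (fact (2 * j) :: real)"
proof (induction j)
  case (Suc j)
  have "2 ^ Suc j * fact (Suc j) = (2 * real j + 2) * (2 ^ j * fact j)"
    by (simp add: algebra_simps)
  also have "\<dots> \<le> (2 * real j + 2) * ((2 * real j + 1) * fact (2 * j))"
  proof (rule mult_left_mono)
    have "1 * fact (2 * j) \<le> (2 * real j + 1) * fact (2 * j)"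
      by (rule mult_right_mono) auto
    with Suc show "2 ^ j * fact j \<le> (2 * real j + 1) * fact (2 * j)" by linarith
  qed simp
  also have "\<dots> = fact (2 * Suc j)" by (simp add: algebra_simps)
  finally show ?case .
qed simp

lemma even_binomial_sum:
  fixes x y :: real
  assumes "y * y = 1"
  shows "((x + y) ^ (2 * m) + (x - y) ^ (2 * m)) / 2 = (\<Sum>i\<le>m. real (2 * m choose (2 * i)) * x ^ (2 * i))"
proof -
  have y2: "y\<^sup>2 = 1" using assms by (simp add: power2_eq_square)
  let ?g = "\<lambda>i. real (2 * m choose i) * x ^ i * (y ^ (2 * m - i) + (- y) ^ (2 * m - i)) / 2"
  have "((x + y) ^ (2 * m) + (x + - y) ^ (2 * m)) / 2 = (\<Sum>i\<le>2 * m. ?g i)"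
    unfolding binomial_ring sum.distrib[symmetric] sum_divide_distrib
    by (intro sum.cong refl) (simp add: distrib_left)
  also have "\<dots> = (\<Sum>i\<in>(\<lambda>i. 2 * i) ` {..m}. ?g i)"
  proof (rule sum.mono_neutral_right)
    show "\<forall>i\<in>{..2 * m} - (*) 2 ` {..m}. ?g i = 0"
    proof
      fix i assume i: "i \<in> {..2 * m} - (*) 2 ` {..m}"
      have "odd i"
      proof
        assume "even i"
        then obtain j where "i = 2 * j" by auto
        with i show False by auto
      qed
      then have "odd (2 * m - i)" using i by auto
      then show "?g i = 0" by simp
    qed
  qed auto
  also have "\<dots> = (\<Sum>i\<le>m. ?g (2 * i))"
    by (subst sum.reindex) (auto simp: inj_on_def)
  also have "\<dots> = (\<Sum>i\<le>m. real (2 * m choose (2 * i)) * x ^ (2 * i))"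
  proof (rule sum.cong)
    fix i assume "i \<in> {..m}"
    have "2 * m - 2 * i = 2 * (m - i)" by simp
    then show "?g (2 * i) = real (2 * m choose (2 * i)) * x ^ (2 * i)"
      by (simp add: power_mult y2)
  qed simp
  finally show ?thesis by simp
qed

text \<open>The constant \<open>fact (2 * m) / (2 ^ m * fact m)\<close> is the double factorial
  (2m-1)!!, the Gaussian moment. Signs are added one at a time; averaging over the new sign leaves
  only the even powers of the old sum.\<close>

lemma rademacher_moment_fact:
  assumes "finite L" "L \<subseteq> {..<k}"
  shows "(\<Sum>b\<in>cube k. (\<Sum>i\<in>L. b i) ^ (2 * m)) \<le> 2 ^ k * (fact (2 * m) / (2 ^ m * fact m)) * real (card L) ^ m"
  using assms
proof (induction L arbitrary: m rule: finite_induct)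
  case empty
  then show ?case by (cases m) (auto simp: card_cube)
next
  case (insert j L)
  let ?S = "\<lambda>b::nat\<Rightarrow>real. \<Sum>i\<in>L. b i"
  let ?df = "\<lambda>m::nat. fact (2 * m) / (2 ^ m * fact m) :: real"
  have jk: "j < k" using insert by auto
  have fl: "?S (flip j b) = ?S b" for b
    using insert by (intro sum.cong) (auto simp: flip_def)
  have "(\<Sum>b\<in>cube k. (\<Sum>i\<in>insert j L. b i) ^ (2 * m)) = (\<Sum>b\<in>cube k. (?S b + b j) ^ (2 * m))"
    using insert by (simp add: add.commute)
  also have "\<dots> = ((\<Sum>b\<in>cube k. (?S b + b j) ^ (2 * m)) + (\<Sum>b\<in>cube k. (?S b - b j) ^ (2 * m))) / 2"
    using sum_cube_flip[OF jk, of "\<lambda>b. (?S b + b j) ^ (2 * m)"] fl by simp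
  also have "\<dots> = (\<Sum>b\<in>cube k. ((?S b + b j) ^ (2 * m) + (?S b - b j) ^ (2 * m)) / 2)"
    by (simp add: sum.distrib sum_divide_distrib add_divide_distrib)
  also have "\<dots> = (\<Sum>b\<in>cube k. \<Sum>i\<le>m. real (2 * m choose (2 * i)) * ?S b ^ (2 * i))"
    by (intro sum.cong refl even_binomial_sum cube_square[OF _ jk])
  also have "\<dots> = (\<Sum>i\<le>m. real (2 * m choose (2 * i)) * (\<Sum>b\<in>cube k. ?S b ^ (2 * i)))"
    by (subst sum.swap) (simp add: sum_distrib_left)
  also have "\<dots> \<le> (\<Sum>i\<le>m. real (2 * m choose (2 * i)) * (2 ^ k * ?df i * real (card L) ^ i))"
    using insert by (intro sum_mono mult_left_mono) auto
  also have "\<dots> \<le> (\<Sum>i\<le>m. 2 ^ k * ?df m * (real (m choose i) * real (card L) ^ i))"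
  proof (rule sum_mono)
    fix i assume "i \<in> {..m}"
    then have im: "i \<le> m" by simp
    have "real (2 * m choose (2 * i)) * ?df i = fact (2 * m) / (fact (2 * (m - i)) * (2 ^ i * fact i))"
      using im by (subst binomial_fact) (auto simp: field_simps diff_mult_distrib)
    \<comment> \<open>The even moments of the new sign, all equal to 1, are raised to the Gaussian
      moments (2j-1)!! with \<open>j = m - i\<close>. After that the binomial theorem closes the
      induction exactly.\<close>
    also have "\<dots> \<le> fact (2 * m) / ((2 ^ (m - i) * fact (m - i)) * (2 ^ i * fact i))"
      by (intro divide_left_mono mult_right_mono two_pow_fact_le) auto
    also have "\<dots> = ?df m * real (m choose i)"
      using im by (subst binomial_fact) (auto simp: field_simps power_add[symmetric])
    finally have "real (2 * m choose (2 * i)) * ?df i \<le> ?df m * real (m choose i)" .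
    then have "real (2 * m choose (2 * i)) * ?df i * (2 ^ k * real (card L) ^ i) \<le> ?df m * real (m choose i) * (2 ^ k * real (card L) ^ i)"
      by (intro mult_right_mono) auto
    then show "real (2 * m choose (2 * i)) * (2 ^ k * ?df i * real (card L) ^ i)
        \<le> 2 ^ k * ?df m * (real (m choose i) * real (card L) ^ i)"
      by (simp add: mult_ac)
  qed
  also have "\<dots> = 2 ^ k * ?df m * (real (card L) + 1) ^ m"
    by (subst binomial_ring) (simp add: sum_distrib_left)
  also have "real (card L) + 1 = real (card (insert j L))"
    using insert by simp
  finally show ?case .
qed

lemma rademacher_moment:
  assumes "L \<subseteq> {..<k}"
  shows "(\<Sum>b\<in>cube k. (\<Sum>i\<in>L. b i) ^ (2 * m)) \<le> 2 ^ k * (real m * real (card L)) ^ m"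
proof -
  have "fact (2 * m) div fact (2 * m - m) \<le> (2 * m) ^ m"
    by (rule fact_div_fact_le_pow) simp
  moreover have "fact m dvd (fact (2 * m) :: nat)" by (rule fact_dvd) simp
  ultimately have "fact (2 * m) \<le> (2 * m) ^ m * (fact m :: nat)"
    by (metis add_diff_cancel_left' dvd_div_mult_self mult_2 mult_le_mono1)
  from of_nat_mono[OF this, where 'a = real] have "fact (2 * m) \<le> (2 * real m) ^ m * fact m"
    by simp
  then have "fact (2 * m) / (2 ^ m * fact m) \<le> (real m ^ m :: real)"
    by (simp add: field_simps power_mult_distrib)
  then have "2 ^ k * (fact (2 * m) / (2 ^ m * fact m)) * real (card L) ^ m \<le> 2 ^ k * real m ^ m * real (card L) ^ m"
    by (intro mult_right_mono mult_left_mono) auto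
  then show ?thesis
    using rademacher_moment_fact[OF finite_subset[OF assms] assms, of m] by (simp add: power_mult_distrib mult_ac)
qed

section \<open>Quadratic forms with random edge labels\<close>

lemma square_power_two_power: "((x::real) ^ (2 ^ p))\<^sup>2 = x ^ (2 ^ Suc p)"
  by (simp add: power_mult[symmetric] mult.commute)

text \<open>Exponents are powers of two throughout, so that repeated squaring by Cauchy-Schwarz
  replaces the general power mean inequality here and spectral theory below.\<close>

lemma power_mean_two_powers:
  fixes f :: "'a \<Rightarrow> real"
  assumes "finite B" "B \<noteq> {}"
  shows "((\<Sum>b\<in>B. \<bar>f b\<bar>) / card B) ^ (2 ^ p) \<le> (\<Sum>b\<in>B. \<bar>f b\<bar> ^ (2 ^ p)) / card B"
proof (induction p)
  case (Suc p)
  have N: "real (card B) > 0" using assms by (simp add: card_gt_0_iff)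
  let ?g = "\<lambda>b. \<bar>f b\<bar> ^ (2 ^ p)"
  have "((\<Sum>b\<in>B. \<bar>f b\<bar>) / card B) ^ (2 ^ Suc p) = (((\<Sum>b\<in>B. \<bar>f b\<bar>) / card B) ^ (2 ^ p))\<^sup>2"
    by (rule square_power_two_power[symmetric])
  also have "\<dots> \<le> ((\<Sum>b\<in>B. ?g b) / card B)\<^sup>2"
    by (rule power_mono[OF Suc]) (auto intro!: sum_nonneg)
  also have "\<dots> = (\<Sum>b\<in>B. ?g b * 1)\<^sup>2 / (card B)\<^sup>2"
    by (simp add: power_divide)
  also have "\<dots> \<le> (\<Sum>b\<in>B. (?g b)\<^sup>2) * (\<Sum>b\<in>B. 1\<^sup>2) / (card B)\<^sup>2"
    by (intro divide_right_mono Cauchy_Schwarz_ineq_sum) auto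
  also have "\<dots> = (\<Sum>b\<in>B. \<bar>f b\<bar> ^ (2 ^ Suc p)) / card B"
    using N unfolding square_power_two_power by (simp add: power2_eq_square)
  finally show ?case .
qed simp

text \<open>
  The coefficients \<open>c\<close> may depend on \<open>b\<close>, but only through coordinates outside \<open>L\<close>; hence a closed
  walk survives averaging only if every label occurs an even number of times.
\<close>

locale signed_graph =
  fixes k :: nat and L :: "nat set" and V :: "'v set" and A :: "'d set"
    and src dst :: "'d \<Rightarrow> 'v" and lab :: "'d \<Rightarrow> nat" and rv :: "'d \<Rightarrow> 'd"
    and c :: "'d \<Rightarrow> (nat \<Rightarrow> real) \<Rightarrow> real" and D :: real
  assumes finite_V: "finite V" and V_nonempty: "V \<noteq> {}" and finite_A: "finite A" and L_sub: "L \<subseteq> {..<k}"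
    and src_V: "d \<in> A \<Longrightarrow> src d \<in> V" and dst_V: "d \<in> A \<Longrightarrow> dst d \<in> V"
    and lab_L: "d \<in> A \<Longrightarrow> lab d \<in> L"
    and rv_A: "d \<in> A \<Longrightarrow> rv d \<in> A" and rv_rv: "d \<in> A \<Longrightarrow> rv (rv d) = d"
    and src_rv: "d \<in> A \<Longrightarrow> src (rv d) = dst d" and dst_rv: "d \<in> A \<Longrightarrow> dst (rv d) = src d"
    and lab_rv: "d \<in> A \<Longrightarrow> lab (rv d) = lab d" and c_rv: "d \<in> A \<Longrightarrow> c (rv d) = c d"
    and c_bound: "d \<in> A \<Longrightarrow> b \<in> cube k \<Longrightarrow> \<bar>c d b\<bar> \<le> 1"
    and c_flip: "d \<in> A \<Longrightarrow> b \<in> cube k \<Longrightarrow> i \<in> L \<Longrightarrow> c d (flip i b) = c d b"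
    and degree: "x \<in> V \<Longrightarrow> i \<in> L \<Longrightarrow> real (card {d\<in>A. src d = x \<and> lab d = i}) \<le> D"
    and D_nonneg: "D \<ge> 0"
begin

section \<open>Walks and powers of the signed adjacency operator\<close>

primrec walks :: "nat \<Rightarrow> 'v \<Rightarrow> 'd list set" where
  "walks 0 x = {[]}"
| "walks (Suc m) x = (\<Union>d\<in>{d\<in>A. src d = x}. (#) d ` walks m (dst d))"

primrec endpoint :: "'v \<Rightarrow> 'd list \<Rightarrow> 'v" where
  "endpoint x [] = x"
| "endpoint x (d # ds) = endpoint (dst d) ds"

definition weight :: "(nat \<Rightarrow> real) \<Rightarrow> 'd list \<Rightarrow> real" where
  "weight b ds = prod_list (map (\<lambda>d. b (lab d) * c d b) ds)"

definition adj :: "(nat \<Rightarrow> real) \<Rightarrow> ('v \<Rightarrow> real) \<Rightarrow> 'v \<Rightarrow> real" where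
  "adj b f x = (\<Sum>d | d \<in> A \<and> src d = x. b (lab d) * c d b * f (dst d))"

definition form :: "('v \<Rightarrow> real) \<Rightarrow> ('v \<Rightarrow> real) \<Rightarrow> real" where
  "form f g = (\<Sum>x\<in>V. f x * g x)"

text \<open>The \<open>(x, y)\<close> entry of the \<open>m\<close>-th power of the signed adjacency
  matrix.\<close>

definition pow_entry :: "(nat \<Rightarrow> real) \<Rightarrow> nat \<Rightarrow> 'v \<Rightarrow> 'v \<Rightarrow> real" where
  "pow_entry b m x y = (\<Sum>ds | ds \<in> walks m x \<and> endpoint x ds = y. weight b ds)"

lemma finite_walks: "finite (walks m x)"
  by (induction m arbitrary: x) (auto simp: finite_A)

lemma walks_sub: "ds \<in> walks m x \<Longrightarrow> set ds \<subseteq> A"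
  by (induction m arbitrary: x ds) fastforce+

lemma endpoint_V: "ds \<in> walks m x \<Longrightarrow> x \<in> V \<Longrightarrow> endpoint x ds \<in> V"
  by (induction m arbitrary: x ds) (auto simp: dst_V)

lemma sum_walks_Suc:
  "(\<Sum>ds\<in>walks (Suc m) x. g ds) = (\<Sum>d | d \<in> A \<and> src d = x. \<Sum>ds\<in>walks m (dst d). g (d # ds))"
proof -
  have "(\<Sum>ds\<in>walks (Suc m) x. g ds) = (\<Sum>d | d \<in> A \<and> src d = x. \<Sum>ds\<in>(#) d ` walks m (dst d). g ds)"
    unfolding walks.simps by (rule sum.UNION_disjoint) (auto simp: finite_A finite_walks)
  also have "\<dots> = (\<Sum>d | d \<in> A \<and> src d = x. \<Sum>ds\<in>walks m (dst d). g (d # ds))"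
    by (rule sum.cong[OF refl]) (simp add: sum.reindex)
  finally show ?thesis .
qed

lemma adj_power: "(adj b ^^ m) f x = (\<Sum>ds\<in>walks m x. weight b ds * f (endpoint x ds))"
proof (induction m arbitrary: x)
  case (Suc m)
  have "(adj b ^^ Suc m) f x = adj b ((adj b ^^ m) f) x" by simp
  also have "\<dots> = (\<Sum>d | d \<in> A \<and> src d = x. b (lab d) * c d b *
      (\<Sum>ds\<in>walks m (dst d). weight b ds * f (endpoint (dst d) ds)))"
    unfolding adj_def[of b "(adj b ^^ m) f"] by (simp add: Suc)
  also have "\<dots> = (\<Sum>ds\<in>walks (Suc m) x. weight b ds * f (endpoint x ds))"
    unfolding sum_walks_Suc by (simp add: weight_def sum_distrib_left mult_ac)
  finally show ?case .
qed (simp add: weight_def)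

lemma adj_power_entries:
  assumes "x \<in> V"
  shows "(adj b ^^ m) f x = (\<Sum>y\<in>V. pow_entry b m x y * f y)"
proof -
  have "(adj b ^^ m) f x = (\<Sum>y\<in>V. \<Sum>ds | ds \<in> walks m x \<and> endpoint x ds = y. weight b ds * f (endpoint x ds))"
    unfolding adj_power by (rule sum.group[symmetric]) (auto simp: finite_walks finite_V endpoint_V assms)
  also have "\<dots> = (\<Sum>y\<in>V. pow_entry b m x y * f y)"
    unfolding pow_entry_def sum_distrib_right by (intro sum.cong) auto
  finally show ?thesis .
qed

text \<open>At every vertex at most \<open>D\<close> darts carry a given label, so each label word
  is spelled by at most \<open>D ^ m\<close> walks from \<open>x\<close>.\<close>

lemma sum_walks_labels:
  assumes "x \<in> V" and "\<And>is. set is \<subseteq> L \<Longrightarrow> \<phi> is \<ge> 0"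
  shows "(\<Sum>ds\<in>walks m x. \<phi> (map lab ds)) \<le> D ^ m * (\<Sum>is | set is \<subseteq> L \<and> length is = m. \<phi> is)"
  using assms
proof (induction m arbitrary: x \<phi>)
  case 0
  have "{is. set is \<subseteq> L \<and> length is = 0} = {[]}" by auto
  then show ?case by simp
next
  case (Suc m)
  let ?W = "{is. set is \<subseteq> L \<and> length is = m}"
  have fL: "finite L" using L_sub finite_subset by blast
  have "(\<Sum>ds\<in>walks (Suc m) x. \<phi> (map lab ds))
      = (\<Sum>d | d \<in> A \<and> src d = x. \<Sum>ds\<in>walks m (dst d). \<phi> (lab d # map lab ds))"
    by (simp add: sum_walks_Suc del: walks.simps)
  also have "\<dots> \<le> (\<Sum>d | d \<in> A \<and> src d = x. D ^ m * (\<Sum>is\<in>?W. \<phi> (lab d # is)))"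
    using Suc.prems lab_L by (intro sum_mono Suc.IH) (auto simp: dst_V)
  also have "\<dots> = (\<Sum>i\<in>L. \<Sum>d | d \<in> {d. d \<in> A \<and> src d = x} \<and> lab d = i. D ^ m * (\<Sum>is\<in>?W. \<phi> (lab d # is)))"
    by (rule sum.group[symmetric]) (auto simp: finite_A fL lab_L)
  also have "\<dots> = (\<Sum>i\<in>L. real (card {d\<in>A. src d = x \<and> lab d = i}) * (D ^ m * (\<Sum>is\<in>?W. \<phi> (i # is))))"
    by (intro sum.cong refl) (simp add: conj_assoc)
  also have "\<dots> \<le> (\<Sum>i\<in>L. D * (D ^ m * (\<Sum>is\<in>?W. \<phi> (i # is))))"
    using Suc.prems D_nonneg by (intro sum_mono mult_right_mono degree mult_nonneg_nonneg sum_nonneg) auto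
  also have "\<dots> = D ^ Suc m * (\<Sum>i\<in>L. \<Sum>is\<in>?W. \<phi> (i # is))"
    by (simp add: sum_distrib_left mult_ac)
  also have "(\<Sum>i\<in>L. \<Sum>is\<in>?W. \<phi> (i # is)) = (\<Sum>is | set is \<subseteq> L \<and> length is = Suc m. \<phi> is)"
    by (subst lists_length_Suc_eq, subst sum.reindex)
      (auto simp: inj_on_def case_prod_unfold sum.cartesian_product' sum.swap[of _ L])
  finally show ?case .
qed

lemma sum_cube_weight:
  assumes "set ds \<subseteq> A" "set ds' \<subseteq> A"
  shows "(\<Sum>b\<in>cube k. weight b ds * weight b ds') \<le> (\<Sum>b\<in>cube k. prod_list (map b (map lab ds @ map lab ds')))"
proof -
  let ?is = "map lab ds @ map lab ds'"
  let ?psi = "\<lambda>b. prod_list (map (\<lambda>d. c d b) (ds @ ds'))"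
  have split: "prod_list (map (\<lambda>d. b (lab d) * c d b) es) = prod_list (map b (map lab es)) * prod_list (map (\<lambda>d. c d b) es)" for b es
    by (induction es) (auto simp: mult_ac)
  have bound: "\<bar>prod_list (map (\<lambda>d. c d b) es)\<bar> \<le> 1" if "set es \<subseteq> A" "b \<in> cube k" for b es
    using that by (induction es) (auto simp: abs_mult c_bound intro!: mult_le_one)
  have "weight b ds * weight b ds' = prod_list (map b ?is) * ?psi b" for b
    by (simp add: weight_def split)
  moreover have "\<bar>\<Sum>b\<in>cube k. prod_list (map b ?is) * ?psi b\<bar> \<le> (\<Sum>b\<in>cube k. prod_list (map b ?is))"
  proof (rule sum_cube_word_dominates[OF _ L_sub])
    show "set ?is \<subseteq> L" using assms lab_L by auto
    show "\<bar>?psi b\<bar> \<le> 1" if "b \<in> cube k" for b using bound[of "ds @ ds'"] assms that by simp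
    show "?psi (flip i b) = ?psi b" if "i \<in> L" "b \<in> cube k" for i b
    proof -
      have "map (\<lambda>d. c d (flip i b)) (ds @ ds') = map (\<lambda>d. c d b) (ds @ ds')"
        using assms that by (intro map_cong refl c_flip) auto
      then show ?thesis by (rule arg_cong)
    qed
  qed
  ultimately show ?thesis by simp
qed

text \<open>Squaring an entry pairs walks with common ends. After averaging over \<open>b\<close>
  only label words with even multiplicities count, and summing these over all words is exactly the
  moment of order \<open>2 * m\<close> of the Rademacher sum over \<open>L\<close>.\<close>

lemma pow_entry_second_moment:
  assumes "x \<in> V"
  shows "(\<Sum>b\<in>cube k. \<Sum>y\<in>V. (pow_entry b m x y)\<^sup>2) \<le> 2 ^ k * (D ^ (2 * m) * (real m * real (card L)) ^ m)"
proof -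
  let ?W = "walks m x"
  let ?R = "\<lambda>is. \<Sum>b\<in>cube k. prod_list (map b is)"
  let ?I = "{is. set is \<subseteq> L \<and> length is = m}"
  have fL: "finite L" using L_sub finite_subset by blast
  have Rnn: "?R is \<ge> 0" if "set is \<subseteq> L" for "is"
    using sum_cube_word_dominates[OF that L_sub, of "\<lambda>_. 0"] by simp
  have lab_walk: "set (map lab ds) \<subseteq> L" if "ds \<in> ?W" for ds
    using walks_sub[OF that] lab_L by auto
  have "(\<Sum>b\<in>cube k. \<Sum>y\<in>V. (pow_entry b m x y)\<^sup>2)
      = (\<Sum>b\<in>cube k. \<Sum>y\<in>V. \<Sum>ds | ds \<in> ?W \<and> endpoint x ds = y. \<Sum>ds' | ds' \<in> ?W \<and> endpoint x ds' = y. weight b ds * weight b ds')"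
    by (simp add: pow_entry_def power2_eq_square sum_product)
  also have "\<dots> = (\<Sum>b\<in>cube k. \<Sum>y\<in>V. \<Sum>ds | ds \<in> ?W \<and> endpoint x ds = y. \<Sum>ds' | ds' \<in> ?W \<and> endpoint x ds' = endpoint x ds. weight b ds * weight b ds')"
    by (intro sum.cong refl) auto
  also have "\<dots> = (\<Sum>b\<in>cube k. \<Sum>ds\<in>?W. \<Sum>ds' | ds' \<in> ?W \<and> endpoint x ds' = endpoint x ds. weight b ds * weight b ds')"
    by (intro sum.cong refl sum.group) (auto simp: finite_walks finite_V endpoint_V assms)
  also have "\<dots> = (\<Sum>ds\<in>?W. \<Sum>ds' | ds' \<in> ?W \<and> endpoint x ds' = endpoint x ds. \<Sum>b\<in>cube k. weight b ds * weight b ds')"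
    by (subst sum.swap, intro sum.cong refl, subst sum.swap, rule refl)
  also have "\<dots> \<le> (\<Sum>ds\<in>?W. \<Sum>ds' | ds' \<in> ?W \<and> endpoint x ds' = endpoint x ds. ?R (map lab ds @ map lab ds'))"
    by (intro sum_mono sum_cube_weight) (auto dest: walks_sub)
  also have "\<dots> \<le> (\<Sum>ds\<in>?W. \<Sum>ds'\<in>?W. ?R (map lab ds @ map lab ds'))"
  proof (intro sum_mono sum_mono2)
    fix ds ds'
    assume "ds \<in> ?W" "ds' \<in> ?W - {ds' \<in> ?W. endpoint x ds' = endpoint x ds}"
    then show "0 \<le> ?R (map lab ds @ map lab ds')"
      using lab_walk by (intro Rnn) auto
  qed (auto simp: finite_walks)
  also have "\<dots> \<le> (\<Sum>ds\<in>?W. D ^ m * (\<Sum>is'\<in>?I. ?R (map lab ds @ is')))"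
    using lab_walk by (intro sum_mono sum_walks_labels[where \<phi> = "\<lambda>is'. ?R (map lab _ @ is')"] assms Rnn) auto
  also have "\<dots> \<le> D ^ m * (\<Sum>is\<in>?I. D ^ m * (\<Sum>is'\<in>?I. ?R (is @ is')))"
    using D_nonneg
    by (intro sum_walks_labels[where \<phi> = "\<lambda>is. D ^ m * (\<Sum>is'\<in>?I. ?R (is @ is'))"] assms mult_nonneg_nonneg sum_nonneg Rnn) auto
  also have "\<dots> = D ^ (2 * m) * (\<Sum>is\<in>?I. \<Sum>is'\<in>?I. ?R (is @ is'))"
    by (simp add: sum_distrib_left[symmetric] mult_2 power_add)
  also have "(\<Sum>is\<in>?I. \<Sum>is'\<in>?I. ?R (is @ is')) = (\<Sum>b\<in>cube k. \<Sum>is\<in>?I. \<Sum>is'\<in>?I. prod_list (map b is) * prod_list (map b is'))"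
    by (simp add: sum.swap[of _ _ "cube k"])
  also have "\<dots> = (\<Sum>b\<in>cube k. (\<Sum>i\<in>L. b i) ^ (2 * m))"
    by (simp add: sum_product[symmetric] sum_words_prod_list[OF fL] mult_2 power_add)
  also have "D ^ (2 * m) * \<dots> \<le> D ^ (2 * m) * (2 ^ k * (real m * real (card L)) ^ m)"
    by (intro mult_left_mono rademacher_moment L_sub) (simp add: D_nonneg)
  finally show ?thesis by (simp add: mult_ac)
qed

section \<open>Quadratic forms of the self-adjoint operator\<close>

lemma form_adj: "form f (adj b g) = (\<Sum>d\<in>A. b (lab d) * c d b * f (src d) * g (dst d))"
proof -
  have "form f (adj b g) = (\<Sum>x\<in>V. \<Sum>d | d \<in> A \<and> src d = x. b (lab d) * c d b * f (src d) * g (dst d))"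
    unfolding form_def adj_def sum_distrib_left by (intro sum.cong) (auto simp: mult_ac)
  also have "\<dots> = (\<Sum>d\<in>A. b (lab d) * c d b * f (src d) * g (dst d))"
    by (rule sum.group) (auto simp: finite_A finite_V src_V)
  finally show ?thesis .
qed

lemma form_adj_sym: "form f (adj b g) = form (adj b f) g"
proof -
  have "(\<Sum>d\<in>A. b (lab d) * c d b * f (src d) * g (dst d)) = (\<Sum>d\<in>A. b (lab d) * c d b * g (src d) * f (dst d))"
    by (rule sum.reindex_bij_witness[of _ rv rv])
      (auto simp: rv_A rv_rv src_rv dst_rv lab_rv c_rv)
  then have "form f (adj b g) = form g (adj b f)" by (simp add: form_adj)
  then show ?thesis by (simp add: form_def mult.commute)
qed

lemma form_adj_power: "form f ((adj b ^^ m) g) = form ((adj b ^^ m) f) g"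
proof (induction m arbitrary: f g)
  case (Suc m)
  have "form f ((adj b ^^ Suc m) g) = form (adj b f) ((adj b ^^ m) g)"
    by (simp add: form_adj_sym)
  also have "\<dots> = form ((adj b ^^ m) (adj b f)) g" by (rule Suc)
  finally show ?case by (simp add: funpow_swap1)
qed simp

lemma form_cauchy: "(form f g)\<^sup>2 \<le> form f f * form g g"
  unfolding form_def using Cauchy_Schwarz_ineq_sum[of f g V] by (simp add: power2_eq_square)

lemma form_power_doubling:
  "(form f ((adj b ^^ m) f))\<^sup>2 \<le> form f f * form f ((adj b ^^ (2 * m)) f)"
proof -
  have "form ((adj b ^^ m) f) ((adj b ^^ m) f) = form f ((adj b ^^ (2 * m)) f)"
    by (simp add: form_adj_power[symmetric] mult_2 funpow_add)
  then show ?thesis using form_cauchy[of f "(adj b ^^ m) f"] by simp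
qed

lemma form_self_le_card:
  assumes "\<And>x. x \<in> V \<Longrightarrow> \<bar>f x\<bar> \<le> 1"
  shows "form f f \<le> card V"
proof -
  have "form f f \<le> (\<Sum>x\<in>V. 1)"
    unfolding form_def
  proof (rule sum_mono)
    fix x assume "x \<in> V"
    then have "\<bar>f x\<bar> * \<bar>f x\<bar> \<le> 1" using assms by (intro mult_le_one) auto
    then show "f x * f x \<le> 1" by (simp add: abs_mult[symmetric])
  qed
  then show ?thesis by simp
qed

text \<open>Self-adjointness and Cauchy-Schwarz give
  \<open>(f, A^m f)^2 \<le> (f, f) (f, A^(2m) f)\<close>; iterating this yields the power inequality
  usually read off the eigenvalues. The factor \<open>card V\<close> on the left stands for a
  division on the right.\<close>

lemma quadratic_form_power:
  assumes f: "\<And>x. x \<in> V \<Longrightarrow> \<bar>f x\<bar> \<le> 1"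
  shows "\<bar>form f (adj b f)\<bar> ^ (2 ^ p) * real (card V) \<le> real (card V) ^ (2 ^ p) * \<bar>form f ((adj b ^^ (2 ^ p)) f)\<bar>"
proof (induction p)
  case (Suc p)
  let ?N = "real (card V)" and ?I = "\<lambda>p. \<bar>form f ((adj b ^^ (2 ^ p)) f)\<bar>"
  have N: "?N > 0" using finite_V V_nonempty by (simp add: card_gt_0_iff)
  have "\<bar>form f (adj b f)\<bar> ^ (2 ^ Suc p) * ?N * ?N = (\<bar>form f (adj b f)\<bar> ^ (2 ^ p) * ?N)\<^sup>2"
    unfolding power_mult_distrib square_power_two_power by (simp add: power2_eq_square)
  also have "\<dots> \<le> (?N ^ (2 ^ p) * ?I p)\<^sup>2"
    using Suc by (intro power_mono) auto
  also have "\<dots> = ?N ^ (2 ^ Suc p) * (?I p)\<^sup>2"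
    unfolding power_mult_distrib square_power_two_power by simp
  also have "\<dots> \<le> ?N ^ (2 ^ Suc p) * (?N * ?I (Suc p))"
  proof (rule mult_left_mono)
    have "(?I p)\<^sup>2 \<le> form f f * form f ((adj b ^^ (2 * 2 ^ p)) f)"
      using form_power_doubling by simp
    also have "\<dots> \<le> form f f * ?I (Suc p)"
      by (intro mult_left_mono) (auto simp: form_def intro!: sum_nonneg)
    also have "\<dots> \<le> ?N * ?I (Suc p)"
      by (intro mult_right_mono form_self_le_card f) auto
    finally show "(?I p)\<^sup>2 \<le> ?N * ?I (Suc p)" .
  qed simp
  finally have "(\<bar>form f (adj b f)\<bar> ^ (2 ^ Suc p) * ?N) * ?N \<le> (?N ^ (2 ^ Suc p) * ?I (Suc p)) * ?N"
    by (simp add: mult_ac)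
  then show ?case using N by (rule mult_right_le_imp_le)
qed simp

text \<open>The last doubling is read as the squared norm of \<open>A^m f\<close>, which is at most
  \<open>card V\<close> times the squared Frobenius norm of \<open>A^m\<close>. The right-hand side
  no longer mentions \<open>f\<close>, so \<open>f\<close> may depend on \<open>b\<close> when
  averages are taken.\<close>

lemma quadratic_form_le_entries:
  assumes f: "\<And>x. x \<in> V \<Longrightarrow> \<bar>f x\<bar> \<le> 1"
  shows "\<bar>form f (adj b f)\<bar> ^ (2 ^ Suc p) \<le> real (card V) ^ (2 ^ Suc p) * (\<Sum>x\<in>V. \<Sum>y\<in>V. (pow_entry b (2 ^ p) x y)\<^sup>2)"
proof -
  let ?N = "real (card V)" and ?m = "2 ^ p :: nat"
  have N: "?N > 0" using finite_V V_nonempty by (simp add: card_gt_0_iff)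
  have "form f ((adj b ^^ (2 ^ Suc p)) f) = form ((adj b ^^ ?m) f) ((adj b ^^ ?m) f)"
    by (simp add: form_adj_power[symmetric] mult_2 funpow_add)
  also have "\<dots> = (\<Sum>x\<in>V. (\<Sum>y\<in>V. pow_entry b ?m x y * f y)\<^sup>2)"
    unfolding form_def by (intro sum.cong refl) (simp add: adj_power_entries power2_eq_square)
  also have "\<dots> \<le> (\<Sum>x\<in>V. (\<Sum>y\<in>V. (pow_entry b ?m x y)\<^sup>2) * (\<Sum>y\<in>V. (f y)\<^sup>2))"
    by (intro sum_mono Cauchy_Schwarz_ineq_sum)
  also have "\<dots> \<le> (\<Sum>x\<in>V. (\<Sum>y\<in>V. (pow_entry b ?m x y)\<^sup>2) * ?N)"
    using form_self_le_card[OF f]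
    by (intro sum_mono mult_left_mono sum_nonneg) (auto simp: form_def power2_eq_square)
  finally have *: "form f ((adj b ^^ (2 ^ Suc p)) f) \<le> (\<Sum>x\<in>V. \<Sum>y\<in>V. (pow_entry b ?m x y)\<^sup>2) * ?N"
    by (simp add: sum_distrib_right)
  have "form f ((adj b ^^ (2 ^ Suc p)) f) \<ge> 0"
    unfolding \<open>form f ((adj b ^^ (2 ^ Suc p)) f) = form ((adj b ^^ ?m) f) ((adj b ^^ ?m) f)\<close>
    by (auto simp: form_def intro!: sum_nonneg)
  with * have "\<bar>form f ((adj b ^^ (2 ^ Suc p)) f)\<bar> \<le> (\<Sum>x\<in>V. \<Sum>y\<in>V. (pow_entry b ?m x y)\<^sup>2) * ?N"
    by simp
  then have "\<bar>form f (adj b f)\<bar> ^ (2 ^ Suc p) * ?N \<le> ?N ^ (2 ^ Suc p) * ((\<Sum>x\<in>V. \<Sum>y\<in>V. (pow_entry b ?m x y)\<^sup>2) * ?N)"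
    by (intro order_trans[OF quadratic_form_power[OF f, where p = "Suc p"]] mult_left_mono) auto
  then have "\<bar>form f (adj b f)\<bar> ^ (2 ^ Suc p) * ?N \<le> (?N ^ (2 ^ Suc p) * (\<Sum>x\<in>V. \<Sum>y\<in>V. (pow_entry b ?m x y)\<^sup>2)) * ?N"
    by (simp only: mult_ac)
  then show ?thesis using N by (rule mult_right_le_imp_le)
qed

text \<open>A matrix Khintchine inequality: \<open>D\<close> bounds the row sums, hence the norm, of
  each label's matrix, and \<open>2 ^ p\<close> takes the place of the logarithm of the dimension.
  The vectors \<open>u b\<close> may depend on \<open>b\<close> in any way.\<close>

lemma average_quadratic_form:
  assumes u: "\<And>b x. b \<in> cube k \<Longrightarrow> x \<in> V \<Longrightarrow> \<bar>u b x\<bar> \<le> 1"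
    and p: "real (card V) \<le> 2 ^ (2 ^ Suc p)"
  shows "(\<Sum>b\<in>cube k. \<Sum>d\<in>A. b (lab d) * c d b * u b (src d) * u b (dst d))
    \<le> 2 ^ k * (2 * real (card V) * D * sqrt (2 ^ p * real (card L)))"
proof -
  let ?a = "\<lambda>b. form (u b) (adj b (u b))"
  let ?N = "real (card V)" and ?m = "2 ^ p :: nat"
  let ?S = "(\<Sum>b\<in>cube k. \<bar>?a b\<bar>) / card (cube k)"
  have "?S ^ (2 ^ Suc p) \<le> (\<Sum>b\<in>cube k. \<bar>?a b\<bar> ^ (2 ^ Suc p)) / card (cube k)"
    by (rule power_mean_two_powers) (auto simp: cube_nonempty)
  also have "\<dots> \<le> (\<Sum>b\<in>cube k. ?N ^ (2 ^ Suc p) * (\<Sum>x\<in>V. \<Sum>y\<in>V. (pow_entry b ?m x y)\<^sup>2)) / card (cube k)"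
    by (intro divide_right_mono sum_mono quadratic_form_le_entries[where p = p] u) auto
  also have "\<dots> = ?N ^ (2 ^ Suc p) * (\<Sum>x\<in>V. \<Sum>b\<in>cube k. \<Sum>y\<in>V. (pow_entry b ?m x y)\<^sup>2) / card (cube k)"
    by (simp only: sum_distrib_left[symmetric] sum.swap[of _ V "cube k"])
  also have "\<dots> \<le> ?N ^ (2 ^ Suc p) * (\<Sum>x\<in>V. 2 ^ k * (D ^ (2 * ?m) * (real ?m * real (card L)) ^ ?m)) / card (cube k)"
    by (intro divide_right_mono mult_left_mono sum_mono pow_entry_second_moment) auto
  also have "\<dots> = ?N ^ (2 ^ Suc p) * (?N * (D ^ (2 ^ Suc p) * (2 ^ p * real (card L)) ^ ?m))"
    by (simp add: card_cube)
  \<comment> \<open>The trace loses one factor \<open>card V\<close>; by the choice of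
    \<open>p\<close> its root of order \<open>2 ^ Suc p\<close> is at most 2.\<close>
  also have "\<dots> \<le> ?N ^ (2 ^ Suc p) * (2 ^ (2 ^ Suc p) * (D ^ (2 ^ Suc p) * (2 ^ p * real (card L)) ^ ?m))"
    using p D_nonneg by (intro mult_left_mono mult_right_mono) auto
  also have "(2 ^ p * real (card L)) ^ ?m = sqrt (2 ^ p * real (card L)) ^ (2 ^ Suc p)"
    by (simp add: power_mult)
  also have "?N ^ (2 ^ Suc p) * (2 ^ (2 ^ Suc p) * (D ^ (2 ^ Suc p) * sqrt (2 ^ p * real (card L)) ^ (2 ^ Suc p)))
      = (2 * ?N * D * sqrt (2 ^ p * real (card L))) ^ (2 ^ Suc p)"
    by (simp only: power_mult_distrib mult_ac)
  finally have "?S \<le> 2 * ?N * D * sqrt (2 ^ p * real (card L))"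
    using D_nonneg by (subst (asm) power_mono_iff)
      (auto intro!: divide_nonneg_nonneg sum_nonneg mult_nonneg_nonneg)
  then have "(\<Sum>b\<in>cube k. \<bar>?a b\<bar>) \<le> 2 ^ k * (2 * ?N * D * sqrt (2 ^ p * real (card L)))"
    by (simp add: card_cube field_simps)
  moreover have "(\<Sum>b\<in>cube k. ?a b) \<le> (\<Sum>b\<in>cube k. \<bar>?a b\<bar>)"
    by (intro sum_mono) auto
  ultimately show ?thesis unfolding form_adj by linarith
qed

end

section \<open>From decoders to matchings\<close>

definition chi :: "nat set \<Rightarrow> (nat \<Rightarrow> real) \<Rightarrow> real" where
  "chi C y = (\<Prod>j\<in>C. y j)"

text \<open>Leaves of a decision tree may carry any real number. Sending all outputs other than 1
  and -1 to 0 keeps the output bounded by 1 in absolute value.\<close>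

definition clip :: "real \<Rightarrow> real" where
  "clip a = (if a = 1 then 1 else if a = -1 then -1 else 0)"

lemma chi_values: "C \<subseteq> {..<n} \<Longrightarrow> y \<in> cube n \<Longrightarrow> chi C y = 1 \<or> chi C y = -1"
proof -
  assume C: "C \<subseteq> {..<n}" and y: "y \<in> cube n"
  have "finite C" using C finite_subset by blast
  then show ?thesis using C
  proof (induction C)
    case (insert j C)
    then have "y j = -1 \<or> y j = 1" using cube_values[OF y, of j] by simp
    moreover have "chi C y = 1 \<or> chi C y = -1" using insert by simp
    moreover have "chi (insert j C) y = y j * chi C y" using insert by (simp add: chi_def)
    ultimately show ?case by (elim disjE) simp_all
  qed (simp add: chi_def)
qed

lemma abs_chi: "C \<subseteq> {..<n} \<Longrightarrow> y \<in> cube n \<Longrightarrow> \<bar>chi C y\<bar> = 1"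
  using chi_values[of C n y] by auto

text \<open>The indicator of a subcube fixing the coordinates in \<open>J\<close> is the average of
  \<open>2 ^ card J\<close> characters with signs, so restricting to it costs nothing.\<close>

lemma subcube_correlation:
  assumes fin: "finite \<Omega>" and Y: "\<And>\<omega>. \<omega> \<in> \<Omega> \<Longrightarrow> Y \<omega> \<in> cube n" and z: "z \<in> cube n"
    and J: "J \<subseteq> {..<n}" "card J \<le> q"
    and cor: "\<And>A. A \<subseteq> {..<n} \<Longrightarrow> card A \<le> q \<Longrightarrow> \<bar>\<Sum>\<omega>\<in>\<Omega>. g \<omega> * chi A (Y \<omega>)\<bar> \<le> \<eta>"
  shows "\<bar>\<Sum>\<omega> | \<omega> \<in> \<Omega> \<and> (\<forall>j\<in>J. Y \<omega> j = z j). g \<omega>\<bar> \<le> \<eta>"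
proof -
  have finJ: "finite J" using J finite_subset by blast
  have ind: "(if \<forall>j\<in>J. Y \<omega> j = z j then 1 else 0) = (\<Sum>A\<in>Pow J. chi A z * chi A (Y \<omega>)) / 2 ^ card J"
    if w: "\<omega> \<in> \<Omega>" for \<omega>
  proof -
    have v: "(z j * Y \<omega> j + 1) / 2 = (if Y \<omega> j = z j then 1 else 0)" if "j \<in> J" for j
    proof -
      have "j < n" using that J by auto
      then show ?thesis using cube_values[OF z, of j] cube_values[OF Y[OF w], of j] by auto
    qed
    have "(if \<forall>j\<in>J. Y \<omega> j = z j then 1 else 0) = (\<Prod>j\<in>J. if Y \<omega> j = z j then 1 else (0::real))"
      using finJ by (auto simp: prod_zero_iff)
    also have "\<dots> = (\<Prod>j\<in>J. (z j * Y \<omega> j + 1) / 2)"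
      using v by (intro prod.cong) auto
    also have "\<dots> = (\<Prod>j\<in>J. z j * Y \<omega> j + 1) / 2 ^ card J"
      by (simp add: prod_dividef)
    also have "(\<Prod>j\<in>J. z j * Y \<omega> j + 1) = (\<Sum>A\<in>Pow J. chi A z * chi A (Y \<omega>))"
      using finJ by (subst prod_add) (auto simp: chi_def prod.distrib)
    finally show ?thesis .
  qed
  have "(\<Sum>\<omega> | \<omega> \<in> \<Omega> \<and> (\<forall>j\<in>J. Y \<omega> j = z j). g \<omega>)
      = (\<Sum>\<omega>\<in>\<Omega>. g \<omega> * (if \<forall>j\<in>J. Y \<omega> j = z j then 1 else 0))"
    using fin by (simp add: sum.inter_filter[symmetric] if_distrib cong: if_cong)
  also have "\<dots> = (\<Sum>\<omega>\<in>\<Omega>. \<Sum>A\<in>Pow J. chi A z * (g \<omega> * chi A (Y \<omega>))) / 2 ^ card J"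
    by (simp add: ind sum_distrib_left sum_divide_distrib mult_ac cong: sum.cong)
  also have "\<dots> = (\<Sum>A\<in>Pow J. chi A z * (\<Sum>\<omega>\<in>\<Omega>. g \<omega> * chi A (Y \<omega>))) / 2 ^ card J"
    by (subst sum.swap) (simp add: sum_distrib_left)
  finally have "\<bar>\<Sum>\<omega> | \<omega> \<in> \<Omega> \<and> (\<forall>j\<in>J. Y \<omega> j = z j). g \<omega>\<bar>
      \<le> (\<Sum>A\<in>Pow J. \<bar>chi A z * (\<Sum>\<omega>\<in>\<Omega>. g \<omega> * chi A (Y \<omega>))\<bar>) / 2 ^ card J"
    by (simp add: abs_divide divide_right_mono sum_abs)
  also have "\<dots> \<le> (\<Sum>A\<in>Pow J. \<eta>) / 2 ^ card J"
  proof (intro divide_right_mono sum_mono)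
    fix A assume "A \<in> Pow J"
    then have "A \<subseteq> {..<n}" "card A \<le> q"
      using J card_mono[OF finJ, of A] by auto
    then show "\<bar>chi A z * (\<Sum>\<omega>\<in>\<Omega>. g \<omega> * chi A (Y \<omega>))\<bar> \<le> \<eta>"
      using cor by (simp add: abs_mult abs_chi[OF _ z])
  qed simp
  also have "\<dots> = \<eta>" using finJ by (simp add: card_Pow)
  finally show ?thesis .
qed

text \<open>\<open>J\<close> and \<open>z\<close> record the queries made so far and their answers.
  A fresh query splits the subcube in two and uses up one of the \<open>r\<close> remaining queries,
  whence the factor \<open>2 ^ r\<close>; at a leaf the output is constant and the subcube bound
  applies.\<close>

lemma tree_correlation:
  assumes fin: "finite \<Omega>" and Y: "\<And>\<omega>. \<omega> \<in> \<Omega> \<Longrightarrow> Y \<omega> \<in> cube n"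
    and cor: "\<And>A. A \<subseteq> {..<n} \<Longrightarrow> card A \<le> q \<Longrightarrow> \<bar>\<Sum>\<omega>\<in>\<Omega>. g \<omega> * chi A (Y \<omega>)\<bar> \<le> \<eta>"
    and "z \<in> cube n" "J \<subseteq> {..<n}" "card J + r \<le> q"
    and "\<And>y. y \<in> cube n \<Longrightarrow> \<forall>j\<in>J. y j = z j \<Longrightarrow> set (queries t y) \<subseteq> {..<n} \<and> length (queries t y) \<le> r"
  shows "\<bar>\<Sum>\<omega> | \<omega> \<in> \<Omega> \<and> (\<forall>j\<in>J. Y \<omega> j = z j). g \<omega> * clip (run t (Y \<omega>))\<bar> \<le> 2 ^ r * \<eta>"
  using assms(4-)
proof (induction t arbitrary: z J r)
  case (Output a)
  have eta: "\<eta> \<ge> 0" using cor[of "{}"] by auto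
  have "\<bar>\<Sum>\<omega> | \<omega> \<in> \<Omega> \<and> (\<forall>j\<in>J. Y \<omega> j = z j). g \<omega>\<bar> \<le> \<eta>"
    using Output by (intro subcube_correlation[OF fin Y _ _ _ cor, where z = z]) auto
  then have "\<bar>(\<Sum>\<omega> | \<omega> \<in> \<Omega> \<and> (\<forall>j\<in>J. Y \<omega> j = z j). g \<omega>) * clip a\<bar> \<le> \<eta> * 1"
    unfolding abs_mult by (intro mult_mono) (auto simp: clip_def eta)
  also have "\<dots> \<le> 2 ^ r * \<eta>"
    using mult_right_mono[OF one_le_power[of "2::real" r] eta] by simp
  finally show ?case by (simp add: sum_distrib_right)
next
  case (Query j s t)
  from Query.prems(4)[OF Query.prems(1)]
  have jn: "j < n" and "Suc 0 \<le> r" by auto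
  then obtain r' where r: "r = Suc r'" by (cases r) auto
  have zj: "z j = -1 \<or> z j = 1" using cube_values[OF Query.prems(1) jn] .
  have eta: "\<eta> \<ge> 0" using cor[of "{}"] by auto
  have pw: "2 ^ r' * \<eta> \<le> 2 ^ r * \<eta>" using eta r by (intro mult_right_mono) auto
  show ?case
  proof (cases "j \<in> J")
    \<comment> \<open>A repeated query has its answer prescribed by \<open>z\<close>, so a single
      branch survives.\<close>
    case True
    show ?thesis
    proof (cases "z j = 1")
      case z1: True
      have "\<bar>\<Sum>\<omega> | \<omega> \<in> \<Omega> \<and> (\<forall>j\<in>J. Y \<omega> j = z j). g \<omega> * clip (run s (Y \<omega>))\<bar> \<le> 2 ^ r' * \<eta>"
      proof (rule Query.IH(1)[OF Query.prems(1,2)])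
        fix y assume y: "y \<in> cube n" "\<forall>j\<in>J. y j = z j"
        then have "y j = 1" using True z1 zj by auto
        with Query.prems(4)[OF y] r show "set (queries s y) \<subseteq> {..<n} \<and> length (queries s y) \<le> r'" by auto
      qed (use Query.prems(3) r in simp)
      also have "(\<Sum>\<omega> | \<omega> \<in> \<Omega> \<and> (\<forall>j\<in>J. Y \<omega> j = z j). g \<omega> * clip (run s (Y \<omega>)))
          = (\<Sum>\<omega> | \<omega> \<in> \<Omega> \<and> (\<forall>j\<in>J. Y \<omega> j = z j). g \<omega> * clip (run (Query j s t) (Y \<omega>)))"
        using True z1 by (intro sum.cong) auto
      finally show ?thesis using pw by linarith
    next
      case z0: False
      have "\<bar>\<Sum>\<omega> | \<omega> \<in> \<Omega> \<and> (\<forall>j\<in>J. Y \<omega> j = z j). g \<omega> * clip (run t (Y \<omega>))\<bar> \<le> 2 ^ r' * \<eta>"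
      proof (rule Query.IH(2)[OF Query.prems(1,2)])
        fix y assume y: "y \<in> cube n" "\<forall>j\<in>J. y j = z j"
        then have "y j = -1" using True z0 zj by auto
        with Query.prems(4)[OF y] r show "set (queries t y) \<subseteq> {..<n} \<and> length (queries t y) \<le> r'" by auto
      qed (use Query.prems(3) r in simp)
      also have "(\<Sum>\<omega> | \<omega> \<in> \<Omega> \<and> (\<forall>j\<in>J. Y \<omega> j = z j). g \<omega> * clip (run t (Y \<omega>)))
          = (\<Sum>\<omega> | \<omega> \<in> \<Omega> \<and> (\<forall>j\<in>J. Y \<omega> j = z j). g \<omega> * clip (run (Query j s t) (Y \<omega>)))"
        using True z0 by (intro sum.cong) auto
      finally show ?thesis using pw by linarith
    qed
  next
    case False
    let ?z = "\<lambda>v. z(j := v)" and ?J = "insert j J"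
    let ?O = "\<lambda>v. {\<omega>. \<omega> \<in> \<Omega> \<and> (\<forall>i\<in>?J. Y \<omega> i = ?z v i)}"
    have finJ: "finite J" using Query.prems finite_subset by blast
    have zc: "?z v \<in> cube n" if "v = 1 \<or> v = -1" for v
      using Query.prems(1) that jn by (auto simp: cube_def PiE_iff extensional_def)
    have cJ: "?J \<subseteq> {..<n}" "card ?J + r' \<le> q"
      using Query.prems jn r False finJ by auto
    have 1: "\<bar>\<Sum>\<omega>\<in>?O 1. g \<omega> * clip (run s (Y \<omega>))\<bar> \<le> 2 ^ r' * \<eta>"
    proof (rule Query.IH(1)[OF zc cJ])
      fix y assume y: "y \<in> cube n" "\<forall>i\<in>?J. y i = ?z 1 i"
      then have "\<forall>i\<in>J. y i = z i" "y j = 1" using False by auto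
      with Query.prems(4)[OF y(1)] r show "set (queries s y) \<subseteq> {..<n} \<and> length (queries s y) \<le> r'" by auto
    qed simp
    have 2: "\<bar>\<Sum>\<omega>\<in>?O (-1). g \<omega> * clip (run t (Y \<omega>))\<bar> \<le> 2 ^ r' * \<eta>"
    proof (rule Query.IH(2)[OF zc cJ])
      fix y assume y: "y \<in> cube n" "\<forall>i\<in>?J. y i = ?z (-1) i"
      then have "\<forall>i\<in>J. y i = z i" "y j = -1" using False by auto
      with Query.prems(4)[OF y(1)] r show "set (queries t y) \<subseteq> {..<n} \<and> length (queries t y) \<le> r'" by auto
    qed simp
    have split: "{\<omega>. \<omega> \<in> \<Omega> \<and> (\<forall>j\<in>J. Y \<omega> j = z j)} = ?O 1 \<union> ?O (-1)"
    proof -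
      have "Y \<omega> j = -1 \<or> Y \<omega> j = 1" if "\<omega> \<in> \<Omega>" for \<omega>
        using cube_values[OF Y[OF that] jn] .
      then have "\<omega> \<in> ?O 1 \<union> ?O (-1)" if "\<omega> \<in> \<Omega>" "\<forall>j\<in>J. Y \<omega> j = z j" for \<omega>
        using that False by auto
      moreover have "\<omega> \<in> \<Omega> \<and> (\<forall>j\<in>J. Y \<omega> j = z j)" if "\<omega> \<in> ?O 1 \<union> ?O (-1)" for \<omega>
        using that False by (auto split: if_splits)
      ultimately show ?thesis by blast
    qed
    have "(\<Sum>\<omega> | \<omega> \<in> \<Omega> \<and> (\<forall>j\<in>J. Y \<omega> j = z j). g \<omega> * clip (run (Query j s t) (Y \<omega>)))
        = (\<Sum>\<omega>\<in>?O 1. g \<omega> * clip (run (Query j s t) (Y \<omega>))) + (\<Sum>\<omega>\<in>?O (-1). g \<omega> * clip (run (Query j s t) (Y \<omega>)))"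
      unfolding split using fin by (intro sum.union_disjoint) auto
    also have "(\<Sum>\<omega>\<in>?O 1. g \<omega> * clip (run (Query j s t) (Y \<omega>))) = (\<Sum>\<omega>\<in>?O 1. g \<omega> * clip (run s (Y \<omega>)))"
      by (intro sum.cong) auto
    also have "(\<Sum>\<omega>\<in>?O (-1). g \<omega> * clip (run (Query j s t) (Y \<omega>))) = (\<Sum>\<omega>\<in>?O (-1). g \<omega> * clip (run t (Y \<omega>)))"
      by (intro sum.cong) auto
    finally show ?thesis using 1 2 r by simp
  qed
qed

lemma hamming_self [simp]: "hamming n y y = 0"
  by (simp add: hamming_def)

text \<open>\<open>v * clip (run t y)\<close> is 1 for a correct answer and at least -1 otherwise,
  hence at least twice the indicator of success minus 1.\<close>

lemma decoder_advantage:
  assumes "measure_pmf.prob D {t. run t y = v} \<ge> 1 / 2 + \<epsilon>" "v = -1 \<or> v = (1::real)"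
  shows "measure_pmf.expectation D (\<lambda>t. v * clip (run t y)) \<ge> 2 * \<epsilon>"
proof -
  let ?I = "\<lambda>t. indicator {t. run t y = v} t :: real"
  have "2 * \<epsilon> \<le> 2 * measure_pmf.prob D {t. run t y = v} - 1" using assms by simp
  also have "\<dots> = measure_pmf.expectation D (\<lambda>t. 2 * ?I t - 1)"
  proof -
    have "integrable (measure_pmf D) ?I"
      by (rule measure_pmf.integrable_const_bound[where B = 1]) auto
    then show ?thesis by simp
  qed
  also have "\<dots> \<le> measure_pmf.expectation D (\<lambda>t. v * clip (run t y))"
    using assms(2) by (intro integral_mono measure_pmf.integrable_const_bound[where B = 3])
      (auto simp: clip_def indicator_def)
  finally show ?thesis .
qed

text \<open>The coordinates in \<open>W\<close> are replaced by fresh random signs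
  \<open>\<zeta>\<close>. A character meeting \<open>W\<close> then averages to zero over
  \<open>\<zeta>\<close>, a nonempty one missing \<open>W\<close> is unchanged, and the empty one
  vanishes because \<open>b i\<close> has mean zero.\<close>

lemma corrupted_correlation:
  assumes E: "E \<in> cube k \<rightarrow> cube n" and i: "i < k" and W: "W \<subseteq> {..<n}"
    and small: "\<And>A. A \<subseteq> {..<n} \<Longrightarrow> card A \<le> q \<Longrightarrow> A \<noteq> {} \<Longrightarrow> A \<inter> W = {} \<Longrightarrow>
      \<bar>\<Sum>b\<in>cube k. b i * chi A (E b)\<bar> \<le> \<eta>"
    and eta: "\<eta> \<ge> 0" and A: "A \<subseteq> {..<n}" "card A \<le> q"
  shows "\<bar>\<Sum>(b, \<zeta>)\<in>cube k \<times> cube n. b i * chi A (\<lambda>j. if j \<in> W then \<zeta> j else E b j)\<bar> \<le> 2 ^ n * \<eta>"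
proof (cases "A \<inter> W = {}")
  case True
  have "chi A (\<lambda>j. if j \<in> W then \<zeta> j else E b j) = chi A (E b)" for b \<zeta>
    unfolding chi_def using True by (intro prod.cong) auto
  then have eq: "(\<Sum>(b, \<zeta>)\<in>cube k \<times> cube n. b i * chi A (\<lambda>j. if j \<in> W then \<zeta> j else E b j))
      = 2 ^ n * (\<Sum>b\<in>cube k. b i * chi A (E b))"
    by (simp add: sum.cartesian_product[symmetric] card_cube sum_distrib_left)
  show ?thesis
  proof (cases "A = {}")
    case True
    have "(\<Sum>b\<in>cube k. b i) = 0" by (rule sum_cube_odd[OF i]) auto
    then show ?thesis unfolding eq using True eta by (simp add: chi_def)
  next
    case False
    then show ?thesis unfolding eq using small[OF A False True] by (simp add: abs_mult)
  qed
next
  case False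
  then obtain j where j: "j \<in> A" "j \<in> W" by auto
  have finA: "finite A" using A finite_subset by blast
  have "(\<Sum>\<zeta>\<in>cube n. b i * chi A (\<lambda>j. if j \<in> W then \<zeta> j else E b j)) = 0" for b
  proof (rule sum_cube_odd[of j])
    show "j < n" using j W by auto
    fix \<zeta> :: "nat \<Rightarrow> real"
    have "chi A (\<lambda>j. if j \<in> W then flip j' \<zeta> j else E b j)
       = - chi A (\<lambda>j. if j \<in> W then \<zeta> j else E b j)" if "j' = j" for j'
      unfolding chi_def prod.remove[OF finA j(1)] using j that
      by (simp cong: prod.cong) (intro disjI2 prod.cong, auto)
    then show "b i * chi A (\<lambda>ja. if ja \<in> W then flip j \<zeta> ja else E b ja) =
         - (b i * chi A (\<lambda>j. if j \<in> W then \<zeta> j else E b j))" by simp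
  qed
  then show ?thesis using eta by (simp add: sum.cartesian_product[symmetric])
qed

text \<open>\<open>H\<close> is a maximal disjoint family of correlated sets, so its union
  \<open>W\<close> meets every correlated set. If \<open>W\<close> had at most
  \<open>\<delta> n\<close> elements, randomising it would leave each tree of depth \<open>q\<close>
  with correlation at most \<open>2 ^ q * (\<epsilon> / 2 ^ q) = \<epsilon>\<close>, contradicting
  the advantage \<open>2 * \<epsilon>\<close>. Sets of size at most \<open>q\<close> then give the
  lower bound on \<open>card H\<close>.\<close>

lemma ldc_normal_form:
  assumes E: "E \<in> cube k \<rightarrow> cube n" and i: "i < k" and d: "\<delta> > 0" and e: "\<epsilon> > 0"
    and qb: "query_bounded q n D"
    and dec: "\<And>b y. b \<in> cube k \<Longrightarrow> y \<in> cube n \<Longrightarrow> real (hamming n y (E b)) \<le> \<delta> * real n \<Longrightarrow>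
      measure_pmf.prob D {t. run t y = b i} \<ge> 1 / 2 + \<epsilon>"
  obtains H where "disjoint H" "real q * real (card H) \<ge> \<delta> * real n" "\<delta> * real n < real n"
    "\<And>C. C \<in> H \<Longrightarrow> C \<subseteq> {..<n} \<and> C \<noteq> {} \<and> card C \<le> q \<and>
       \<bar>\<Sum>b\<in>cube k. b i * chi C (E b)\<bar> \<ge> 2 ^ k * (\<epsilon> / 2 ^ q)"
proof -
  define good where "good = {C. C \<subseteq> {..<n} \<and> C \<noteq> {} \<and> card C \<le> q \<and>
       \<bar>\<Sum>b\<in>cube k. b i * chi C (E b)\<bar> \<ge> 2 ^ k * (\<epsilon> / 2 ^ q)}"
  have "good \<subseteq> Pow {..<n}" by (auto simp: good_def)
  then have fin_good: "finite good" by (rule finite_subset) simp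
  define MM where "MM = {H. H \<subseteq> good \<and> disjoint H}"
  have "finite MM"
    by (rule finite_subset[of _ "Pow good"]) (auto simp: fin_good MM_def)
  moreover have "{} \<in> MM" by (auto simp: disjoint_def MM_def)
  ultimately obtain H where HM: "H \<in> MM" and maxM: "\<And>H'. H' \<in> MM \<Longrightarrow> H \<subseteq> H' \<Longrightarrow> H' = H"
    using finite_has_maximal[of MM] by (metis empty_iff)
  from HM have H: "H \<subseteq> good" "disjoint H" by (auto simp: MM_def)
  have max: "H' = H" if "H' \<subseteq> good" "disjoint H'" "H \<subseteq> H'" for H'
    using maxM[of H'] that by (auto simp: MM_def)
  have finH: "finite H" using H(1) fin_good finite_subset by blast
  define W where "W = \<Union>H"
  have W: "W \<subseteq> {..<n}" using H by (auto simp: W_def good_def)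
  have hit: "C \<inter> W \<noteq> {}" if C: "C \<in> good" for C
  proof
    assume CW: "C \<inter> W = {}"
    have "disjoint (insert C H)"
      using H(2) CW unfolding disjoint_def W_def by auto
    then have "insert C H = H" using max[of "insert C H"] H C by auto
    then have "C \<subseteq> W" by (auto simp: W_def)
    with CW C show False by (auto simp: good_def)
  qed
  \<comment> \<open>Otherwise rerandomising the coordinates in \<open>W\<close> is an admissible corruption that destroys all correlations.\<close>
  have big: "real (card W) > \<delta> * real n"
  proof (rule ccontr)
    assume small: "\<not> ?thesis"
    let ?O = "cube k \<times> cube n"
    let ?Y = "\<lambda>(b, \<zeta>). \<lambda>j. if j \<in> W then \<zeta> j else (E b j :: real)"
    let ?g = "\<lambda>(b, \<zeta>::nat\<Rightarrow>real). (b i :: real)"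
    let ?eta = "2 ^ n * (2 ^ k * (\<epsilon> / 2 ^ q))"
    have Y: "?Y \<omega> \<in> cube n" if "\<omega> \<in> ?O" for \<omega>
    proof -
      obtain b \<zeta> where wb: "\<omega> = (b, \<zeta>)" by force
      then have "E b \<in> cube n" "\<zeta> \<in> cube n" using that E by auto
      then show ?thesis using W by (auto simp: wb cube_def PiE_iff extensional_def)
    qed
    have cor: "\<bar>\<Sum>\<omega>\<in>?O. ?g \<omega> * chi A (?Y \<omega>)\<bar> \<le> ?eta" if "A \<subseteq> {..<n}" "card A \<le> q" for A
    proof -
      have small: "\<bar>\<Sum>b\<in>cube k. b i * chi A (E b)\<bar> \<le> 2 ^ k * (\<epsilon> / 2 ^ q)"
        if "A \<subseteq> {..<n}" "card A \<le> q" "A \<noteq> {}" "A \<inter> W = {}" for A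
      proof (rule ccontr)
        assume "\<not> ?thesis"
        then have "A \<in> good" using that by (simp add: good_def)
        then show False using hit[of A] that by simp
      qed
      have "\<bar>\<Sum>(b, \<zeta>)\<in>?O. b i * chi A (\<lambda>j. if j \<in> W then \<zeta> j else E b j)\<bar> \<le> ?eta"
        by (rule corrupted_correlation[OF E i W]) (use small that e in auto)
      then show ?thesis by (simp only: case_prod_unfold)
    qed
    have tree: "(\<Sum>\<omega>\<in>?O. ?g \<omega> * clip (run t (?Y \<omega>))) \<le> 2 ^ n * 2 ^ k * \<epsilon>" if t: "t \<in> set_pmf D" for t
    proof -
      obtain z where z: "z \<in> cube n" using cube_nonempty by blast
      have "\<bar>\<Sum>\<omega> | \<omega> \<in> ?O \<and> (\<forall>j\<in>{}. ?Y \<omega> j = z j). ?g \<omega> * clip (run t (?Y \<omega>))\<bar> \<le> 2 ^ q * ?eta"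
        using t qb by (intro tree_correlation[OF _ Y cor z]) (auto simp: query_bounded_def)
      then show ?thesis by (simp add: mult_ac)
    qed
    have int: "integrable (measure_pmf D) (\<lambda>t. ?g \<omega> * clip (run t (?Y \<omega>)))" for \<omega>
      by (rule measure_pmf.integrable_const_bound[where B = "\<bar>?g \<omega>\<bar>"]) (auto simp: clip_def split: prod.splits)
    have "(\<Sum>\<omega>\<in>?O. 2 * \<epsilon>) \<le> (\<Sum>\<omega>\<in>?O. measure_pmf.expectation D (\<lambda>t. ?g \<omega> * clip (run t (?Y \<omega>))))"
    proof (rule sum_mono)
      fix \<omega> assume w: "\<omega> \<in> ?O"
      obtain b \<zeta> where wb: "\<omega> = (b, \<zeta>)" by force
      have b: "b \<in> cube k" using w wb by auto
      have "{j. j < n \<and> ?Y \<omega> j \<noteq> E b j} \<subseteq> W" by (auto simp: wb)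
      then have "hamming n (?Y \<omega>) (E b) \<le> card W"
        unfolding hamming_def by (intro card_mono finite_subset[OF W]) auto
      then have "real (hamming n (?Y \<omega>) (E b)) \<le> \<delta> * real n" using small by linarith
      from decoder_advantage[OF dec[OF b Y[OF w] this] cube_values[OF b i]]
      show "2 * \<epsilon> \<le> measure_pmf.expectation D (\<lambda>t. ?g \<omega> * clip (run t (?Y \<omega>)))"
        by (simp add: wb)
    qed
    also have "\<dots> = measure_pmf.expectation D (\<lambda>t. \<Sum>\<omega>\<in>?O. ?g \<omega> * clip (run t (?Y \<omega>)))"
      by (rule Bochner_Integration.integral_sum[symmetric, OF int])
    also have "\<dots> \<le> 2 ^ n * 2 ^ k * \<epsilon>"
      by (intro measure_pmf.integral_le_const Bochner_Integration.integrable_sum int)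
        (auto simp: AE_measure_pmf_iff tree)
    finally show False using e by (simp add: card_cube)
  qed
  have "card W \<le> (\<Sum>C\<in>H. card C)" unfolding W_def by (rule card_Union_le_sum_card)
  also have "\<dots> \<le> (\<Sum>C\<in>H. q)" using H by (intro sum_mono) (auto simp: good_def)
  finally have "card W \<le> card H * q" by simp
  from of_nat_mono[OF this, where 'a = real] have "real q * real (card H) \<ge> \<delta> * real n"
    using big by (simp add: mult.commute)
  moreover have "card W \<le> n" using card_mono[OF _ W] by simp
  then have "\<delta> * real n < real n" using big by linarith
  moreover have "C \<subseteq> {..<n} \<and> C \<noteq> {} \<and> card C \<le> q \<and>
       \<bar>\<Sum>b\<in>cube k. b i * chi C (E b)\<bar> \<ge> 2 ^ k * (\<epsilon> / 2 ^ q)" if "C \<in> H" for C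
    using that H(1) unfolding good_def by blast
  ultimately show ?thesis
    by (intro that[OF H(2)])
qed

section \<open>Greedy grouping of hyperedges\<close>

text \<open>
  Repeatedly pick the set \<open>Q\<close> whose degree, measured in units of \<open>\<Delta> (card Q)\<close>, is largest, and
  remove all edges containing it. The ratios decrease along the process, so an edge set of bounded
  ratio has degrees bounded by the same ratio.
\<close>

lemma greedy_grouping:
  fixes F :: "'e set" and vs :: "'e \<Rightarrow> 'v set" and \<Delta> :: "nat \<Rightarrow> real"
  assumes "finite F" "\<And>e. e \<in> F \<Longrightarrow> finite (vs e) \<and> vs e \<noteq> {}" and \<Delta>: "\<And>t. \<Delta> t > 0"
  shows "\<exists>Q. (\<forall>e\<in>F. Q e \<subseteq> vs e \<and> Q e \<noteq> {}) \<and>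
    (\<forall>U r. U \<noteq> {} \<longrightarrow> r \<ge> 0 \<longrightarrow>
      real (card {e\<in>F. U \<subseteq> vs e \<and> real (card {e'\<in>F. Q e' = Q e}) / \<Delta> (card (Q e)) \<le> r}) \<le> r * \<Delta> (card U))"
  using assms(1,2)
proof (induction F rule: finite_psubset_induct)
  case (psubset F)
  show ?case
  proof (cases "F = {}")
    case True
    then show ?thesis using \<Delta> by (auto simp: less_imp_le)
  next
    case False
    define deg where "deg U = real (card {e\<in>F. U \<subseteq> vs e}) / \<Delta> (card U)" for U
    define \<U> where "\<U> = (\<Union>e\<in>F. Pow (vs e)) - {{}}"
    have "finite \<U>" unfolding \<U>_def using psubset by auto
    moreover have "\<U> \<noteq> {}"
    proof -
      obtain e where "e \<in> F" using False by auto
      then have "vs e \<in> \<U>" using psubset.prems by (auto simp: \<U>_def)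
      then show ?thesis by auto
    qed
    ultimately have Mx: "Max (deg ` \<U>) \<in> deg ` \<U>" and fin\<U>: "finite (deg ` \<U>)" by auto
    from Mx obtain Q0 where Q0: "Q0 \<in> \<U>" and "Max (deg ` \<U>) = deg Q0" by auto
    then have mx: "deg U \<le> deg Q0" if "U \<in> \<U>" for U
      using Max_ge[OF fin\<U>, of "deg U"] that by auto
    define G where "G = {e\<in>F. Q0 \<subseteq> vs e}"
    have "G \<noteq> {}" using Q0 by (auto simp: G_def \<U>_def)
    then have sub: "F - G \<subset> F" by (auto simp: G_def)
    have "\<And>e. e \<in> F - G \<Longrightarrow> finite (vs e) \<and> vs e \<noteq> {}" using psubset.prems by simp
    from psubset.IH[OF sub this] obtain Q'
      where Q': "\<And>e. e \<in> F - G \<Longrightarrow> Q' e \<subseteq> vs e \<and> Q' e \<noteq> {}"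
        and deg': "\<And>U r. U \<noteq> {} \<Longrightarrow> r \<ge> 0 \<Longrightarrow>
          real (card {e\<in>F - G. U \<subseteq> vs e \<and> real (card {e'\<in>F - G. Q' e' = Q' e}) / \<Delta> (card (Q' e)) \<le> r}) \<le> r * \<Delta> (card U)"
      by blast
    define Q where "Q e = (if e \<in> G then Q0 else Q' e)" for e
    \<comment> \<open>Every edge containing \<open>Q0\<close> has left with \<open>G\<close>, so
      \<open>Q0\<close> cannot be chosen again and the two groupings do not merge.\<close>
    have ne: "Q' e \<noteq> Q0" if "e \<in> F - G" for e
      using Q'[OF that] that by (auto simp: G_def)
    have grpG: "{e'\<in>F. Q e' = Q e} = G" if "e \<in> G" for e
      using that ne by (auto simp: Q_def G_def)
    have grpF: "{e'\<in>F. Q e' = Q e} = {e'\<in>F - G. Q' e' = Q' e}" if "e \<in> F - G" for e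
      using that ne[OF that] by (auto simp: Q_def)
    have rG: "real (card {e'\<in>F. Q e' = Q e}) / \<Delta> (card (Q e)) = deg Q0" if "e \<in> G" for e
      using grpG[OF that] that by (simp add: deg_def Q_def G_def)
    show ?thesis
    proof (intro exI[of _ Q] conjI ballI allI impI)
      fix e assume e: "e \<in> F"
      show "Q e \<subseteq> vs e" "Q e \<noteq> {}"
        using Q' e Q0 by (auto simp: Q_def G_def \<U>_def)
    next
      fix U :: "'v set" and r :: real assume U: "U \<noteq> {}" and r: "r \<ge> 0"
      let ?X = "{e\<in>F. U \<subseteq> vs e \<and> real (card {e'\<in>F. Q e' = Q e}) / \<Delta> (card (Q e)) \<le> r}"
      \<comment> \<open>If \<open>r\<close> is at least the maximal ratio, the full degree of
        \<open>U\<close> obeys the bound. Otherwise the ratio of \<open>G\<close> exceeds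
        \<open>r\<close>, no edge of \<open>G\<close> is counted, and the bound for
        \<open>F - G\<close> applies.\<close>
      show "real (card ?X) \<le> r * \<Delta> (card U)"
      proof (cases "deg Q0 \<le> r")
        case True
        show ?thesis
        proof (cases "U \<in> \<U>")
          case UU: True
          have "real (card ?X) \<le> real (card {e\<in>F. U \<subseteq> vs e})"
            using psubset.hyps by (intro of_nat_mono card_mono) auto
          also have "\<dots> = deg U * \<Delta> (card U)"
            using \<Delta>[of "card U"] by (simp add: deg_def)
          also have "\<dots> \<le> r * \<Delta> (card U)"
            using mx[OF UU] True \<Delta>[of "card U"] by (intro mult_right_mono) auto
          finally show ?thesis .
        next
          case UU: False
          then have "?X = {}" using U by (auto simp: \<U>_def)
          then have "card ?X = 0" by (simp only: card.empty)
          then show ?thesis using r \<Delta>[of "card U"] by (simp only: of_nat_0) simp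
        qed
      next
        case False
        have "?X = {e\<in>F - G. U \<subseteq> vs e \<and> real (card {e'\<in>F - G. Q' e' = Q' e}) / \<Delta> (card (Q' e)) \<le> r}"
        proof (rule Collect_cong)
          fix e
          show "(e \<in> F \<and> U \<subseteq> vs e \<and> real (card {e'\<in>F. Q e' = Q e}) / \<Delta> (card (Q e)) \<le> r) =
            (e \<in> F - G \<and> U \<subseteq> vs e \<and> real (card {e'\<in>F - G. Q' e' = Q' e}) / \<Delta> (card (Q' e)) \<le> r)"
          proof (cases "e \<in> F - G")
            case True
            then have "Q e = Q' e" by (simp add: Q_def)
            with grpF[OF True] True show ?thesis by simp
          next
            case nF: False
            then show ?thesis using rG[of e] False by auto
          qed
        qed
        then show ?thesis using deg'[OF U r] by simp
      qed
    qed
  qed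
qed

section \<open>The Kikuchi graph on tuples\<close>

definition tuples :: "nat \<Rightarrow> nat \<Rightarrow> (nat \<Rightarrow> nat) set" where
  "tuples n l = {..<l} \<rightarrow>\<^sub>E {..<n}"

definition occ :: "nat \<Rightarrow> (nat \<Rightarrow> nat) \<Rightarrow> nat \<Rightarrow> nat" where
  "occ l R a = card {z. z < l \<and> R z = a}"

lemma finite_tuples [simp]: "finite (tuples n l)"
  unfolding tuples_def by (intro finite_PiE) auto

lemma prod_one_off: "(\<Prod>i<l::nat. if i \<in> Z then 1 else n) = (n::nat) ^ card ({..<l} - Z)"
proof -
  have "(\<Prod>i<l. if i \<in> Z then 1 else n) = (\<Prod>i\<in>{..<l} - Z. n)"
    by (rule prod.mono_neutral_cong_right) auto
  then show ?thesis by simp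
qed

lemma card_tuples_fix_set:
  assumes "\<And>z. z \<in> Z \<Longrightarrow> f z < n" "Z \<subseteq> {..<l}"
  shows "card {R\<in>tuples n l. \<forall>z\<in>Z. R z = f z} = n ^ (l - card Z)"
proof -
  have "{R\<in>tuples n l. \<forall>z\<in>Z. R z = f z} = PiE {..<l} (\<lambda>i. if i \<in> Z then {f i} else {..<n})" (is "?A = ?B")
  proof (rule set_eqI)
    fix R
    have "(\<forall>i<l. R i \<in> (if i \<in> Z then {f i} else {..<n})) \<longleftrightarrow> (\<forall>i<l. R i < n) \<and> (\<forall>z\<in>Z. R z = f z)"
    proof (intro iffI conjI allI impI ballI)
      fix i assume *: "\<forall>i<l. R i \<in> (if i \<in> Z then {f i} else {..<n})" and i: "i < l"
      show "R i < n" using *[rule_format, OF i] assms(1)[of i] by (cases "i \<in> Z") auto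
    next
      fix z assume *: "\<forall>i<l. R i \<in> (if i \<in> Z then {f i} else {..<n})" and z: "z \<in> Z"
      then have "z < l" using assms(2) by auto
      from *[rule_format, OF this] z show "R z = f z" by simp
    next
      fix i assume "(\<forall>i<l. R i < n) \<and> (\<forall>z\<in>Z. R z = f z)" "i < l"
      then show "R i \<in> (if i \<in> Z then {f i} else {..<n})" by simp
    qed
    then show "R \<in> ?A \<longleftrightarrow> R \<in> ?B" by (simp add: tuples_def PiE_iff Ball_def) blast
  qed
  also have "card \<dots> = (\<Prod>i<l. if i \<in> Z then 1 else n)"
    by (subst card_PiE) (auto intro!: prod.cong)
  also have "\<dots> = n ^ (l - card Z)"
    using assms(2) by (simp add: prod_one_off card_Diff_subset finite_subset[OF assms(2)])
  finally show ?thesis .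
qed

lemma card_tuples_fix:
  assumes "a < n" "z < l"
  shows "card {R\<in>tuples n l. R z = a} = n ^ (l - 1)"
  using card_tuples_fix_set[of "{z}" "\<lambda>_. a" n l] assms by simp

lemma card_tuples_fix2:
  assumes "a < n" "a' < n" "z < l" "z' < l" "z \<noteq> z'"
  shows "card {R\<in>tuples n l. R z = a \<and> R z' = a'} = n ^ (l - 2)"
  using card_tuples_fix_set[of "{z, z'}" "\<lambda>i. if i = z then a else a'" n l] assms by (auto simp: numeral_2_eq_2)

lemma occ_eq_sum: "real (occ l R a) = (\<Sum>z<l. if R z = a then 1 else 0)"
proof -
  have "{z. z < l \<and> R z = a} = {z \<in> {..<l}. R z = a}" by auto
  then show ?thesis by (simp add: occ_def sum.inter_filter[symmetric])
qed

lemma sum_occ: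
  assumes "a < n"
  shows "(\<Sum>R\<in>tuples n l. real (occ l R a)) = real l * real n ^ (l - 1)"
proof -
  have "(\<Sum>R\<in>tuples n l. real (occ l R a)) = (\<Sum>z<l. \<Sum>R\<in>tuples n l. if R z = a then 1 else 0)"
    unfolding occ_eq_sum by (rule sum.swap)
  also have "\<dots> = (\<Sum>z<l. real (card {R\<in>tuples n l. R z = a}))"
    by (intro sum.cong refl) (simp add: sum.inter_filter[symmetric])
  also have "\<dots> = (\<Sum>z<l. real n ^ (l - 1))"
    using assms by (intro sum.cong refl) (simp add: card_tuples_fix)
  finally show ?thesis by simp
qed

text \<open>Equal positions contribute only if \<open>a = a'\<close>; two distinct positions are
  independent and cost a further factor \<open>1 / n\<close> each. This produces the agreement
  factor \<open>1 + w\<close> or \<open>w\<close> per tuple.\<close>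

lemma sum_occ_occ:
  assumes "a < n" "a' < n"
  shows "(\<Sum>R\<in>tuples n l. real (occ l R a) * real (occ l R a'))
    \<le> real l * real n ^ (l - 1) * ((if a = a' then 1 else 0) + real l / real n)"
proof -
  have n: "real n > 0" using assms by simp
  have "(\<Sum>R\<in>tuples n l. real (occ l R a) * real (occ l R a'))
      = (\<Sum>R\<in>tuples n l. \<Sum>z<l. \<Sum>z'<l. if R z = a \<and> R z' = a' then 1 else 0)"
    unfolding occ_eq_sum sum_product by (intro sum.cong refl) auto
  also have "\<dots> = (\<Sum>z<l. \<Sum>z'<l. \<Sum>R\<in>tuples n l. if R z = a \<and> R z' = a' then 1 else 0)"
    by (simp add: sum.swap[of _ _ "tuples n l"])
  also have "\<dots> = (\<Sum>z<l. \<Sum>z'<l. real (card {R\<in>tuples n l. R z = a \<and> R z' = a'}))"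
    by (intro sum.cong refl) (simp add: sum.inter_filter[symmetric])
  also have "\<dots> \<le> (\<Sum>z<l. \<Sum>z'<l. (if z' = z then (if a = a' then real n ^ (l - 1) else 0) else 0) + real n ^ (l - 1) / real n)"
  proof (intro sum_mono)
    fix z z' assume z: "z \<in> {..<l}" "z' \<in> {..<l}"
    show "real (card {R\<in>tuples n l. R z = a \<and> R z' = a'})
      \<le> (if z' = z then (if a = a' then real n ^ (l - 1) else 0) else 0) + real n ^ (l - 1) / real n"
    proof (cases "z' = z")
      case True
      show ?thesis
      proof (cases "a = a'")
        case aa: True
        then show ?thesis using True z assms n by (simp add: card_tuples_fix)
      next
        case False
        then have "card {R\<in>tuples n l. R z = a \<and> R z' = a'} = 0" using True by (auto simp: card_eq_0_iff)
        then show ?thesis using False by (simp only: of_nat_0) simp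
      qed
    next
      case False
      then have l2: "l \<ge> 2" using z by auto
      have "card {R\<in>tuples n l. R z = a \<and> R z' = a'} = n ^ (l - 2)"
        using False z assms by (intro card_tuples_fix2) auto
      moreover have "real n ^ (l - 1) = real n ^ (l - 2) * real n"
      proof -
        have "l - 1 = Suc (l - 2)" using l2 by simp
        then show ?thesis by simp
      qed
      ultimately show ?thesis using False n by simp
    qed
  qed
  also have "\<dots> = real l * real n ^ (l - 1) * ((if a = a' then 1 else 0) + real l / real n)"
    by (simp add: sum.distrib algebra_simps)
  finally show ?thesis .
qed

text \<open>
  A vertex of the Kikuchi graph consists of \<open>s\<close> tuples of length \<open>l\<close>; the \<open>y\<close>-th element of a hyperedge
  is searched for in the \<open>y\<close>-th tuple only. Tuples instead of sets make second moments
  factor over \<open>y\<close>.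
\<close>

definition verts :: "nat \<Rightarrow> nat \<Rightarrow> nat \<Rightarrow> (nat \<Rightarrow> nat \<Rightarrow> nat) set" where
  "verts n l s = {..<s} \<rightarrow>\<^sub>E tuples n l"

definition hits :: "nat \<Rightarrow> nat \<Rightarrow> (nat \<Rightarrow> nat \<Rightarrow> nat) \<Rightarrow> (nat \<Rightarrow> nat) \<Rightarrow> nat" where
  "hits l s S a = (\<Prod>y<s. occ l (S y) (a y))"

definition placements :: "nat \<Rightarrow> nat \<Rightarrow> (nat \<Rightarrow> nat \<Rightarrow> nat) \<Rightarrow> (nat \<Rightarrow> nat) \<Rightarrow> (nat \<Rightarrow> nat) set" where
  "placements l s S a = {\<pi> \<in> {..<s} \<rightarrow>\<^sub>E {..<l}. \<forall>y<s. S y (\<pi> y) = a y}"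

text \<open>A slot is a potential edge seen from one end: writing \<open>b y\<close> in place of
  \<open>a y\<close> at the positions \<open>\<pi>\<close> gives the other end. Since
  \<open>overwrite\<close> is undone by a second overwriting, the slots of \<open>a\<close> and of
  \<open>b\<close> correspond bijectively.\<close>

definition slots :: "nat \<Rightarrow> nat \<Rightarrow> nat \<Rightarrow> (nat \<Rightarrow> nat) \<Rightarrow> ((nat \<Rightarrow> nat) \<times> (nat \<Rightarrow> nat \<Rightarrow> nat)) set" where
  "slots n l s a = {(\<pi>, S). S \<in> verts n l s \<and> \<pi> \<in> placements l s S a}"

definition overwrite :: "nat \<Rightarrow> (nat \<Rightarrow> nat) \<Rightarrow> (nat \<Rightarrow> nat) \<Rightarrow> (nat \<Rightarrow> nat \<Rightarrow> nat) \<Rightarrow> nat \<Rightarrow> nat \<Rightarrow> nat" where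
  "overwrite s b \<pi> S = (\<lambda>y. if y < s then (S y)(\<pi> y := b y) else undefined)"

lemma finite_verts [simp]: "finite (verts n l s)"
  unfolding verts_def by (intro finite_PiE) auto

lemma card_verts: "card (verts n l s) = n ^ (l * s)"
  by (simp add: verts_def tuples_def card_PiE power_mult)

lemma finite_placements [simp]: "finite (placements l s S a)"
  by (rule finite_subset[of _ "{..<s} \<rightarrow>\<^sub>E {..<l}"]) (auto simp: placements_def intro!: finite_PiE)

lemma card_placements: "card (placements l s S a) = hits l s S a"
proof -
  have "placements l s S a = PiE {..<s} (\<lambda>y. {z. z < l \<and> S y z = a y})"
    by (rule set_eqI) (simp add: placements_def PiE_iff Ball_def, blast)
  then show ?thesis by (simp add: card_PiE hits_def occ_def)
qed

lemma slots_eq: "slots n l s a = (\<lambda>(S, \<pi>). (\<pi>, S)) ` (SIGMA S:verts n l s. placements l s S a)"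
  by (auto simp: slots_def image_iff)

lemma finite_slots [simp]: "finite (slots n l s a)"
  unfolding slots_eq by auto

lemma card_slots_filter:
  "card {(\<pi>, S) \<in> slots n l s a. P S} = (\<Sum>S | S \<in> verts n l s \<and> P S. hits l s S a)"
proof -
  have "{(\<pi>, S) \<in> slots n l s a. P S} = (\<lambda>(S, \<pi>). (\<pi>, S)) ` (SIGMA S:{S\<in>verts n l s. P S}. placements l s S a)"
    by (auto simp: slots_def image_iff)
  then have "card {(\<pi>, S) \<in> slots n l s a. P S} = card (SIGMA S:{S\<in>verts n l s. P S}. placements l s S a)"
    by (simp add: card_image inj_on_def case_prod_unfold)
  then show ?thesis by (simp add: card_placements)
qed

lemma sum_hits:
  assumes "\<And>y. y < s \<Longrightarrow> a y < n"
  shows "(\<Sum>S\<in>verts n l s. real (hits l s S a)) = (real l * real n ^ (l - 1)) ^ s"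
proof -
  have "(\<Sum>S\<in>verts n l s. real (hits l s S a)) = (\<Sum>S\<in>verts n l s. \<Prod>y<s. real (occ l (S y) (a y)))"
    by (simp add: hits_def)
  also have "\<dots> = (\<Prod>y<s. \<Sum>R\<in>tuples n l. real (occ l R (a y)))"
    unfolding verts_def by (rule prod_sum_PiE[symmetric]) auto
  also have "\<dots> = (\<Prod>y<s. real l * real n ^ (l - 1))"
    using assms by (intro prod.cong refl sum_occ) auto
  finally show ?thesis by simp
qed

lemma sum_hits_hits:
  assumes "\<And>y. y < s \<Longrightarrow> a y < n" "\<And>y. y < s \<Longrightarrow> a' y < n"
  shows "(\<Sum>S\<in>verts n l s. real (hits l s S a) * real (hits l s S a'))
    \<le> (real l * real n ^ (l - 1)) ^ s * (\<Prod>y<s. (if a y = a' y then 1 else 0) + real l / real n)"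
proof -
  have "(\<Sum>S\<in>verts n l s. real (hits l s S a) * real (hits l s S a'))
      = (\<Sum>S\<in>verts n l s. \<Prod>y<s. real (occ l (S y) (a y)) * real (occ l (S y) (a' y)))"
    by (simp add: hits_def prod.distrib)
  also have "\<dots> = (\<Prod>y<s. \<Sum>R\<in>tuples n l. real (occ l R (a y)) * real (occ l R (a' y)))"
    unfolding verts_def by (rule prod_sum_PiE[symmetric]) auto
  also have "\<dots> \<le> (\<Prod>y<s. real l * real n ^ (l - 1) * ((if a y = a' y then 1 else 0) + real l / real n))"
    using assms by (intro prod_mono conjI sum_nonneg sum_occ_occ) auto
  also have "\<dots> = (real l * real n ^ (l - 1)) ^ s * (\<Prod>y<s. (if a y = a' y then 1 else 0) + real l / real n)"
    by (simp only: prod.distrib prod_constant card_lessThan power_mult_distrib)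
  finally show ?thesis .
qed

section \<open>Pruning the slots at vertices of large degree\<close>

lemma overwrite_in_slots:
  assumes "(\<pi>, S) \<in> slots n l s a" "\<And>y. y < s \<Longrightarrow> b y < n"
  shows "(\<pi>, overwrite s b \<pi> S) \<in> slots n l s b"
  using assms by (auto simp: slots_def placements_def verts_def tuples_def overwrite_def PiE_iff extensional_def)

lemma overwrite_overwrite:
  assumes "(\<pi>, S) \<in> slots n l s a"
  shows "overwrite s a \<pi> (overwrite s b \<pi> S) = S"
proof
  fix y
  show "overwrite s a \<pi> (overwrite s b \<pi> S) y = S y"
    using assms by (cases "y < s") (auto simp: overwrite_def slots_def placements_def verts_def PiE_iff extensional_def)
qed

text \<open>Markov's inequality for a random slot of \<open>P0\<close>, that is, for a vertex chosen
  with weight \<open>hits l s S (a P0)\<close>. The second moment estimate says that the mean degree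
  under this size-biased law is at most \<open>M\<close>, so at most a quarter of the slots see more
  than \<open>4 * M\<close>.\<close>

lemma few_bad_slots:
  assumes P0: "P0 \<in> \<P>" and a: "\<And>P y. P \<in> \<P> \<Longrightarrow> y < s \<Longrightarrow> a P y < n" and M: "M > 0"
    and bound: "(\<Sum>P\<in>\<P>. \<Prod>y<s. (if a P0 y = a P y then 1 else 0) + real l / real n) \<le> M"
  shows "4 * real (card {(\<pi>, S) \<in> slots n l s (a P0). (\<Sum>P\<in>\<P>. real (hits l s S (a P))) > 4 * M})
    \<le> (real l * real n ^ (l - 1)) ^ s"
proof -
  let ?h = "\<lambda>S. real (hits l s S (a P0))" and ?d = "\<lambda>S. \<Sum>P\<in>\<P>. real (hits l s S (a P))"
  let ?T = "(real l * real n ^ (l - 1)) ^ s"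
  let ?B = "{S. S \<in> verts n l s \<and> ?d S > 4 * M}"
  have "(4 * M) * real (card {(\<pi>, S) \<in> slots n l s (a P0). ?d S > 4 * M}) = (\<Sum>S\<in>?B. ?h S * (4 * M))"
    by (simp add: card_slots_filter sum_distrib_left mult_ac)
  also have "\<dots> \<le> (\<Sum>S\<in>?B. ?h S * ?d S)"
    by (intro sum_mono mult_left_mono) auto
  also have "\<dots> \<le> (\<Sum>S\<in>verts n l s. ?h S * ?d S)"
    by (intro sum_mono2) (auto intro!: mult_nonneg_nonneg sum_nonneg)
  also have "\<dots> = (\<Sum>P\<in>\<P>. \<Sum>S\<in>verts n l s. ?h S * real (hits l s S (a P)))"
    by (subst sum.swap) (simp add: sum_distrib_left)
  also have "\<dots> \<le> (\<Sum>P\<in>\<P>. ?T * (\<Prod>y<s. (if a P0 y = a P y then 1 else 0) + real l / real n))"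
    using a P0 by (intro sum_mono sum_hits_hits) auto
  also have "\<dots> = ?T * (\<Sum>P\<in>\<P>. \<Prod>y<s. (if a P0 y = a P y then 1 else 0) + real l / real n)"
    by (simp add: sum_distrib_left)
  also have "\<dots> \<le> ?T * M"
    using bound by (intro mult_left_mono) auto
  finally have "M * (4 * real (card {(\<pi>, S) \<in> slots n l s (a P0). ?d S > 4 * M})) \<le> M * ?T"
    by (simp add: mult_ac)
  then show ?thesis using M by (simp only: mult_le_cancel_left_pos)
qed

text \<open>Row and column ends each spoil at most a quarter of the slots, the column end being
  transported by \<open>overwrite\<close>; half remain.\<close>

lemma many_good_slots:
  assumes P0: "P0 \<in> \<P>"
    and a: "\<And>P y. P \<in> \<P> \<Longrightarrow> y < s \<Longrightarrow> a P y < n" and b: "\<And>P y. P \<in> \<P> \<Longrightarrow> y < s \<Longrightarrow> b P y < n" and M: "M > 0"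
    and bound_a: "(\<Sum>P\<in>\<P>. \<Prod>y<s. (if a P0 y = a P y then 1 else 0) + real l / real n) \<le> M"
    and bound_b: "(\<Sum>P\<in>\<P>. \<Prod>y<s. (if b P0 y = b P y then 1 else 0) + real l / real n) \<le> M"
  shows "(real l * real n ^ (l - 1)) ^ s \<le> 2 * real (card {(\<pi>, S) \<in> slots n l s (a P0).
     (\<Sum>P\<in>\<P>. real (hits l s S (a P))) \<le> 4 * M \<and> (\<Sum>P\<in>\<P>. real (hits l s (overwrite s (b P0) \<pi> S) (b P))) \<le> 4 * M})"
proof -
  let ?T = "(real l * real n ^ (l - 1)) ^ s"
  let ?K = "slots n l s (a P0)"
  let ?da = "\<lambda>S. \<Sum>P\<in>\<P>. real (hits l s S (a P))" and ?db = "\<lambda>S. \<Sum>P\<in>\<P>. real (hits l s S (b P))"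
  let ?G = "{(\<pi>, S) \<in> ?K. ?da S \<le> 4 * M \<and> ?db (overwrite s (b P0) \<pi> S) \<le> 4 * M}"
  let ?A = "{(\<pi>, S) \<in> ?K. ?da S > 4 * M}"
  let ?B = "{(\<pi>, S) \<in> ?K. ?db (overwrite s (b P0) \<pi> S) > 4 * M}"
  let ?B' = "{(\<pi>, S) \<in> slots n l s (b P0). ?db S > 4 * M}"
  have "real (card ?K) = ?T"
  proof -
    have "card ?K = (\<Sum>S\<in>verts n l s. hits l s S (a P0))"
      using card_slots_filter[of n l s "a P0" "\<lambda>_. True"] by simp
    then show ?thesis using sum_hits[of s "a P0" n l] a[OF P0] by simp
  qed
  moreover have "card ?K \<le> card ?G + card ?A + card ?B"
  proof -
    have "?K = ?G \<union> ?A \<union> ?B" by auto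
    then have "card ?K = card (?G \<union> ?A \<union> ?B)" by simp
    also have "\<dots> \<le> card ?G + card ?A + card ?B"
      by (meson add_right_mono card_Un_le le_trans)
    finally show ?thesis .
  qed
  moreover have "4 * real (card ?A) \<le> ?T"
    by (rule few_bad_slots[OF P0 a M bound_a])
  moreover have "card ?B \<le> card ?B'"
  proof (rule card_inj_on_le)
    show "inj_on (\<lambda>(\<pi>, S). (\<pi>, overwrite s (b P0) \<pi> S)) ?B"
      by (rule inj_on_inverseI[where g = "\<lambda>(\<pi>, S). (\<pi>, overwrite s (a P0) \<pi> S)"]) (auto simp: overwrite_overwrite)
    show "(\<lambda>(\<pi>, S). (\<pi>, overwrite s (b P0) \<pi> S)) ` ?B \<subseteq> ?B'"
      using b[OF P0] by (auto intro: overwrite_in_slots)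
    show "finite ?B'" by (rule finite_subset[OF _ finite_slots]) auto
  qed
  moreover have "4 * real (card ?B') \<le> ?T"
    by (rule few_bad_slots[OF P0 b M bound_b])
  ultimately show ?thesis by linarith
qed

section \<open>Degrees in the Kikuchi graph\<close>

text \<open>
  With \<open>w = l / n\<close> the degree of a vertex set of size \<open>u\<close> is compared with \<open>max 1 (n w\<^sup>u)\<close>. At the scale
  \<open>n\<^sup>2 w\<^sup>q \<ge> 1\<close> these thresholds make every overlap pattern contribute at most the mean to the
  row degrees of the Kikuchi matrix, for all parities of \<open>q\<close>.
\<close>

definition threshold :: "nat \<Rightarrow> nat \<Rightarrow> nat \<Rightarrow> real" where
  "threshold n l u = max 1 (real n * (real l / real n) ^ u)"

text \<open>
  In a pair \<open>(e, e')\<close> a row carries the elements of \<open>e\<close> at slots \<open>Y\<close> and those of \<open>e'\<close> elsewhere; the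
  matching column has the roles exchanged. Splitting both edges in half this way works even if
  \<open>s\<close> is odd.
\<close>

definition mix :: "nat set \<Rightarrow> ('e \<Rightarrow> nat \<Rightarrow> nat) \<Rightarrow> 'e \<times> 'e \<Rightarrow> nat \<Rightarrow> nat" where
  "mix Y en P y = (if y \<in> Y then en (fst P) y else en (snd P) y)"

lemma threshold_ge_1: "threshold n l u \<ge> 1" and threshold_pos: "threshold n l u > 0"
  by (auto simp: threshold_def)

text \<open>A piece of the hypergraph in which all sets \<open>Q e\<close> have one size
  \<open>t\<close> and all remainders one size \<open>s\<close>. The enumeration \<open>en\<close>
  decides in which of the \<open>s\<close> tuples each element of a remainder is searched for;
  \<open>\<kappa>\<close> caps the degree ratio.\<close>

locale grouped_matchings =
  fixes F :: "(nat \<times> nat set) set" and Q :: "nat \<times> nat set \<Rightarrow> nat set"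
    and en :: "nat \<times> nat set \<Rightarrow> nat \<Rightarrow> nat" and n l t s :: nat and \<kappa> :: real
  assumes finite_F: "finite F" and edge_sub: "e \<in> F \<Longrightarrow> snd e \<subseteq> {..<n}"
    and Q_sub: "e \<in> F \<Longrightarrow> Q e \<subseteq> snd e" and Q_ne: "e \<in> F \<Longrightarrow> Q e \<noteq> {}"
    and Q_card: "e \<in> F \<Longrightarrow> card (Q e) = t"
    and en_bij: "e \<in> F \<Longrightarrow> bij_betw (en e) {..<s} (snd e - Q e)"
    and matching: "e \<in> F \<Longrightarrow> e' \<in> F \<Longrightarrow> fst e = fst e' \<Longrightarrow> snd e \<inter> snd e' \<noteq> {} \<Longrightarrow> e = e'"
    and deg: "U \<noteq> {} \<Longrightarrow> real (card {e\<in>F. U \<subseteq> snd e}) \<le> \<kappa> * threshold n l (card U)"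
    and l_pos: "0 < l" and l_le: "l \<le> n" and kappa: "\<kappa> > 0"
    and scale: "1 \<le> (real n)\<^sup>2 * (real l / real n) ^ (s + t)"
begin

abbreviation "w \<equiv> real l / real n"
abbreviation "\<Delta> \<equiv> threshold n l"

lemma n_pos: "0 < n" using l_pos l_le by simp

lemma w_pos: "0 < w" and w_le: "w \<le> 1"
  using l_pos l_le by (auto simp: divide_le_eq)

lemma en_in: "e \<in> F \<Longrightarrow> y < s \<Longrightarrow> en e y \<in> snd e - Q e"
  using en_bij[of e] by (auto dest: bij_betwE)

lemma en_lt: "e \<in> F \<Longrightarrow> y < s \<Longrightarrow> en e y < n"
  using en_in edge_sub by blast

lemma card_label_class: "card {e\<in>F. fst e = i} \<le> n"
proof -
  have "card {e\<in>F. fst e = i} \<le> card {..<n}"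
  proof (rule card_inj_on_le[where f = "\<lambda>e. SOME v. v \<in> snd e"])
    have in_e: "(SOME v. v \<in> snd e) \<in> snd e" if "e \<in> F" for e
      using that Q_sub[of e] Q_ne[of e] by (metis ex_in_conv someI_ex subset_empty)
    show "inj_on (\<lambda>e. SOME v. v \<in> snd e) {e\<in>F. fst e = i}"
    proof (rule inj_onI)
      fix e e' assume *: "e \<in> {e\<in>F. fst e = i}" "e' \<in> {e\<in>F. fst e = i}"
        "(SOME v. v \<in> snd e) = (SOME v. v \<in> snd e')"
      then have "snd e \<inter> snd e' \<noteq> {}" using in_e[of e] in_e[of e'] by auto
      then show "e = e'" using * matching by auto
    qed
    show "(\<lambda>e. SOME v. v \<in> snd e) ` {e\<in>F. fst e = i} \<subseteq> {..<n}"
      using in_e edge_sub by blast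
  qed simp
  then show ?thesis by simp
qed

lemma group_le: "e \<in> F \<Longrightarrow> real (card {e'\<in>F. Q e' = Q e}) \<le> \<kappa> * \<Delta> t"
proof -
  assume e: "e \<in> F"
  have "card {e'\<in>F. Q e' = Q e} \<le> card {e'\<in>F. Q e \<subseteq> snd e'}"
    using Q_sub finite_F by (intro card_mono) auto
  then show ?thesis using deg[OF Q_ne[OF e]] Q_card[OF e] by simp
qed

lemma power_w_le: "i \<le> j \<Longrightarrow> w ^ j \<le> w ^ i"
  using w_pos w_le by (intro power_decreasing) auto

text \<open>Used when \<open>j1\<close> agreements lie in the first edge and \<open>j2\<close> in
  the second, and the second edge must contain \<open>Q\<close> and \<open>j2\<close> further
  elements. In the maximum defining the left side, 1 is handled by the scale and the power by
  \<open>n w^j1 \<ge> 1\<close>.\<close>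

lemma threshold_first:
  assumes "j1 + j2 \<le> s" "1 \<le> real n * w ^ j1"
  shows "\<Delta> (t + j2) \<le> real n * \<Delta> t * w ^ (j1 + j2)"
proof -
  have nn: "real n * \<Delta> t * w ^ (j1 + j2) \<ge> real n * (real n * w ^ t) * w ^ (j1 + j2)"
    using w_pos by (intro mult_right_mono mult_left_mono) (auto simp: threshold_def)
  have "1 \<le> (real n)\<^sup>2 * w ^ (s + t)" by (rule scale)
  also have "\<dots> \<le> (real n)\<^sup>2 * w ^ (j1 + j2 + t)"
    using assms by (intro mult_left_mono power_w_le) auto
  also have "\<dots> = real n * (real n * w ^ t) * w ^ (j1 + j2)"
    by (simp add: power2_eq_square power_add mult_ac)
  finally have 1: "1 \<le> real n * (real n * w ^ t) * w ^ (j1 + j2)" .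
  have "real n * w ^ (t + j2) * 1 \<le> real n * w ^ (t + j2) * (real n * w ^ j1)"
    using assms(2) w_pos by (intro mult_left_mono) auto
  also have "\<dots> = real n * (real n * w ^ t) * w ^ (j1 + j2)"
    by (simp add: power_add mult_ac)
  finally have 2: "real n * w ^ (t + j2) \<le> real n * (real n * w ^ t) * w ^ (j1 + j2)" by simp
  from 1 2 nn show ?thesis unfolding threshold_def[of n l "t + j2"] by simp
qed

text \<open>Used when all \<open>j\<close> agreements lie in the second edge, which then contains
  \<open>j\<close> prescribed elements.\<close>

lemma threshold_second:
  assumes "1 \<le> real n * w ^ j"
  shows "\<Delta> j \<le> real n * \<Delta> t * w ^ j"
proof -
  have "\<Delta> j = real n * w ^ j" using assms by (simp add: threshold_def)
  also have "\<dots> = real n * 1 * w ^ j" by simp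
  also have "\<dots> \<le> real n * \<Delta> t * w ^ j"
    using w_pos threshold_ge_1[of n l t] by (intro mult_right_mono mult_left_mono) auto
  finally show ?thesis .
qed

text \<open>Once its label is \<open>i\<close>, the first edge is determined by any one of its
  elements. An agreement inside \<open>Y\<close> therefore fixes the first edge, leaving a second
  edge through \<open>Q\<close> and the remaining agreements. If all agreements lie outside
  \<open>Y\<close>, they restrict the second edge, and its set \<open>Q\<close> then fixes the
  first. Without agreement there are at most \<open>n\<close> first edges and a group of second
  ones.\<close>

lemma count_agreeing_pairs:
  assumes P: "\<P> \<subseteq> {(e, e'). e \<in> F \<and> e' \<in> F \<and> fst e = i \<and> Q e = Q e'}" and P0: "P0 \<in> \<P>"
    and J: "J \<subseteq> {..<s}"
    and h1: "1 \<le> real n * w ^ card ({..<s} \<inter> Y)" and h2: "1 \<le> real n * w ^ card ({..<s} - Y)"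
  shows "real (card {P\<in>\<P>. \<forall>y\<in>J. mix Y en P0 y = mix Y en P y}) \<le> \<kappa> * (real n * \<Delta> t * w ^ card J)"
proof -
  let ?X = "{P\<in>\<P>. \<forall>y\<in>J. mix Y en P0 y = mix Y en P y}"
  obtain e0 e0' where P0e: "P0 = (e0, e0')" by (cases P0)
  then have e0: "e0 \<in> F" "e0' \<in> F" "fst e0 = i" "Q e0 = Q e0'" using P P0 by auto
  have finJ: "finite J" using J finite_subset by blast
  have inj: "inj_on (en e0') (J - Y)"
    using en_bij[OF e0(2)] J by (auto simp: bij_betw_def intro: inj_on_subset)
  have card_split: "card J = card (J \<inter> Y) + card (J - Y)"
    using finJ by (metis card_Int_Diff)
  have PD: "fst R \<in> F \<and> snd R \<in> F \<and> fst (fst R) = i \<and> Q (fst R) = Q (snd R)" if "R \<in> \<P>" for R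
    using subsetD[OF P that] by (simp add: case_prod_unfold)
  have uniq: "fst P = e" if "P \<in> \<P>" "(e, snd P) \<in> \<P>" for P e
  proof -
    have "Q (fst P) = Q e" "fst P \<in> F" "e \<in> F" "fst (fst P) = fst e" using PD[OF that(1)] PD[OF that(2)] by auto
    moreover from this have "snd (fst P) \<inter> snd e \<noteq> {}"
      using Q_sub[of e] Q_sub[of "fst P"] Q_ne[of e] by auto
    ultimately show ?thesis using matching by blast
  qed
  consider (first) "J \<inter> Y \<noteq> {}" | (second) "J \<inter> Y = {}" "J \<noteq> {}" | (none) "J = {}" by blast
  then show ?thesis
  proof cases
    case first
    then obtain y where y: "y \<in> J" "y \<in> Y" by auto
    let ?U = "Q e0' \<union> en e0' ` (J - Y)"
    have "?X \<subseteq> {e0} \<times> {e'\<in>F. ?U \<subseteq> snd e'}"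
    proof
      fix P assume PX: "P \<in> ?X"
      obtain e e' where Pe: "P = (e, e')" by (cases P)
      have e: "e \<in> F" "e' \<in> F" "fst e = i" "Q e = Q e'" using PX P Pe by auto
      have agree: "mix Y en (e0, e0') z = mix Y en (e, e') z" if "z \<in> J" for z
        using PX that Pe P0e by auto
      have "en e0 y = en e y" using agree[OF y(1)] y by (simp add: mix_def)
      then have "en e0 y \<in> snd e0 \<inter> snd e"
        using en_in[OF e0(1), of y] en_in[OF e(1), of y] y J by auto
      then have ee: "e0 = e" using matching[OF e0(1) e(1)] e e0 by auto
      have "en e0' z \<in> snd e'" if "z \<in> J - Y" for z
      proof -
        have "en e0' z = en e' z" using agree[of z] that by (simp add: mix_def)
        then show ?thesis using en_in[OF e(2), of z] that J by auto
      qed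
      moreover have "Q e0' \<subseteq> snd e'" using ee e e0 Q_sub[of e'] by simp
      ultimately show "P \<in> {e0} \<times> {e'\<in>F. ?U \<subseteq> snd e'}" using Pe ee e by auto
    qed
    then have "card ?X \<le> card ({e0} \<times> {e'\<in>F. ?U \<subseteq> snd e'})"
      using finite_F by (intro card_mono) auto
    then have "real (card ?X) \<le> real (card {e'\<in>F. ?U \<subseteq> snd e'})" by (simp add: card_cartesian_product)
    also have "\<dots> \<le> \<kappa> * \<Delta> (card ?U)" using Q_ne[OF e0(2)] by (intro deg) auto
    also have "card ?U = t + card (J - Y)"
    proof -
      have "finite (Q e0')" using Q_sub[OF e0(2)] edge_sub[OF e0(2)] by (meson finite_lessThan finite_subset)
      moreover have "Q e0' \<inter> en e0' ` (J - Y) = {}" using en_in[OF e0(2)] J by fastforce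
      ultimately show ?thesis
        using finJ by (simp add: card_Un_disjoint card_image[OF inj] Q_card[OF e0(2)])
    qed
    also have "\<Delta> (t + card (J - Y)) \<le> real n * \<Delta> t * w ^ (card (J \<inter> Y) + card (J - Y))"
    proof (rule threshold_first)
      show "card (J \<inter> Y) + card (J - Y) \<le> s"
        using card_mono[OF _ J] card_split by simp
      have "card (J \<inter> Y) \<le> card ({..<s} \<inter> Y)" using J by (intro card_mono) auto
      then have "w ^ card ({..<s} \<inter> Y) \<le> w ^ card (J \<inter> Y)" by (rule power_w_le)
      then have "real n * w ^ card ({..<s} \<inter> Y) \<le> real n * w ^ card (J \<inter> Y)" by (intro mult_left_mono) auto
      with h1 show "1 \<le> real n * w ^ card (J \<inter> Y)" by linarith
    qed
    finally show ?thesis using kappa card_split by (simp add: mult_left_mono)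
  next
    case second
    have "card ?X \<le> card {e'\<in>F. en e0' ` J \<subseteq> snd e'}"
    proof (rule card_inj_on_le[where f = snd])
      show "inj_on snd ?X"
      proof (rule inj_onI)
        fix P P' assume *: "P \<in> ?X" "P' \<in> ?X" "snd P = snd P'"
        then have "P \<in> \<P>" "(fst P', snd P) \<in> \<P>" by auto
        from uniq[OF this] * show "P = P'"
          by (simp add: prod_eq_iff)
      qed
      show "snd ` ?X \<subseteq> {e'\<in>F. en e0' ` J \<subseteq> snd e'}"
      proof (rule image_subsetI)
        fix P assume PX: "P \<in> ?X"
        then have e: "snd P \<in> F" using PD by auto
        have "en e0' z \<in> snd (snd P)" if "z \<in> J" for z
        proof -
          have "mix Y en P0 z = mix Y en P z" using PX that by simp
          moreover have "z \<notin> Y" using that second by auto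
          ultimately have "en e0' z = en (snd P) z" using P0e by (simp add: mix_def)
          then show ?thesis using en_in[OF e, of z] that J by auto
        qed
        then show "snd P \<in> {e'\<in>F. en e0' ` J \<subseteq> snd e'}" using e by auto
      qed
    qed (simp add: finite_F)
    then have "real (card ?X) \<le> real (card {e'\<in>F. en e0' ` J \<subseteq> snd e'})" by simp
    also have "\<dots> \<le> \<kappa> * \<Delta> (card (en e0' ` J))" using second by (intro deg) auto
    also have "card (en e0' ` J) = card J"
    proof -
      have "J - Y = J" using second by auto
      with inj show ?thesis by (simp add: card_image)
    qed
    also have "\<Delta> (card J) \<le> real n * \<Delta> t * w ^ card J"
    proof (rule threshold_second)
      have "card J \<le> card ({..<s} - Y)" using J second by (intro card_mono) auto
      then have "w ^ card ({..<s} - Y) \<le> w ^ card J" by (rule power_w_le)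
      then have "real n * w ^ card ({..<s} - Y) \<le> real n * w ^ card J" by (intro mult_left_mono) auto
      with h2 show "1 \<le> real n * w ^ card J" by linarith
    qed
    finally show ?thesis using kappa by (simp add: mult_left_mono)
  next
    case none
    let ?S = "SIGMA e:{e\<in>F. fst e = i}. {e'\<in>F. Q e' = Q e}"
    have "?X \<subseteq> ?S" using P by auto
    then have "card ?X \<le> card ?S" using finite_F by (intro card_mono finite_SigmaI) auto
    also have "card ?S = (\<Sum>e\<in>{e\<in>F. fst e = i}. card {e'\<in>F. Q e' = Q e})"
      using finite_F by simp
    finally have "real (card ?X) \<le> (\<Sum>e\<in>{e\<in>F. fst e = i}. real (card {e'\<in>F. Q e' = Q e}))"
      by (simp only: of_nat_sum[symmetric] of_nat_le_iff)
    also have "\<dots> \<le> (\<Sum>e\<in>{e\<in>F. fst e = i}. \<kappa> * \<Delta> t)"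
      by (intro sum_mono group_le) auto
    also have "\<dots> = real (card {e\<in>F. fst e = i}) * (\<kappa> * \<Delta> t)" by simp
    also have "\<dots> \<le> real n * (\<kappa> * \<Delta> t)"
      using card_label_class kappa threshold_pos[of n l t] by (intro mult_right_mono) auto
    finally show ?thesis using none by (simp add: mult_ac)
  qed
qed

text \<open>Expanding the product over the set \<open>J\<close> of agreeing coordinates gives
  \<open>2 ^ s\<close> patterns. A pattern has few pairs, proportionally to
  \<open>w ^ card J\<close>, and its other coordinates supply \<open>w ^ (s - card J)\<close>, so
  all patterns get the same bound.\<close>

lemma sum_agreement_products:
  assumes P: "\<P> \<subseteq> {(e, e'). e \<in> F \<and> e' \<in> F \<and> fst e = i \<and> Q e = Q e'}" and P0: "P0 \<in> \<P>"
    and h1: "1 \<le> real n * w ^ card ({..<s} \<inter> Y)" and h2: "1 \<le> real n * w ^ card ({..<s} - Y)"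
  shows "(\<Sum>P\<in>\<P>. \<Prod>y<s. (if mix Y en P0 y = mix Y en P y then 1 else 0) + w)
    \<le> 2 ^ s * (\<kappa> * (real n * \<Delta> t * w ^ s))"
proof -
  have finP: "finite \<P>"
    by (rule finite_subset[OF P], rule finite_subset[of _ "F \<times> F"]) (auto simp: finite_F)
  let ?a = "\<lambda>J P. \<forall>y\<in>J. mix Y en P0 y = mix Y en P y"
  have "(\<Prod>y<s. (if mix Y en P0 y = mix Y en P y then 1 else 0) + w)
      = (\<Sum>J\<in>Pow {..<s}. (if ?a J P then 1 else 0) * w ^ (s - card J))" for P
  proof -
    have "(\<Prod>y\<in>J. if mix Y en P0 y = mix Y en P y then 1 else (0::real)) = (if ?a J P then 1 else 0)"
      if "J \<subseteq> {..<s}" for J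
      using finite_subset[OF that] by (auto simp: prod_zero_iff)
    moreover have "(\<Prod>y\<in>{..<s} - J. w) = w ^ (s - card J)" if "J \<subseteq> {..<s}" for J
      using that finite_subset[OF that] by (simp add: card_Diff_subset)
    ultimately show ?thesis by (subst prod_add) (auto intro!: sum.cong)
  qed
  then have "(\<Sum>P\<in>\<P>. \<Prod>y<s. (if mix Y en P0 y = mix Y en P y then 1 else 0) + w)
      = (\<Sum>J\<in>Pow {..<s}. \<Sum>P\<in>\<P>. (if ?a J P then 1 else 0) * w ^ (s - card J))"
    by (simp add: sum.swap[of _ \<P>])
  also have "\<dots> = (\<Sum>J\<in>Pow {..<s}. real (card {P\<in>\<P>. ?a J P}) * w ^ (s - card J))"
    by (intro sum.cong refl)
      (simp only: sum_distrib_right[symmetric] sum.inter_filter[OF finP, symmetric] real_of_card)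
  also have "\<dots> \<le> (\<Sum>J\<in>Pow {..<s}. \<kappa> * (real n * \<Delta> t * w ^ s))"
  proof (rule sum_mono)
    fix J assume "J \<in> Pow {..<s}"
    then have J: "J \<subseteq> {..<s}" by simp
    have cJ: "card J \<le> s" using card_mono[OF _ J] by simp
    have "real (card {P\<in>\<P>. ?a J P}) * w ^ (s - card J) \<le> \<kappa> * (real n * \<Delta> t * w ^ card J) * w ^ (s - card J)"
      using w_pos by (intro mult_right_mono count_agreeing_pairs[OF P P0 J h1 h2]) auto
    also have "\<dots> = \<kappa> * (real n * \<Delta> t * (w ^ card J * w ^ (s - card J)))" by (simp add: mult_ac)
    also have "w ^ card J * w ^ (s - card J) = w ^ s" using cJ by (simp flip: power_add)
    finally show "real (card {P\<in>\<P>. ?a J P}) * w ^ (s - card J) \<le> \<kappa> * (real n * \<Delta> t * w ^ s)" .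
  qed
  also have "\<dots> = 2 ^ s * (\<kappa> * (real n * \<Delta> t * w ^ s))"
    by (simp add: card_Pow)
  finally show ?thesis .
qed

end

section \<open>The spectral bound\<close>

definition tensor :: "nat \<Rightarrow> nat \<Rightarrow> (nat \<Rightarrow> real) \<Rightarrow> (nat \<Rightarrow> nat \<Rightarrow> nat) \<Rightarrow> real" where
  "tensor l s x S = (\<Prod>y<s. \<Prod>z<l. x (S y z))"

lemma verts_lt: "S \<in> verts n l s \<Longrightarrow> y < s \<Longrightarrow> z < l \<Longrightarrow> S y z < n"
  by (auto simp: verts_def tuples_def PiE_iff)

lemma abs_tensor:
  assumes "x \<in> cube n" "S \<in> verts n l s"
  shows "\<bar>tensor l s x S\<bar> = 1"
proof -
  have "\<bar>x (S y z)\<bar> = 1" if "y < s" "z < l" for y z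
    using cube_values[OF assms(1) verts_lt[OF assms(2) that]] by auto
  then show ?thesis by (simp add: tensor_def abs_prod)
qed

text \<open>The two vertices agree away from the positions \<open>\<pi>\<close>, and the common
  entries contribute squares equal to 1. So the quadratic form at the tensor vector returns the
  monomial of each edge.\<close>

lemma tensor_overwrite:
  assumes x: "x \<in> cube n" and slot: "(\<pi>, S) \<in> slots n l s a" and b: "\<And>y. y < s \<Longrightarrow> b y < n"
  shows "tensor l s x S * tensor l s x (overwrite s b \<pi> S) = (\<Prod>y<s. x (a y) * x (b y))"
proof -
  have "(\<Prod>z<l. x (S y z)) * (\<Prod>z<l. x (overwrite s b \<pi> S y z)) = x (a y) * x (b y)" if y: "y < s" for y
  proof -
    have py: "\<pi> y \<in> {..<l}" and S: "S \<in> verts n l s" and Sy: "S y (\<pi> y) = a y"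
      using slot y by (auto simp: slots_def placements_def PiE_iff)
    let ?r = "\<Prod>z\<in>{..<l} - {\<pi> y}. x (S y z)"
    have 1: "(\<Prod>z<l. x (S y z)) = x (a y) * ?r"
      by (subst prod.remove[OF _ py]) (auto simp: Sy)
    have 2: "(\<Prod>z<l. x (overwrite s b \<pi> S y z)) = x (b y) * ?r"
      by (subst prod.remove[OF _ py]) (auto simp: overwrite_def y intro!: prod.cong)
    have "?r * ?r = (\<Prod>z\<in>{..<l} - {\<pi> y}. x (S y z) * x (S y z))" by (simp add: prod.distrib)
    also have "\<dots> = 1"
      by (rule prod.neutral) (use cube_square[OF x verts_lt[OF S y]] in auto)
    finally have rr: "?r * ?r = 1" .
    have "x (a y) * ?r * (x (b y) * ?r) = x (a y) * x (b y) * (?r * ?r)" by (simp only: mult_ac)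
    then show ?thesis unfolding 1 2 rr by simp
  qed
  then show ?thesis
    unfolding tensor_def prod.distrib[symmetric] by (intro prod.cong) auto
qed

context grouped_matchings
begin

lemma prod_mix:
  assumes "e \<in> F" "e' \<in> F"
  shows "(\<Prod>y<s. x (mix Y en (e, e') y) * x (mix (- Y) en (e, e') y))
    = chi (snd e - Q e) x * chi (snd e' - Q e') x"
proof -
  have "(\<Prod>y<s. x (mix Y en (e, e') y) * x (mix (- Y) en (e, e') y)) = (\<Prod>y<s. x (en e y) * x (en e' y))"
    by (intro prod.cong) (auto simp: mix_def)
  moreover have "(\<Prod>y<s. x (en d y)) = chi (snd d - Q d) x" if "d \<in> F" for d
    unfolding chi_def by (rule prod.reindex_bij_betw[OF en_bij[OF that]])
  ultimately show ?thesis using assms by (simp add: prod.distrib)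
qed

text \<open>At the vector \<open>tensor l s (E b)\<close> every kept edge of a pair reproduces that
  pair's correlation. With \<open>N\<close> vertices, degree cap \<open>8 * M\<close> and at least
  \<open>T / 2\<close> edges per pair, the trace bound divided by \<open>T = N w^s\<close> leaves
  \<open>M / w^s\<close>, and \<open>N\<close> disappears.\<close>

lemma kikuchi_bound:
  assumes L: "L \<subseteq> {..<k}" and E: "E \<in> cube k \<rightarrow> cube n" and lab: "\<And>e. e \<in> F \<Longrightarrow> fst e < k"
    and sg: "\<And>e. e \<in> F \<Longrightarrow> \<bar>\<sigma> e\<bar> \<le> 1"
    and half: "1 \<le> real n * w ^ (s - s div 2)"
    and p: "real n ^ (l * s) \<le> 2 ^ (2 ^ Suc p)"
    and Pdef: "\<P> = {(e, e'). e \<in> F \<and> e' \<in> F \<and> Q e = Q e' \<and> fst e \<in> L \<and> fst e' \<notin> L}"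
  shows "(\<Sum>b\<in>cube k. \<Sum>(e, e')\<in>\<P>. b (fst e) * b (fst e') * (\<sigma> e * \<sigma> e') *
      (chi (snd e - Q e) (E b) * chi (snd e' - Q e') (E b)))
    \<le> 2 ^ k * (16 * 2 ^ s * \<kappa> * real n * \<Delta> t * sqrt (2 ^ p * real (card L)))"
    (is "?Z \<le> _")
proof -
  \<comment> \<open>\<open>Y\<close> takes the smaller half of the slots. The roles swap for
    columns, so the condition \<open>half\<close> is imposed on the larger half.\<close>
  define Y where "Y = {..<s div 2}"
  define \<alpha> where "\<alpha> = mix Y en"
  define \<beta> where "\<beta> = mix (- Y) en"
  define M where "M = 2 ^ s * (\<kappa> * (real n * \<Delta> t * w ^ s))"
  define T where "T = (real l * real n ^ (l - 1)) ^ s"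
  define PI where "PI i = {P\<in>\<P>. fst (fst P) = i}" for i
  have finP: "finite \<P>"
    by (rule finite_subset[of _ "F \<times> F"]) (auto simp: Pdef finite_F)
  have PD: "fst P \<in> F" "snd P \<in> F" "Q (fst P) = Q (snd P)" "fst (fst P) \<in> L" "fst (snd P) \<notin> L"
    if "P \<in> \<P>" for P using that by (auto simp: Pdef)
  have \<alpha>_lt: "\<alpha> P y < n" and \<beta>_lt: "\<beta> P y < n" if "P \<in> \<P>" "y < s" for P y
    using PD[OF that(1)] en_lt that(2) by (auto simp: \<alpha>_def \<beta>_def mix_def)
  have Mpos: "M > 0"
    unfolding M_def using kappa n_pos w_pos threshold_pos[of n l t] by simp
  have Tpos: "T > 0" unfolding T_def using n_pos l_pos by simp
  have c1: "card ({..<s} \<inter> Y) = s div 2" "card ({..<s} - - Y) = s div 2"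
    and c2: "card ({..<s} - Y) = s - s div 2" "card ({..<s} \<inter> - Y) = s - s div 2"
  proof -
    have "{..<s} \<inter> Y = {..<s div 2}" "{..<s} - - Y = {..<s div 2}"
      "{..<s} - Y = {s div 2..<s}" "{..<s} \<inter> - Y = {s div 2..<s}" by (auto simp: Y_def)
    then show "card ({..<s} \<inter> Y) = s div 2" "card ({..<s} - - Y) = s div 2"
      "card ({..<s} - Y) = s - s div 2" "card ({..<s} \<inter> - Y) = s - s div 2" by simp_all
  qed
  have half': "1 \<le> real n * w ^ (s div 2)"
  proof -
    have "real n * w ^ (s - s div 2) \<le> real n * w ^ (s div 2)"
      by (intro mult_left_mono power_w_le) auto
    with half show ?thesis by linarith
  qed
  let ?good = "\<lambda>P. {(\<pi>, S) \<in> slots n l s (\<alpha> P).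
     (\<Sum>R\<in>PI (fst (fst P)). real (hits l s S (\<alpha> R))) \<le> 4 * M \<and>
     (\<Sum>R\<in>PI (fst (fst P)). real (hits l s (overwrite s (\<beta> P) \<pi> S) (\<beta> R))) \<le> 4 * M}"
  have good: "T \<le> 2 * real (card (?good P))" if P: "P \<in> \<P>" for P
    unfolding T_def
  proof (rule many_good_slots)
    let ?i = "fst (fst P)"
    have sub: "PI ?i \<subseteq> {(e, e'). e \<in> F \<and> e' \<in> F \<and> fst e = ?i \<and> Q e = Q e'}"
      using PD by (auto simp: PI_def)
    show "P \<in> PI ?i" using P by (simp add: PI_def)
    show "(\<Sum>R\<in>PI ?i. \<Prod>y<s. (if \<alpha> P y = \<alpha> R y then 1 else 0) + w) \<le> M"
      unfolding \<alpha>_def M_def using half half' c1 c2 P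
      by (intro sum_agreement_products[OF sub]) (auto simp: PI_def)
    show "(\<Sum>R\<in>PI ?i. \<Prod>y<s. (if \<beta> P y = \<beta> R y then 1 else 0) + w) \<le> M"
      unfolding \<beta>_def M_def using half half' c1 c2 P
      by (intro sum_agreement_products[OF sub]) (auto simp: PI_def)
    show "M > 0" by (rule Mpos)
  qed (use \<alpha>_lt \<beta>_lt in \<open>auto simp: PI_def\<close>)
  \<comment> \<open>Only sums over pairs are known to correlate, so each pair must keep exactly the same number of edges.\<close>
  define m where "m = nat \<lceil>T / 2\<rceil>"
  have m_ge: "T \<le> 2 * real m" unfolding m_def by linarith
  have "\<exists>K. K \<subseteq> ?good P \<and> card K = m" if P: "P \<in> \<P>" for P
  proof -
    have "T / 2 \<le> of_int (int (card (?good P)))" using good[OF P] by simp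
    then have "\<lceil>T / 2\<rceil> \<le> int (card (?good P))" by (simp only: ceiling_le_iff)
    then have "m \<le> card (?good P)" unfolding m_def by linarith
    then show ?thesis by (rule obtain_subset_with_card_n) blast
  qed
  then have "\<forall>P\<in>\<P>. \<exists>K. K \<subseteq> ?good P \<and> card K = m" by blast
  from bchoice[OF this] obtain K where KK: "\<forall>P\<in>\<P>. K P \<subseteq> ?good P \<and> card (K P) = m" ..
  have K: "K P \<subseteq> ?good P" and Km: "card (K P) = m" if "P \<in> \<P>" for P
    using bspec[OF KK that] by simp_all
  have KD: "(\<pi>, S) \<in> slots n l s (\<alpha> P)" "S \<in> verts n l s" "\<pi> \<in> placements l s S (\<alpha> P)"
    "(\<Sum>R\<in>PI (fst (fst P)). real (hits l s S (\<alpha> R))) \<le> 4 * M"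
    "(\<Sum>R\<in>PI (fst (fst P)). real (hits l s (overwrite s (\<beta> P) \<pi> S) (\<beta> R))) \<le> 4 * M"
    "(\<pi>, overwrite s (\<beta> P) \<pi> S) \<in> slots n l s (\<beta> P)"
    if "P \<in> \<P>" "(\<pi>, S) \<in> K P" for P \<pi> S
  proof -
    have g: "(\<pi>, S) \<in> ?good P" using K that by blast
    then show 1: "(\<pi>, S) \<in> slots n l s (\<alpha> P)"
      and "(\<Sum>R\<in>PI (fst (fst P)). real (hits l s S (\<alpha> R))) \<le> 4 * M"
      and "(\<Sum>R\<in>PI (fst (fst P)). real (hits l s (overwrite s (\<beta> P) \<pi> S) (\<beta> R))) \<le> 4 * M" by auto
    from 1 show "S \<in> verts n l s" "\<pi> \<in> placements l s S (\<alpha> P)" by (auto simp: slots_def)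
    show "(\<pi>, overwrite s (\<beta> P) \<pi> S) \<in> slots n l s (\<beta> P)"
      using \<beta>_lt[OF that(1)] by (intro overwrite_in_slots[OF 1])
  qed
  have finK: "finite (K P)" if "P \<in> \<P>" for P
  proof (rule finite_subset[OF K[OF that]])
    show "finite (?good P)" by (rule finite_subset[OF _ finite_slots[of n l s "\<alpha> P"]]) auto
  qed
  define B where "B = (SIGMA P:\<P>. K P)"
  have finB: "finite B" unfolding B_def using finP finK by auto
  \<comment> \<open>The Boolean is the orientation: each edge yields two mutually reverse darts,
    which makes the operator self-adjoint.\<close>
  define A where "A = B \<times> (UNIV :: bool set)"
  let ?S = "\<lambda>d. snd (snd d)" and ?T = "\<lambda>d. overwrite s (\<beta> (fst d)) (fst (snd d)) (snd (snd d))"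
  define sr where "sr d = (if snd d then ?S (fst d) else ?T (fst d))" for d
  define ds where "ds d = (if snd d then ?T (fst d) else ?S (fst d))" for d
  define lb where "lb d = fst (fst (fst (fst d)))" for d :: "(((nat \<times> nat set) \<times> nat \<times> nat set) \<times> (nat \<Rightarrow> nat) \<times> (nat \<Rightarrow> nat \<Rightarrow> nat)) \<times> bool"
  \<comment> \<open>Only the sign of the first edge's label stays random. The second label lies
    outside \<open>L\<close>, so its sign is unaffected by flips in \<open>L\<close> and can be part
    of the coefficient.\<close>
  define c where "c d b = b (fst (snd (fst (fst d)))) * (\<sigma> (fst (fst (fst d))) * \<sigma> (snd (fst (fst d))))"
    for d :: "(((nat \<times> nat set) \<times> nat \<times> nat set) \<times> (nat \<Rightarrow> nat) \<times> (nat \<Rightarrow> nat \<Rightarrow> nat)) \<times> bool" and b :: "nat \<Rightarrow> real"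
  define rv where "rv d = (fst d, \<not> snd d)" for d :: "(((nat \<times> nat set) \<times> nat \<times> nat set) \<times> (nat \<Rightarrow> nat) \<times> (nat \<Rightarrow> nat \<Rightarrow> nat)) \<times> bool"
  have BV: "?S d \<in> verts n l s" "?T d \<in> verts n l s" if "d \<in> B" for d
    using KD(2,6)[of "fst d" "fst (snd d)" "snd (snd d)"] that by (auto simp: B_def slots_def)
  have graph: "signed_graph k L (verts n l s) A sr ds lb rv c (8 * M)"
  proof
    show "finite (verts n l s)" by simp
    show "verts n l s \<noteq> {}" using card_verts[of n l s] n_pos by (metis card.empty power_not_zero less_not_refl)
    show "finite A" unfolding A_def using finB by simp
    show "L \<subseteq> {..<k}" by (rule L)
    show "0 \<le> 8 * M" using Mpos by simp
    show "sr d \<in> verts n l s" "ds d \<in> verts n l s" if "d \<in> A" for d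
      using BV[of "fst d"] that by (auto simp: A_def sr_def ds_def)
    show "lb d \<in> L" if "d \<in> A" for d using that PD by (auto simp: A_def B_def lb_def)
    show "rv d \<in> A" if "d \<in> A" for d using that by (auto simp: A_def rv_def)
    show "rv (rv d) = d" "sr (rv d) = ds d" "ds (rv d) = sr d" "lb (rv d) = lb d" "c (rv d) = c d" for d
      by (auto simp: rv_def sr_def ds_def lb_def c_def fun_eq_iff)
    show "\<bar>c d b\<bar> \<le> 1" if "d \<in> A" "b \<in> cube k" for d b
    proof -
      let ?P = "fst (fst d)"
      have P: "?P \<in> \<P>" using that by (auto simp: A_def B_def)
      have "\<bar>b (fst (snd ?P))\<bar> = 1"
        using cube_values[OF that(2) lab[OF PD(2)[OF P]]] by auto
      moreover have "\<bar>\<sigma> (fst ?P)\<bar> * \<bar>\<sigma> (snd ?P)\<bar> \<le> 1"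
        using sg PD[OF P] by (intro mult_le_one) auto
      ultimately show ?thesis by (simp add: c_def abs_mult)
    qed
    show "c d (flip i b) = c d b" if "d \<in> A" "b \<in> cube k" "i \<in> L" for d b i
    proof -
      have "fst (snd (fst (fst d))) \<noteq> i" using that PD(5)[of "fst (fst d)"] by (auto simp: A_def B_def)
      then show ?thesis by (simp add: c_def)
    qed
    show "real (card {d\<in>A. sr d = x \<and> lb d = i}) \<le> 8 * M" if "x \<in> verts n l s" "i \<in> L" for x i
    proof -
      let ?X = "{d\<in>B. fst (fst (fst d)) = i \<and> ?S d = x}" and ?X' = "{d\<in>B. fst (fst (fst d)) = i \<and> ?T d = x}"
      have "{d\<in>A. sr d = x \<and> lb d = i} \<subseteq> (\<lambda>d. (d, True)) ` ?X \<union> (\<lambda>d. (d, False)) ` ?X'"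
        by (auto simp: A_def sr_def lb_def image_iff)
      then have "card {d\<in>A. sr d = x \<and> lb d = i} \<le> card ((\<lambda>d. (d, True)) ` ?X \<union> (\<lambda>d. (d, False)) ` ?X')"
        using finB by (intro card_mono) auto
      also have "\<dots> \<le> card ?X + card ?X'"
        using finB by (intro order_trans[OF card_Un_le] add_mono card_image_le) auto
      finally have le: "card {d\<in>A. sr d = x \<and> lb d = i} \<le> card ?X + card ?X'" .
      \<comment> \<open>One kept slot at \<open>x\<close> certifies that the total number of hits at
        \<open>x\<close> is small, and this total bounds all kept slots there.\<close>
      have X: "real (card ?X) \<le> 4 * M"
      proof (cases "?X = {}")
        case True
        then have "card ?X = 0" by (simp only: card.empty)
        then show ?thesis using Mpos by simp
      next
        case False
        then obtain d0 where d0: "d0 \<in> ?X" by blast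
        then have "fst d0 \<in> \<P>" "(fst (snd d0), snd (snd d0)) \<in> K (fst d0)" by (auto simp: B_def)
        from KD(4)[OF this] d0 have b: "(\<Sum>R\<in>PI i. real (hits l s x (\<alpha> R))) \<le> 4 * M"
          by simp
        have "card ?X \<le> card (SIGMA R:PI i. placements l s x (\<alpha> R))"
        proof (rule card_inj_on_le[where f = "\<lambda>d. (fst d, fst (snd d))"])
          show "inj_on (\<lambda>d. (fst d, fst (snd d))) ?X" by (auto simp: inj_on_def prod_eq_iff)
          show "(\<lambda>d. (fst d, fst (snd d))) ` ?X \<subseteq> (SIGMA R:PI i. placements l s x (\<alpha> R))"
            using KD(3) by (auto simp: B_def PI_def)
          show "finite (SIGMA R:PI i. placements l s x (\<alpha> R))"
            using finP by (intro finite_SigmaI) (auto simp: PI_def)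
        qed
        also have "\<dots> = (\<Sum>R\<in>PI i. hits l s x (\<alpha> R))"
          using finP by (subst card_SigmaI) (auto simp: PI_def card_placements)
        finally have "real (card ?X) \<le> (\<Sum>R\<in>PI i. real (hits l s x (\<alpha> R)))"
          by (simp only: of_nat_sum[symmetric] of_nat_le_iff)
        with b show ?thesis by linarith
      qed
      have X': "real (card ?X') \<le> 4 * M"
      proof (cases "?X' = {}")
        case True
        then have "card ?X' = 0" by (simp only: card.empty)
        then show ?thesis using Mpos by simp
      next
        case False
        then obtain d0 where d0: "d0 \<in> ?X'" by blast
        then have "fst d0 \<in> \<P>" "(fst (snd d0), snd (snd d0)) \<in> K (fst d0)" by (auto simp: B_def)
        from KD(5)[OF this] d0 have b: "(\<Sum>R\<in>PI i. real (hits l s x (\<beta> R))) \<le> 4 * M"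
          by simp
        have "card ?X' \<le> card (SIGMA R:PI i. placements l s x (\<beta> R))"
        proof (rule card_inj_on_le[where f = "\<lambda>d. (fst d, fst (snd d))"])
          show "inj_on (\<lambda>d. (fst d, fst (snd d))) ?X'"
          proof (rule inj_onI)
            fix d d' assume *: "d \<in> ?X'" "d' \<in> ?X'" "(fst d, fst (snd d)) = (fst d', fst (snd d'))"
            \<comment> \<open>At the column end the original vertex is recovered from
              \<open>x\<close> and the positions by overwriting back.\<close>
            have "?S d = overwrite s (\<alpha> (fst d)) (fst (snd d)) x" if "d \<in> ?X'" for d
              using that KD(1)[of "fst d" "fst (snd d)" "?S d"] overwrite_overwrite[of "fst (snd d)" "?S d" n l s "\<alpha> (fst d)"]
              by (auto simp: B_def)
            from this[OF *(1)] this[OF *(2)] have "?S d = ?S d'" using *(3) by simp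
            moreover have "fst d = fst d'" "fst (snd d) = fst (snd d')" using *(3) by simp_all
            ultimately show "d = d'" by (intro prod_eqI) auto
          qed
          show "(\<lambda>d. (fst d, fst (snd d))) ` ?X' \<subseteq> (SIGMA R:PI i. placements l s x (\<beta> R))"
            using KD(6) by (auto simp: B_def PI_def slots_def)
          show "finite (SIGMA R:PI i. placements l s x (\<beta> R))"
            using finP by (intro finite_SigmaI) (auto simp: PI_def)
        qed
        also have "\<dots> = (\<Sum>R\<in>PI i. hits l s x (\<beta> R))"
          using finP by (subst card_SigmaI) (auto simp: PI_def card_placements)
        finally have "real (card ?X') \<le> (\<Sum>R\<in>PI i. real (hits l s x (\<beta> R)))"
          by (simp only: of_nat_sum[symmetric] of_nat_le_iff)
        with b show ?thesis by linarith
      qed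
      from of_nat_mono[OF le, where 'a = real] X X' show ?thesis by simp
    qed
  qed
  let ?u = "\<lambda>b. tensor l s (E b)"
  let ?y = "\<lambda>b e e'. b (fst e) * b (fst e') * (\<sigma> e * \<sigma> e') * (chi (snd e - Q e) (E b) * chi (snd e' - Q e') (E b))"
  have main: "(\<Sum>b\<in>cube k. \<Sum>d\<in>A. b (lb d) * c d b * ?u b (sr d) * ?u b (ds d))
      \<le> 2 ^ k * (2 * real (card (verts n l s)) * (8 * M) * sqrt (2 ^ p * real (card L)))"
  proof (rule signed_graph.average_quadratic_form[OF graph])
    show "\<bar>?u b x\<bar> \<le> 1" if "b \<in> cube k" "x \<in> verts n l s" for b x
      using abs_tensor[OF funcset_mem[OF E that(1)] that(2)] by simp
    show "real (card (verts n l s)) \<le> 2 ^ (2 ^ Suc p)" using p by (simp add: card_verts)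
  qed
  have inner: "(\<Sum>d\<in>A. b (lb d) * c d b * ?u b (sr d) * ?u b (ds d)) = 2 * real m * (\<Sum>(e, e')\<in>\<P>. ?y b e e')"
    if b: "b \<in> cube k" for b
  proof -
    let ?f = "\<lambda>d. b (lb d) * c d b * ?u b (sr d) * ?u b (ds d)"
    have f: "?f (d, v) = ?y b (fst (fst d)) (snd (fst d))" if d: "d \<in> B" for d v
    proof -
      obtain e e' \<pi> S where de: "d = ((e, e'), \<pi>, S)" by (metis prod.collapse)
      then have P: "(e, e') \<in> \<P>" "(\<pi>, S) \<in> K (e, e')" using d by (auto simp: B_def)
      have ef: "e \<in> F" "e' \<in> F" using PD[OF P(1)] by auto
      have "?u b S * ?u b (overwrite s (\<beta> (e, e')) \<pi> S) = (\<Prod>y<s. E b (\<alpha> (e, e') y) * E b (\<beta> (e, e') y))"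
        using E b \<beta>_lt[OF P(1)] by (intro tensor_overwrite[OF _ KD(1)[OF P]]) auto
      also have "\<dots> = chi (snd e - Q e) (E b) * chi (snd e' - Q e') (E b)"
        unfolding \<alpha>_def \<beta>_def by (rule prod_mix[OF ef])
      finally have uu: "?u b S * ?u b (overwrite s (\<beta> (e, e')) \<pi> S) = chi (snd e - Q e) (E b) * chi (snd e' - Q e') (E b)" .
      have "?u b (sr (d, v)) * ?u b (ds (d, v)) = chi (snd e - Q e) (E b) * chi (snd e' - Q e') (E b)"
        using uu by (cases v) (simp_all add: sr_def ds_def de mult.commute)
      then have "?f (d, v) = (b (lb (d, v)) * c (d, v) b) * (chi (snd e - Q e) (E b) * chi (snd e' - Q e') (E b))"
        by (simp only: mult.assoc)
      then show ?thesis by (simp add: lb_def c_def de mult.assoc)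
    qed
    have "(\<Sum>d\<in>A. ?f d) = (\<Sum>d\<in>B. \<Sum>v\<in>UNIV. ?f (d, v))"
      unfolding A_def by (simp only: sum.cartesian_product case_prod_unfold prod.collapse)
    also have "\<dots> = (\<Sum>d\<in>B. 2 * ?y b (fst (fst d)) (snd (fst d)))"
      by (intro sum.cong refl) (simp only: f UNIV_bool, simp)
    also have "\<dots> = (\<Sum>P\<in>\<P>. \<Sum>d\<in>K P. 2 * ?y b (fst P) (snd P))"
      unfolding B_def using finP finK by (subst sum.Sigma) (auto simp: case_prod_unfold)
    also have "\<dots> = (\<Sum>P\<in>\<P>. 2 * real m * ?y b (fst P) (snd P))"
      by (intro sum.cong refl) (simp add: Km)
    also have "\<dots> = 2 * real m * (\<Sum>(e, e')\<in>\<P>. ?y b e e')"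
      by (simp add: sum_distrib_left case_prod_unfold)
    finally show ?thesis .
  qed
  have Zeq: "?Z = (\<Sum>b\<in>cube k. \<Sum>(e, e')\<in>\<P>. ?y b e e')" ..
  have main': "2 * real m * ?Z \<le> 2 ^ k * (2 * real n ^ (l * s) * (8 * M) * sqrt (2 ^ p * real (card L)))"
    using main inner by (simp add: sum_distrib_left[symmetric] card_verts cong: sum.cong)
  \<comment> \<open>\<open>m\<close> is only bounded below by \<open>T / 2\<close>, so
    \<open>T\<close> can replace \<open>2 * m\<close> only in front of a nonnegative sum; for a
    negative sum the claim is immediate.\<close>
  show ?thesis
  proof (cases "?Z \<ge> 0")
    case True
    have Tw: "T = real n ^ (l * s) * w ^ s"
    proof -
      have "real l * real n ^ (l - 1) = real n ^ l * w"
        using l_pos n_pos by (cases l) auto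
      then have "T = (real n ^ l * w) ^ s" by (simp only: T_def)
      then show ?thesis by (simp only: power_mult_distrib power_mult)
    qed
    have "T * ?Z \<le> 2 * real m * ?Z" using m_ge True by (intro mult_right_mono) auto
    also note main'
    also have "2 ^ k * (2 * real n ^ (l * s) * (8 * M) * sqrt (2 ^ p * real (card L)))
        = T * (2 ^ k * (16 * 2 ^ s * \<kappa> * real n * \<Delta> t * sqrt (2 ^ p * real (card L))))"
      unfolding M_def Tw by (simp add: mult_ac)
    finally show ?thesis using Tpos by (simp only: mult_le_cancel_left_pos)
  next
    case False
    moreover have "0 \<le> 2 ^ k * (16 * 2 ^ s * \<kappa> * real n * \<Delta> t * sqrt (2 ^ p * real (card L)))"
      using kappa threshold_pos[of n l t] by simp
    ultimately show ?thesis by linarith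
  qed
qed

end

section \<open>Correlation of pairs of hyperedges\<close>

lemma card_separating_subsets:
  assumes "i < k" "j < k" "i \<noteq> (j::nat)"
  shows "4 * card {L\<in>Pow {..<k}. i \<in> L \<and> j \<notin> L} = 2 ^ k"
proof -
  let ?R = "{..<k} - {i, j}"
  have "{L\<in>Pow {..<k}. i \<in> L \<and> j \<notin> L} = insert i ` Pow ?R"
  proof (intro equalityI subsetI)
    fix L assume L: "L \<in> {L\<in>Pow {..<k}. i \<in> L \<and> j \<notin> L}"
    then have "L = insert i (L - {i})" "L - {i} \<in> Pow ?R" by auto
    then show "L \<in> insert i ` Pow ?R" by (rule image_eqI)
  qed (use assms in auto)
  moreover have "inj_on (insert i) (Pow ?R)"
    by (rule inj_onI) (metis Diff_insert_absorb Diff_iff PowD insertI1 subsetD)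
  ultimately have "card {L\<in>Pow {..<k}. i \<in> L \<and> j \<notin> L} = 2 ^ card ?R"
    by (simp add: card_image card_Pow)
  moreover have "card ?R = k - 2" using assms by (simp add: card_Diff_subset numeral_2_eq_2)
  moreover have "(2::nat) ^ k = 4 * 2 ^ (k - 2)"
  proof -
    have "k \<ge> 2" using assms by simp
    then obtain m where "k = 2 + m" using le_Suc_ex by blast
    then show ?thesis by simp
  qed
  ultimately show ?thesis by simp
qed

text \<open>A uniformly random \<open>L\<close> separates any two distinct labels in the prescribed
  order with probability 1/4, so some \<open>L\<close> does at least as well as the average. The
  weights may have either sign.\<close>

lemma good_cut:
  fixes W :: "'p \<Rightarrow> real" and f g :: "'p \<Rightarrow> nat"
  assumes fin: "finite X" and fg: "\<And>P. P \<in> X \<Longrightarrow> f P < k \<and> g P < k \<and> f P \<noteq> g P"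
  obtains L where "L \<subseteq> {..<k}" "(\<Sum>P\<in>X. W P) \<le> 4 * (\<Sum>P | P \<in> X \<and> f P \<in> L \<and> g P \<notin> L. W P)"
proof -
  let ?S = "\<lambda>L. \<Sum>P | P \<in> X \<and> f P \<in> L \<and> g P \<notin> L. W P"
  have "4 * (\<Sum>L\<in>Pow {..<k}. ?S L) = 4 * (\<Sum>L\<in>Pow {..<k}. \<Sum>P\<in>X. if f P \<in> L \<and> g P \<notin> L then W P else 0)"
    using fin by (simp add: sum.inter_filter[symmetric])
  also have "\<dots> = (\<Sum>P\<in>X. 4 * (\<Sum>L\<in>Pow {..<k}. if f P \<in> L \<and> g P \<notin> L then W P else 0))"
    by (subst sum.swap) (simp add: sum_distrib_left)
  also have "\<dots> = (\<Sum>P\<in>X. 2 ^ k * W P)"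
  proof (intro sum.cong refl)
    fix P assume P: "P \<in> X"
    have "4 * (\<Sum>L\<in>Pow {..<k}. if f P \<in> L \<and> g P \<notin> L then W P else 0)
        = real (4 * card {L\<in>Pow {..<k}. f P \<in> L \<and> g P \<notin> L}) * W P"
      by (simp add: sum.inter_filter[symmetric] del: Pow_iff)
    also have "\<dots> = 2 ^ k * W P"
      using fg[OF P] by (subst card_separating_subsets) auto
    finally show "4 * (\<Sum>L\<in>Pow {..<k}. if f P \<in> L \<and> g P \<notin> L then W P else 0) = 2 ^ k * W P" .
  qed
  finally have total: "4 * (\<Sum>L\<in>Pow {..<k}. ?S L) = 2 ^ k * (\<Sum>P\<in>X. W P)"
    by (simp add: sum_distrib_left)
  have "\<exists>L\<in>Pow {..<k}. (\<Sum>P\<in>X. W P) \<le> 4 * ?S L"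
  proof (rule ccontr)
    assume "\<not> ?thesis"
    then have "4 * ?S L < (\<Sum>P\<in>X. W P)" if "L \<in> Pow {..<k}" for L
      using that by (meson not_le)
    then have "(\<Sum>L\<in>Pow {..<k}. 4 * ?S L) < (\<Sum>L\<in>Pow {..<k}. \<Sum>P\<in>X. W P)"
      by (rule sum_strict_mono[rotated 2]) auto
    with total show False by (simp add: sum_distrib_left[symmetric] card_Pow)
  qed
  then show ?thesis using that by auto
qed

lemma chi_square: "C \<subseteq> {..<n} \<Longrightarrow> y \<in> cube n \<Longrightarrow> chi C y * chi C y = 1"
  using chi_values[of C n y] by auto

context grouped_matchings
begin

text \<open>Cauchy-Schwarz over messages and group centres removes the common factor
  \<open>chi (Q e) (E b)\<close>. There are at most \<open>card F / g\<close> centres, which gives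
  total correlation \<open>\<epsilon>\<^sup>2 * card F * g\<close> over pairs in a group. The
  diagonal costs at most half because \<open>g * \<epsilon>\<^sup>2 \<ge> 2\<close>, and the cut a
  quarter of the rest, hence the 8.\<close>

lemma pair_correlations:
  assumes E: "E \<in> cube k \<rightarrow> cube n" and lab: "\<And>e. e \<in> F \<Longrightarrow> fst e < k"
    and sg: "\<And>e. e \<in> F \<Longrightarrow> \<sigma> e * \<sigma> e = (1::real)"
    and grp: "\<And>e. e \<in> F \<Longrightarrow> g \<le> real (card {e'\<in>F. Q e' = Q e})"
    and cor: "\<And>e. e \<in> F \<Longrightarrow> 2 ^ k * \<epsilon> \<le> (\<Sum>b\<in>cube k. b (fst e) * \<sigma> e * chi (snd e) (E b))"
    and eps: "\<epsilon> > 0" and g: "g > 0" "g * \<epsilon>\<^sup>2 \<ge> 2"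
  obtains L where "L \<subseteq> {..<k}"
    "2 ^ k * (\<epsilon>\<^sup>2 * real (card F) * g / 8) \<le>
     (\<Sum>b\<in>cube k. \<Sum>(e, e')\<in>{(e, e'). e \<in> F \<and> e' \<in> F \<and> Q e = Q e' \<and> fst e \<in> L \<and> fst e' \<notin> L}.
        b (fst e) * b (fst e') * (\<sigma> e * \<sigma> e') * (chi (snd e - Q e) (E b) * chi (snd e' - Q e') (E b)))"
proof -
  define v where "v b e = b (fst e) * \<sigma> e * chi (snd e - Q e) (E b)" for b e
  define X where "X = {(e, e'). e \<in> F \<and> e' \<in> F \<and> Q e = Q e'}"
  define W where "W P = (\<Sum>b\<in>cube k. v b (fst P) * v b (snd P))" for P
  let ?G = "Q ` F" and ?N = "real (card F)"
  let ?z = "\<lambda>b q. \<Sum>e | e \<in> F \<and> Q e = q. v b e"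
  have Eb: "E b \<in> cube n" if "b \<in> cube k" for b using funcset_mem[OF E that] .
  have finX: "finite X" by (rule finite_subset[of _ "F \<times> F"]) (auto simp: X_def finite_F)
  have fin_e: "finite (snd e)" if "e \<in> F" for e using edge_sub[OF that] finite_subset by blast
  have qsub: "q \<subseteq> {..<n}" if "q \<in> ?G" for q using that Q_sub edge_sub by blast
  have chi_split: "chi (snd e) x = chi (Q e) x * chi (snd e - Q e) x" if "e \<in> F" for e x
    unfolding chi_def using prod.subset_diff[OF Q_sub[OF that] fin_e[OF that], of x] by (simp add: mult.commute)
  have sq: "v b e * v b e = 1" if "b \<in> cube k" "e \<in> F" for b e
  proof -
    have "chi (snd e - Q e) (E b) * chi (snd e - Q e) (E b) = 1"
      using edge_sub[OF that(2)] by (intro chi_square[OF _ Eb[OF that(1)]]) auto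
    moreover have "v b e * v b e = (b (fst e) * b (fst e)) * (\<sigma> e * \<sigma> e) * (chi (snd e - Q e) (E b) * chi (snd e - Q e) (E b))"
      by (simp add: v_def mult_ac)
    ultimately show ?thesis using sg[OF that(2)] cube_square[OF that(1) lab[OF that(2)]] by simp
  qed
  have "2 ^ k * \<epsilon> * ?N = (\<Sum>e\<in>F. 2 ^ k * \<epsilon>)" by simp
  also have "\<dots> \<le> (\<Sum>e\<in>F. \<Sum>b\<in>cube k. b (fst e) * \<sigma> e * chi (snd e) (E b))"
    by (intro sum_mono cor)
  also have "\<dots> = (\<Sum>b\<in>cube k. \<Sum>e\<in>F. chi (Q e) (E b) * v b e)"
    by (subst sum.swap) (simp add: v_def chi_split mult_ac)
  also have "\<dots> = (\<Sum>b\<in>cube k. \<Sum>q\<in>?G. chi q (E b) * ?z b q)"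
  proof (intro sum.cong refl)
    fix b
    have "(\<Sum>e\<in>F. chi (Q e) (E b) * v b e) = (\<Sum>q\<in>?G. \<Sum>e | e \<in> F \<and> Q e = q. chi (Q e) (E b) * v b e)"
      using finite_F by (intro sum.group[symmetric]) auto
    also have "\<dots> = (\<Sum>q\<in>?G. chi q (E b) * ?z b q)"
      unfolding sum_distrib_left by (intro sum.cong) auto
    finally show "(\<Sum>e\<in>F. chi (Q e) (E b) * v b e) = (\<Sum>q\<in>?G. chi q (E b) * ?z b q)" .
  qed
  finally have low: "2 ^ k * \<epsilon> * ?N \<le> (\<Sum>(b, q)\<in>cube k \<times> ?G. chi q (E b) * ?z b q)"
    by (simp add: sum.cartesian_product)
  have "(2 ^ k * \<epsilon> * ?N)\<^sup>2 \<le> (\<Sum>(b, q)\<in>cube k \<times> ?G. chi q (E b) * ?z b q)\<^sup>2"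
    using low eps by (intro power_mono) auto
  also have "\<dots> \<le> (\<Sum>(b, q)\<in>cube k \<times> ?G. (chi q (E b))\<^sup>2) * (\<Sum>(b, q)\<in>cube k \<times> ?G. (?z b q)\<^sup>2)"
    using Cauchy_Schwarz_ineq_sum[of "\<lambda>(b, q). chi q (E b)" "\<lambda>(b, q). ?z b q" "cube k \<times> ?G"]
    by (simp add: case_prod_unfold)
  also have "(\<Sum>(b, q)\<in>cube k \<times> ?G. (chi q (E b))\<^sup>2) = (\<Sum>(b, q)\<in>cube k \<times> ?G. 1)"
  proof (intro sum.cong refl)
    fix P assume "P \<in> cube k \<times> ?G"
    then show "(case P of (b, q) \<Rightarrow> (chi q (E b))\<^sup>2) = (case P of (b, q) \<Rightarrow> 1)"
      using chi_square[OF qsub Eb] by (auto simp: power2_eq_square)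
  qed
  also have "\<dots> = 2 ^ k * real (card ?G)" by (simp add: case_prod_unfold card_cube card_cartesian_product)
  also have "(\<Sum>(b, q)\<in>cube k \<times> ?G. (?z b q)\<^sup>2) = (\<Sum>P\<in>X. W P)"
  proof -
    have "(\<Sum>q\<in>?G. (?z b q)\<^sup>2) = (\<Sum>P\<in>X. v b (fst P) * v b (snd P))" for b
    proof -
      have "(\<Sum>q\<in>?G. (?z b q)\<^sup>2) = (\<Sum>q\<in>?G. \<Sum>e | e \<in> F \<and> Q e = q. \<Sum>e' | e' \<in> F \<and> Q e' = Q e. v b e * v b e')"
        unfolding power2_eq_square sum_product by (intro sum.cong refl) auto
      also have "\<dots> = (\<Sum>e\<in>F. \<Sum>e' | e' \<in> F \<and> Q e' = Q e. v b e * v b e')"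
        using finite_F by (intro sum.group) auto
      also have "\<dots> = (\<Sum>(e, e')\<in>(SIGMA e:F. {e'. e' \<in> F \<and> Q e' = Q e}). v b e * v b e')"
        using finite_F by (intro sum.Sigma) auto
      also have "(SIGMA e:F. {e'. e' \<in> F \<and> Q e' = Q e}) = X" by (auto simp: X_def)
      finally show ?thesis by (simp add: case_prod_unfold)
    qed
    then have "(\<Sum>(b, q)\<in>cube k \<times> ?G. (?z b q)\<^sup>2) = (\<Sum>b\<in>cube k. \<Sum>P\<in>X. v b (fst P) * v b (snd P))"
      by (simp add: sum.cartesian_product[symmetric])
    then show ?thesis unfolding W_def by (simp add: sum.swap[of _ "cube k"])
  qed
  finally have cs: "(2 ^ k * \<epsilon> * ?N)\<^sup>2 \<le> 2 ^ k * real (card ?G) * (\<Sum>P\<in>X. W P)" .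
  have "real (card ?G) * g = (\<Sum>q\<in>?G. g)" by simp
  also have "\<dots> \<le> (\<Sum>q\<in>?G. real (card {e\<in>F. Q e = q}))"
    using grp by (intro sum_mono) auto
  also have "\<dots> = (\<Sum>q\<in>?G. \<Sum>e | e \<in> F \<and> Q e = q. 1)" by simp
  also have "\<dots> = (\<Sum>e\<in>F. 1)" using finite_F by (intro sum.group) auto
  finally have Gg: "real (card ?G) * g \<le> ?N" by simp
  have Wbig: "2 ^ k * (\<epsilon>\<^sup>2 * ?N * g) \<le> (\<Sum>P\<in>X. W P)"
  proof (cases "F = {}")
    case True
    then have "X = {}" by (auto simp: X_def)
    then show ?thesis using True by simp
  next
    case False
    then have N: "?N > 0" using finite_F by (simp add: card_gt_0_iff)
    have Wnn: "(\<Sum>P\<in>X. W P) \<ge> 0"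
    proof (rule ccontr)
      assume "\<not> ?thesis"
      then have "2 ^ k * real (card ?G) * (\<Sum>P\<in>X. W P) \<le> 0"
        by (intro mult_nonneg_nonpos) auto
      moreover have "(2 ^ k * \<epsilon> * ?N)\<^sup>2 > 0" using eps N by simp
      ultimately show False using cs by linarith
    qed
    have "(2 ^ k * ?N) * (2 ^ k * (\<epsilon>\<^sup>2 * ?N * g)) = (2 ^ k * \<epsilon> * ?N)\<^sup>2 * g"
      by (simp add: power2_eq_square mult_ac)
    also have "\<dots> \<le> 2 ^ k * real (card ?G) * (\<Sum>P\<in>X. W P) * g"
      using cs g by (intro mult_right_mono) auto
    also have "\<dots> = 2 ^ k * (\<Sum>P\<in>X. W P) * (real (card ?G) * g)" by (simp only: mult_ac)
    also have "\<dots> \<le> 2 ^ k * (\<Sum>P\<in>X. W P) * ?N"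
      using Gg Wnn by (intro mult_left_mono) auto
    also have "\<dots> = (2 ^ k * ?N) * (\<Sum>P\<in>X. W P)" by (simp only: mult_ac)
    finally show ?thesis by (rule mult_left_le_imp_le) (use N in simp)
  qed
  define X1 where "X1 = {P\<in>X. fst (fst P) \<noteq> fst (snd P)}"
  define X0 where "X0 = (\<lambda>e. (e, e)) ` F"
  \<comment> \<open>Two edges of one group share a nonempty \<open>Q\<close>, so with equal labels
    they coincide: the pairs lost are exactly the diagonal ones.\<close>
  have "X - X1 = X0"
  proof (intro equalityI subsetI)
    fix P assume P: "P \<in> X - X1"
    then have e: "fst P \<in> F" "snd P \<in> F" "Q (fst P) = Q (snd P)" "fst (fst P) = fst (snd P)"
      by (auto simp: X_def X1_def)
    then have "snd (fst P) \<inter> snd (snd P) \<noteq> {}"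
      using Q_sub[OF e(1)] Q_sub[OF e(2)] Q_ne[OF e(1)] by auto
    then have "fst P = snd P" using matching e by blast
    then show "P \<in> X0" using e by (auto simp: X0_def image_iff prod_eq_iff)
  qed (auto simp: X_def X0_def X1_def)
  moreover have "(\<Sum>P\<in>X. W P) = (\<Sum>P\<in>X - X1. W P) + (\<Sum>P\<in>X1. W P)"
    using finX by (intro sum.subset_diff) (auto simp: X1_def)
  moreover have "(\<Sum>P\<in>X0. W P) = 2 ^ k * ?N"
  proof -
    have "(\<Sum>P\<in>X0. W P) = (\<Sum>e\<in>F. W (e, e))"
      unfolding X0_def by (subst sum.reindex) (auto simp: inj_on_def)
    also have "\<dots> = (\<Sum>e\<in>F. 2 ^ k)"
      by (intro sum.cong refl) (simp add: W_def sq card_cube cong: sum.cong)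
    finally show ?thesis by simp
  qed
  ultimately have "2 ^ k * (\<epsilon>\<^sup>2 * ?N * g) - 2 ^ k * ?N \<le> (\<Sum>P\<in>X1. W P)"
    using Wbig by simp
  moreover have "2 ^ k * ?N \<le> 2 ^ k * (\<epsilon>\<^sup>2 * ?N * g) / 2"
  proof -
    have "2 * (2 ^ k * ?N) \<le> (g * \<epsilon>\<^sup>2) * (2 ^ k * ?N)" using g by (intro mult_right_mono) auto
    then show ?thesis by (simp add: mult_ac)
  qed
  ultimately have off: "2 ^ k * (\<epsilon>\<^sup>2 * ?N * g) / 2 \<le> (\<Sum>P\<in>X1. W P)" by linarith
  have "finite X1" using finX by (simp add: X1_def)
  moreover have "fst (fst P) < k \<and> fst (snd P) < k \<and> fst (fst P) \<noteq> fst (snd P)" if "P \<in> X1" for P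
    using that lab by (auto simp: X1_def X_def)
  ultimately obtain L where L: "L \<subseteq> {..<k}"
    "(\<Sum>P\<in>X1. W P) \<le> 4 * (\<Sum>P | P \<in> X1 \<and> fst (fst P) \<in> L \<and> fst (snd P) \<notin> L. W P)"
    by (rule good_cut[of X1 "\<lambda>P. fst (fst P)" k "\<lambda>P. fst (snd P)" W])
  let ?PL = "{(e, e'). e \<in> F \<and> e' \<in> F \<and> Q e = Q e' \<and> fst e \<in> L \<and> fst e' \<notin> L}"
  have "{P. P \<in> X1 \<and> fst (fst P) \<in> L \<and> fst (snd P) \<notin> L} = ?PL"
    by (auto simp: X1_def X_def)
  with L(2) off have "2 ^ k * (\<epsilon>\<^sup>2 * ?N * g / 8) \<le> (\<Sum>P\<in>?PL. W P)" by simp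
  also have "\<dots> = (\<Sum>b\<in>cube k. \<Sum>P\<in>?PL. v b (fst P) * v b (snd P))"
    unfolding W_def by (rule sum.swap)
  also have "\<dots> = (\<Sum>b\<in>cube k. \<Sum>(e, e')\<in>?PL. b (fst e) * b (fst e') * (\<sigma> e * \<sigma> e') * (chi (snd e - Q e) (E b) * chi (snd e' - Q e') (E b)))"
    by (intro sum.cong refl) (simp add: v_def case_prod_unfold mult_ac)
  finally show ?thesis using that L(1) by blast
qed

text \<open>The group size \<open>\<kappa> / 2 * \<Delta> t\<close> gained by Cauchy-Schwarz cancels
  against the degree bound, so the result does not depend on how heavy the groups are. The constant
  is \<open>8 * 16 * 2 = 2 ^ 8\<close>.\<close>

lemma group_bound:
  assumes E: "E \<in> cube k \<rightarrow> cube n" and lab: "\<And>e. e \<in> F \<Longrightarrow> fst e < k"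
    and sg: "\<And>e. e \<in> F \<Longrightarrow> \<sigma> e * \<sigma> e = (1::real)"
    and grp: "\<And>e. e \<in> F \<Longrightarrow> \<kappa> / 2 * \<Delta> t \<le> real (card {e'\<in>F. Q e' = Q e})"
    and cor: "\<And>e. e \<in> F \<Longrightarrow> 2 ^ k * \<epsilon> \<le> (\<Sum>b\<in>cube k. b (fst e) * \<sigma> e * chi (snd e) (E b))"
    and eps: "\<epsilon> > 0" and g: "\<kappa> / 2 * \<epsilon>\<^sup>2 \<ge> 2"
    and half: "1 \<le> real n * w ^ (s - s div 2)"
    and p: "real n ^ (l * s) \<le> 2 ^ (2 ^ Suc p)"
  shows "\<epsilon>\<^sup>2 * real (card F) \<le> 2 ^ (s + 8) * real n * sqrt (2 ^ p * real k)"
proof -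
  let ?g = "\<kappa> / 2 * \<Delta> t"
  have gpos: "?g > 0" using kappa threshold_pos[of n l t] by simp
  have g2: "?g * \<epsilon>\<^sup>2 \<ge> 2"
  proof -
    have "2 * 1 \<le> (\<kappa> / 2 * \<epsilon>\<^sup>2) * \<Delta> t" using g threshold_ge_1[of n l t] by (intro mult_mono) auto
    then show ?thesis by (simp add: mult_ac)
  qed
  obtain L where L: "L \<subseteq> {..<k}"
    and low: "2 ^ k * (\<epsilon>\<^sup>2 * real (card F) * ?g / 8) \<le>
     (\<Sum>b\<in>cube k. \<Sum>(e, e')\<in>{(e, e'). e \<in> F \<and> e' \<in> F \<and> Q e = Q e' \<and> fst e \<in> L \<and> fst e' \<notin> L}.
        b (fst e) * b (fst e') * (\<sigma> e * \<sigma> e') * (chi (snd e - Q e) (E b) * chi (snd e' - Q e') (E b)))"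
    by (rule pair_correlations[OF E lab sg grp cor eps gpos g2])
  note low
  also have "\<dots> \<le> 2 ^ k * (16 * 2 ^ s * \<kappa> * real n * \<Delta> t * sqrt (2 ^ p * real (card L)))"
  proof (rule kikuchi_bound[OF L E lab _ half p refl])
    show "\<bar>\<sigma> e\<bar> \<le> 1" if "e \<in> F" for e
      using sg[OF that] by (metis abs_mult_self_eq abs_one less_eq_real_def power2_eq_1_iff power2_eq_square abs_minus)
  qed
  also have "\<dots> \<le> 2 ^ k * (16 * 2 ^ s * \<kappa> * real n * \<Delta> t * sqrt (2 ^ p * real k))"
  proof -
    have "card L \<le> k" using card_mono[OF _ L] by simp
    then have "sqrt (2 ^ p * real (card L)) \<le> sqrt (2 ^ p * real k)" by simp
    then show ?thesis using kappa threshold_pos[of n l t] by (intro mult_left_mono) auto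
  qed
  finally have "\<epsilon>\<^sup>2 * real (card F) * ?g / 8 \<le> 16 * 2 ^ s * \<kappa> * real n * \<Delta> t * sqrt (2 ^ p * real k)"
    by (simp only: mult_le_cancel_left_pos zero_less_power zero_less_numeral)
  then have "?g * (\<epsilon>\<^sup>2 * real (card F)) \<le> ?g * (2 ^ (s + 8) * real n * sqrt (2 ^ p * real k))"
    by (simp add: power_add mult_ac)
  then show ?thesis using gpos by (simp only: mult_le_cancel_left_pos)
qed

end

section \<open>The lower bound\<close>

lemma pigeonhole_class:
  assumes "finite A" "finite B" "f ` A \<subseteq> B" "B \<noteq> {}"
  obtains y where "y \<in> B" "card A \<le> card B * card {x\<in>A. f x = y}"
proof -
  have "card A = (\<Sum>y\<in>B. card {x\<in>A. f x = y})"
    using sum.group[OF assms(1-3), of "\<lambda>_. 1::nat"] by simp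
  have "\<exists>y\<in>B. card A \<le> card B * card {x\<in>A. f x = y}"
  proof (rule ccontr)
    assume "\<not> ?thesis"
    then have "card B * card {x\<in>A. f x = y} < card A" if "y \<in> B" for y
      using that by (meson not_le)
    then have "(\<Sum>y\<in>B. card B * card {x\<in>A. f x = y}) < (\<Sum>y\<in>B. card A)"
      using assms by (intro sum_strict_mono) auto
    then show False
      using \<open>card A = _\<close> by (simp add: sum_distrib_left[symmetric])
  qed
  then show ?thesis using that by blast
qed

lemma two_power_approx:
  fixes x :: real
  obtains p where "x \<le> 2 ^ Suc p" "2 ^ p \<le> max 1 x"
proof -
  obtain m where m: "x < 2 ^ m" using real_arch_pow[of 2 x] by auto
  define p where "p = (LEAST p. x \<le> 2 ^ Suc p)"
  have "x \<le> 2 ^ Suc m" using m by (smt (verit) power_increasing le_SucI order_refl)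
  then have p: "x \<le> 2 ^ Suc p" unfolding p_def by (rule LeastI)
  have "2 ^ p \<le> max 1 x"
  proof (cases p)
    case (Suc r)
    then have "\<not> x \<le> 2 ^ Suc r" using not_less_Least[of r "\<lambda>p. x \<le> 2 ^ Suc p"] by (simp add: p_def)
    then show ?thesis using Suc by simp
  qed simp
  with p show ?thesis using that by blast
qed

text \<open>Pigeonholing fixes the size of \<open>C\<close>, the size of \<open>Q\<close> and the
  ratio of a group up to a factor 2, at a cost of order \<open>q^2 log n\<close>. The hypothesis
  \<open>large\<close> makes the surviving groups big enough compared with
  \<open>1 / \<epsilon>\<^sup>2\<close> for the diagonal to be negligible.\<close>

lemma matchings_bound:
  fixes H :: "nat \<Rightarrow> nat set set" and \<delta> \<epsilon> :: real
  assumes E: "E \<in> cube k \<rightarrow> cube n" and n: "n \<ge> 2" and k: "1 \<le> k" "k \<le> n" and q: "q \<ge> 1"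
    and eps: "0 < \<epsilon>" "\<epsilon> \<le> 1" and del: "\<delta> > 0"
    and l: "0 < l" "l \<le> n" and scale: "1 \<le> (real n)\<^sup>2 * (real l / real n) ^ q"
    and disj: "\<And>i. i < k \<Longrightarrow> disjoint (H i)"
    and size: "\<And>i. i < k \<Longrightarrow> \<delta> * real n \<le> real q * real (card (H i))"
    and H: "\<And>i C. i < k \<Longrightarrow> C \<in> H i \<Longrightarrow> C \<subseteq> {..<n} \<and> C \<noteq> {} \<and> card C \<le> q \<and>
       \<bar>\<Sum>b\<in>cube k. b i * chi C (E b)\<bar> \<ge> 2 ^ k * \<epsilon>"
    and large: "8 * (real q)\<^sup>2 * real l \<le> real k * \<delta> * \<epsilon>\<^sup>2"
  shows "real k * (\<epsilon> ^ 4 * \<delta>\<^sup>2) \<le> 2 ^ (2 * q + 20) * real q ^ 7 * (log 2 (real n)) ^ 3 * real l"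
proof -
  let ?w = "real l / real n" and ?lg = "log 2 (real n)"
  have npos: "real n > 0" using n by simp
  have lg1: "?lg \<ge> 1" using n by simp
  have w: "0 < ?w" "?w \<le> 1" using l n by (auto simp: divide_le_eq)
  have finH: "finite (H i)" if "i < k" for i
    by (rule finite_subset[of _ "Pow {..<n}"]) (use H[OF that] in auto)
  define All where "All = (SIGMA i:{..<k}. H i)"
  have finAll: "finite All" unfolding All_def using finH by auto
  have "real k * (\<delta> * real n) = (\<Sum>i<k. \<delta> * real n)" by simp
  also have "\<dots> \<le> (\<Sum>i<k. real q * real (card (H i)))" by (intro sum_mono size) auto
  also have "\<dots> = real q * real (card All)"
    using finH by (simp add: All_def sum_distrib_left)
  finally have sz_All: "real k * (\<delta> * real n) \<le> real q * real (card All)" .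
  have "(\<lambda>e. card (snd e)) ` All \<subseteq> {1..q}"
  proof (rule image_subsetI)
    fix e assume "e \<in> All"
    then have "fst e < k" "snd e \<in> H (fst e)" by (auto simp: All_def)
    from H[OF this] have "snd e \<subseteq> {..<n}" "snd e \<noteq> {}" "card (snd e) \<le> q" by auto
    moreover from this have "finite (snd e)" using finite_subset by blast
    ultimately show "card (snd e) \<in> {1..q}" using card_gt_0_iff[of "snd e"] by auto
  qed
  from pigeonhole_class[OF finAll _ this] q obtain r where r: "r \<in> {1..q}"
    and szr: "card All \<le> q * card {e\<in>All. card (snd e) = r}" by auto
  define A where "A = {e\<in>All. card (snd e) = r}"
  have finA: "finite A" using finAll by (simp add: A_def)
  have AD: "fst e < k" "snd e \<in> H (fst e)" "snd e \<subseteq> {..<n}" "snd e \<noteq> {}" "card (snd e) = r" "finite (snd e)"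
    "\<bar>\<Sum>b\<in>cube k. b (fst e) * chi (snd e) (E b)\<bar> \<ge> 2 ^ k * \<epsilon>" if "e \<in> A" for e
  proof -
    show 1: "fst e < k" "snd e \<in> H (fst e)" "card (snd e) = r" using that by (auto simp: A_def All_def)
    from H[OF 1(1,2)] show "snd e \<subseteq> {..<n}" "snd e \<noteq> {}"
      "\<bar>\<Sum>b\<in>cube k. b (fst e) * chi (snd e) (E b)\<bar> \<ge> 2 ^ k * \<epsilon>" by auto
    then show "finite (snd e)" using finite_subset by blast
  qed
  have matching: "e = e'" if "e \<in> A" "e' \<in> A" "fst e = fst e'" "snd e \<inter> snd e' \<noteq> {}" for e e'
  proof -
    have "snd e = snd e'" using disj[OF AD(1)[OF that(1)]] AD(2)[OF that(1)] AD(2)[OF that(2)] that(3,4)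
      unfolding disjoint_def by auto
    then show ?thesis using that(3) by (simp add: prod_eq_iff)
  qed
  have sz_A: "real k * (\<delta> * real n) \<le> (real q)\<^sup>2 * real (card A)"
  proof -
    have "real q * real (card All) \<le> real q * (real q * real (card A))"
      using of_nat_mono[OF szr, where 'a = real] by (intro mult_left_mono) (auto simp: A_def)
    with sz_All show ?thesis by (simp add: power2_eq_square mult_ac)
  qed
  have "\<exists>Q. (\<forall>e\<in>A. Q e \<subseteq> snd e \<and> Q e \<noteq> {}) \<and>
    (\<forall>U \<rho>. U \<noteq> {} \<longrightarrow> \<rho> \<ge> 0 \<longrightarrow>
      real (card {e\<in>A. U \<subseteq> snd e \<and> real (card {e'\<in>A. Q e' = Q e}) / threshold n l (card (Q e)) \<le> \<rho>}) \<le> \<rho> * threshold n l (card U))"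
    by (rule greedy_grouping[OF finA]) (simp_all add: AD threshold_pos)
  then obtain Q where QQ: "(\<forall>e\<in>A. Q e \<subseteq> snd e \<and> Q e \<noteq> {}) \<and>
    (\<forall>U \<rho>. U \<noteq> {} \<longrightarrow> \<rho> \<ge> 0 \<longrightarrow>
      real (card {e\<in>A. U \<subseteq> snd e \<and> real (card {e'\<in>A. Q e' = Q e}) / threshold n l (card (Q e)) \<le> \<rho>}) \<le> \<rho> * threshold n l (card U))" ..
  note Q = bspec[OF conjunct1[OF QQ]] and dg = conjunct2[OF QQ, rule_format]
  define rho where "rho e = real (card {e'\<in>A. Q e' = Q e}) / threshold n l (card (Q e))" for e
  have rho_Q: "rho e = rho e'" if "Q e = Q e'" for e e' using that by (simp add: rho_def)
  \<comment> \<open>Chosen so that \<open>n * \<rho>0 * threshold n l 1 = card A / 2\<close>: the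
    edges of ratio at most \<open>\<rho>0\<close>, counted through their vertices, make up at most
    half of \<open>A\<close>.\<close>
  define \<rho>0 where "\<rho>0 = real (card A) / (2 * real n * real l)"
  have thr1: "threshold n l 1 = real l" using l n by (simp add: threshold_def)
  have \<rho>0_big: "4 \<le> \<rho>0 * \<epsilon>\<^sup>2"
  proof -
    have "8 * (real q)\<^sup>2 * real l * real n \<le> real k * \<delta> * \<epsilon>\<^sup>2 * real n"
      using large by (intro mult_right_mono) auto
    also have "\<dots> = real k * (\<delta> * real n) * \<epsilon>\<^sup>2" by (simp add: mult_ac)
    also have "\<dots> \<le> (real q)\<^sup>2 * real (card A) * \<epsilon>\<^sup>2" using sz_A by (intro mult_right_mono) auto
    finally have "(real q)\<^sup>2 * (8 * real l * real n) \<le> (real q)\<^sup>2 * (real (card A) * \<epsilon>\<^sup>2)"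
      by (simp add: mult_ac)
    then have "8 * real l * real n \<le> real (card A) * \<epsilon>\<^sup>2"
      by (rule mult_left_le_imp_le) (use q in auto)
    then show ?thesis using l n by (simp add: \<rho>0_def field_simps)
  qed
  have \<rho>0_1: "1 \<le> \<rho>0"
  proof -
    have "\<rho>0 \<ge> 0" by (simp add: \<rho>0_def)
    moreover have "\<epsilon>\<^sup>2 \<le> 1" using eps by (simp add: power_le_one)
    ultimately have "\<rho>0 * \<epsilon>\<^sup>2 \<le> \<rho>0 * 1" by (intro mult_left_mono) auto
    with \<rho>0_big show ?thesis by linarith
  qed
  define Hi where "Hi = {e\<in>A. \<rho>0 < rho e}"
  have finHi: "finite Hi" using finA by (simp add: Hi_def)
  have sz_Hi: "real (card A) \<le> 2 * real (card Hi)"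
  proof -
    let ?Lo = "{e\<in>A. rho e \<le> \<rho>0}"
    have "?Lo \<subseteq> (\<Union>v<n. {e\<in>A. {v} \<subseteq> snd e \<and> rho e \<le> \<rho>0})" using AD(3,4) by fastforce
    then have "card ?Lo \<le> card (\<Union>v<n. {e\<in>A. {v} \<subseteq> snd e \<and> rho e \<le> \<rho>0})"
      using finA by (intro card_mono) auto
    also have "\<dots> \<le> (\<Sum>v<n. card {e\<in>A. {v} \<subseteq> snd e \<and> rho e \<le> \<rho>0})" by (rule card_UN_le) simp
    finally have "real (card ?Lo) \<le> (\<Sum>v<n. real (card {e\<in>A. {v} \<subseteq> snd e \<and> rho e \<le> \<rho>0}))"
      by (simp only: of_nat_sum[symmetric] of_nat_le_iff)
    also have "\<dots> \<le> (\<Sum>v<n. \<rho>0 * threshold n l (card {v}))"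
      unfolding rho_def using \<rho>0_1 by (intro sum_mono dg) auto
    also have "\<dots> = real (card A) / 2" using thr1 l n by (simp add: \<rho>0_def)
    finally have "real (card ?Lo) \<le> real (card A) / 2" .
    moreover have "card A \<le> card Hi + card ?Lo"
    proof -
      have "A = Hi \<union> ?Lo" by (auto simp: Hi_def)
      then show ?thesis by (metis card_Un_le)
    qed
    ultimately show ?thesis by linarith
  qed
  \<comment> \<open>Edges in one group have distinct labels, so groups have at most
    \<open>k \<le> n\<close> members and about \<open>log n\<close> dyadic levels suffice.\<close>
  have rho_le: "rho e \<le> real n" if "e \<in> A" for e
  proof -
    have "card {e'\<in>A. Q e' = Q e} \<le> card {..<k}"
    proof (rule card_inj_on_le[where f = fst])
      show "inj_on fst {e'\<in>A. Q e' = Q e}"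
      proof (rule inj_onI)
        fix x y assume *: "x \<in> {e'\<in>A. Q e' = Q e}" "y \<in> {e'\<in>A. Q e' = Q e}" "fst x = fst y"
        then have "snd x \<inter> snd y \<noteq> {}" using Q[of x] Q[of y] by auto
        then show "x = y" using * matching by auto
      qed
    qed (use AD(1) in auto)
    then have "real (card {e'\<in>A. Q e' = Q e}) \<le> real n" using k by simp
    moreover have "rho e \<le> real (card {e'\<in>A. Q e' = Q e}) / 1"
      unfolding rho_def using threshold_ge_1 threshold_pos by (intro divide_left_mono) auto
    ultimately show ?thesis by simp
  qed
  define lev where "lev e = nat \<lfloor>log 2 (rho e)\<rfloor>" for e
  have levD: "2 ^ lev e \<le> rho e" "rho e < 2 ^ Suc (lev e)" "lev e \<le> nat \<lfloor>?lg\<rfloor>" if "e \<in> Hi" for e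
  proof -
    have g1: "rho e > 1" using that \<rho>0_1 by (simp add: Hi_def)
    then have "log 2 (rho e) \<ge> 0" by simp
    then have f: "real (lev e) = of_int \<lfloor>log 2 (rho e)\<rfloor>" unfolding lev_def by simp
    have "real (lev e) \<le> log 2 (rho e)" "log 2 (rho e) < real (Suc (lev e))"
      using f by linarith+
    then have "2 powr real (lev e) \<le> rho e" "rho e < 2 powr real (Suc (lev e))"
      using g1 by (simp_all add: le_log_iff log_less_iff del: of_nat_Suc)
    then show "2 ^ lev e \<le> rho e" "rho e < 2 ^ Suc (lev e)"
      by (simp_all add: powr_realpow del: of_nat_Suc power_Suc)
    have "log 2 (rho e) \<le> ?lg" using g1 rho_le[of e] that n by (simp add: Hi_def)
    then show "lev e \<le> nat \<lfloor>?lg\<rfloor>" unfolding lev_def by (intro nat_mono floor_mono)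
  qed
  have cQ: "card (Q e) \<in> {1..q}" if "e \<in> A" for e
  proof -
    have fQ: "finite (Q e)" using Q[OF that] AD(6)[OF that] finite_subset by blast
    then have "1 \<le> card (Q e)" using Q[OF that] card_gt_0_iff[of "Q e"] by auto
    moreover have "card (Q e) \<le> r" using card_mono[OF AD(6)[OF that]] Q[OF that] AD(5)[OF that] by metis
    ultimately show ?thesis using r by simp
  qed
  have img: "(\<lambda>e. (card (Q e), lev e)) ` Hi \<subseteq> {1..q} \<times> {..nat \<lfloor>?lg\<rfloor>}"
    using cQ levD(3) by (auto simp: Hi_def)
  obtain y where y: "y \<in> {1..q} \<times> {..nat \<lfloor>?lg\<rfloor>}"
    "card Hi \<le> card ({1..q} \<times> {..nat \<lfloor>?lg\<rfloor>}) * card {e\<in>Hi. (card (Q e), lev e) = y}"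
    by (rule pigeonhole_class[OF finHi _ img]) (use q in auto)
  obtain t a where ya: "y = (t, a)" by (cases y)
  have ta: "t \<in> {1..q}" using y(1) ya by simp
  note szF = y(2)[unfolded ya]
  define F where "F = {e\<in>Hi. (card (Q e), lev e) = (t, a)}"
  have FD: "e \<in> A" "e \<in> Hi" "card (Q e) = t" "lev e = a" if "e \<in> F" for e
    using that by (auto simp: F_def Hi_def)
  have finF: "finite F" using finHi by (simp add: F_def)
  have sz_F: "real k * \<delta> * real n \<le> 4 * real q ^ 3 * ?lg * real (card F)"
  proof -
    have "real (card ({1..q} \<times> {..nat \<lfloor>?lg\<rfloor>})) \<le> real q * (2 * ?lg)"
    proof -
      have "real (nat \<lfloor>?lg\<rfloor>) \<le> ?lg" using lg1 by simp
      then have "1 + real (nat \<lfloor>?lg\<rfloor>) \<le> 2 * ?lg" using lg1 by linarith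
      then have "real q * (1 + real (nat \<lfloor>?lg\<rfloor>)) \<le> real q * (2 * ?lg)" by (intro mult_left_mono) auto
      moreover have "card ({1..q} \<times> {..nat \<lfloor>?lg\<rfloor>}) = q * (1 + nat \<lfloor>?lg\<rfloor>)"
        by (simp add: card_cartesian_product)
      ultimately show ?thesis by (simp only: of_nat_mult of_nat_add of_nat_1)
    qed
    then have "real (card Hi) \<le> real q * (2 * ?lg) * real (card F)"
      using of_nat_mono[OF szF, where 'a = real]
      by (simp only: F_def[symmetric] of_nat_mult) (erule order_trans, rule mult_right_mono, auto)
    then have "real (card A) \<le> 2 * (real q * (2 * ?lg) * real (card F))" using sz_Hi by linarith
    then have "(real q)\<^sup>2 * real (card A) \<le> (real q)\<^sup>2 * (2 * (real q * (2 * ?lg) * real (card F)))"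
      by (intro mult_left_mono) auto
    with sz_A show ?thesis by (simp add: power2_eq_square power3_eq_cube mult_ac)
  qed
  show ?thesis
  proof (cases "F = {}")
    case True
    then have "real k * \<delta> * real n \<le> 0" using sz_F by simp
    moreover have "real k * \<delta> * real n > 0" using k del n by simp
    ultimately show ?thesis by linarith
  next
    case Fne: False
    have tr: "t \<le> r"
    proof -
      obtain e where e: "e \<in> F" using Fne by auto
      show ?thesis
        using card_mono[OF AD(6)[OF FD(1)[OF e]], of "Q e"] Q[OF FD(1)[OF e]] AD(5)[OF FD(1)[OF e]] FD(3)[OF e] by auto
    qed
    define s where "s = r - t"
    have st: "s + t = r" using tr by (simp add: s_def)
    have "\<exists>f. bij_betw f {..<s} (snd e - Q e)" if "e \<in> F" for e
    proof -
      have "card (snd e - Q e) = s"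
        using Q[OF FD(1)[OF that]] AD(5,6)[OF FD(1)[OF that]] FD(3)[OF that] finite_subset
        by (subst card_Diff_subset) (auto simp: s_def)
      moreover have "finite (snd e - Q e)" using AD(6)[OF FD(1)[OF that]] by simp
      ultimately show ?thesis using ex_bij_betw_nat_finite[of "snd e - Q e"] by (simp add: atLeast0LessThan)
    qed
    then have "\<forall>e\<in>F. \<exists>f. bij_betw f {..<s} (snd e - Q e)" by blast
    from bchoice[OF this] obtain en where en: "\<And>e. e \<in> F \<Longrightarrow> bij_betw (en e) {..<s} (snd e - Q e)" by blast
    \<comment> \<open>The size of \<open>Q\<close> and the ratio are constant on groups, so the
      chosen class is a union of whole groups and the group sizes do not shrink.\<close>
    have grpF: "{e'\<in>F. Q e' = Q e} = {e'\<in>A. Q e' = Q e}" if "e \<in> F" for e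
    proof -
      have "e' \<in> F" if "e' \<in> A" "Q e' = Q e" for e'
        using that \<open>e \<in> F\<close> rho_Q[OF that(2)] by (simp add: F_def Hi_def lev_def)
      then show ?thesis using FD(1) by auto
    qed
    have wq: "1 \<le> (real n)\<^sup>2 * ?w ^ m" if "m \<le> q" for m
    proof -
      have "?w ^ q \<le> ?w ^ m" using w that by (intro power_decreasing) auto
      then have "(real n)\<^sup>2 * ?w ^ q \<le> (real n)\<^sup>2 * ?w ^ m" by (intro mult_left_mono) auto
      with scale show ?thesis by linarith
    qed
    interpret grouped_matchings F Q en n l t s "2 ^ Suc a"
    proof
      fix U :: "nat set" assume U: "U \<noteq> {}"
      have "{e\<in>F. U \<subseteq> snd e} \<subseteq> {e\<in>A. U \<subseteq> snd e \<and> rho e \<le> 2 ^ Suc a}"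
      proof
        fix e assume "e \<in> {e\<in>F. U \<subseteq> snd e}"
        then have e: "e \<in> F" "U \<subseteq> snd e" by auto
        then show "e \<in> {e\<in>A. U \<subseteq> snd e \<and> rho e \<le> 2 ^ Suc a}"
          using levD(2)[OF FD(2)[OF e(1)]] FD(1,4)[OF e(1)] by simp
      qed
      then have "card {e\<in>F. U \<subseteq> snd e} \<le> card {e\<in>A. U \<subseteq> snd e \<and> rho e \<le> 2 ^ Suc a}"
        using finA by (intro card_mono) auto
      then show "real (card {e\<in>F. U \<subseteq> snd e}) \<le> 2 ^ Suc a * threshold n l (card U)"
        using dg[OF U, of "2 ^ Suc a"] unfolding rho_def by simp
    next
      show "1 \<le> (real n)\<^sup>2 * (real l / real n) ^ (s + t)" using wq[of r] r st by simp
    qed (use finF FD AD Q en matching l in auto)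
    define \<sigma> where "\<sigma> e = (if (\<Sum>b\<in>cube k. b (fst e) * chi (snd e) (E b)) \<ge> 0 then 1 else -1 :: real)" for e
    have half: "1 \<le> real n * ?w ^ (s - s div 2)"
    proof -
      \<comment> \<open>Rounding up costs at most \<open>s + 1 \<le> s + t\<close>, because
        \<open>t \<ge> 1\<close>. This is why odd \<open>s\<close> does no harm: the half condition
        is the square root of the scale condition.\<close>
      have "2 * (s - s div 2) \<le> q" using st ta r by auto
      from wq[OF this] have "1\<^sup>2 \<le> (real n * ?w ^ (s - s div 2))\<^sup>2"
        by (simp only: power_mult_distrib power_even_eq one_power2)
      then show ?thesis by (rule power2_le_imp_le) (use w in auto)
    qed
    \<comment> \<open>\<open>2 ^ p\<close> is comparable to the binary logarithm of the number
      \<open>n ^ (l * s)\<close> of vertices; the maximum with 1 covers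
      \<open>s = 0\<close>.\<close>
    obtain p where p: "real (l * s) * ?lg \<le> 2 ^ Suc p" "2 ^ p \<le> max 1 (real (l * s) * ?lg)"
      by (rule two_power_approx)
    have "real n ^ (l * s) = 2 powr (?lg * real (l * s))"
      using npos n by (simp add: powr_powr[symmetric] powr_realpow power_mult)
    also have "\<dots> \<le> 2 powr real (2 ^ Suc p)"
      using p(1) by (intro powr_mono) (auto simp: mult.commute)
    also have "\<dots> = 2 ^ (2 ^ Suc p)" by (rule powr_realpow) simp
    finally have Np: "real n ^ (l * s) \<le> 2 ^ (2 ^ Suc p)" .
    have "\<epsilon>\<^sup>2 * real (card F) \<le> 2 ^ (s + 8) * real n * sqrt (2 ^ p * real k)"
    proof (rule group_bound[OF E, where \<sigma> = \<sigma>])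
      show "fst e < k" if "e \<in> F" for e using AD FD that by blast
      show "\<sigma> e * \<sigma> e = 1" for e by (simp add: \<sigma>_def)
      show "2 ^ Suc a / 2 * threshold n l t \<le> real (card {e'\<in>F. Q e' = Q e})" if e: "e \<in> F" for e
      proof -
        have "2 ^ a * threshold n l t \<le> rho e * threshold n l t"
          using levD(1)[OF FD(2)[OF e]] FD(4)[OF e] threshold_pos[of n l t] by (intro mult_right_mono) auto
        also have "\<dots> = real (card {e'\<in>F. Q e' = Q e})"
          using threshold_pos[of n l t] FD(3)[OF e] grpF[OF e] by (simp add: rho_def)
        finally show ?thesis by simp
      qed
      show "2 ^ k * \<epsilon> \<le> (\<Sum>b\<in>cube k. b (fst e) * \<sigma> e * chi (snd e) (E b))" if e: "e \<in> F" for e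
      proof -
        let ?S = "\<Sum>b\<in>cube k. b (fst e) * chi (snd e) (E b)"
        have "(\<Sum>b\<in>cube k. b (fst e) * \<sigma> e * chi (snd e) (E b)) = \<sigma> e * ?S"
          by (simp add: sum_distrib_left mult_ac)
        also have "\<dots> = \<bar>?S\<bar>" by (simp add: \<sigma>_def)
        finally show ?thesis using AD(7)[OF FD(1)[OF e]] by simp
      qed
      show "2 \<le> 2 ^ Suc a / 2 * \<epsilon>\<^sup>2"
      proof -
        obtain e where e: "e \<in> F" using Fne by auto
        have "\<rho>0 < 2 * 2 ^ a" using levD(2)[OF FD(2)[OF e]] FD(4)[OF e] FD(2)[OF e] by (simp add: Hi_def)
        then have "\<rho>0 * \<epsilon>\<^sup>2 \<le> 2 * 2 ^ a * \<epsilon>\<^sup>2" by (intro mult_right_mono) auto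
        with \<rho>0_big show ?thesis by simp
      qed
    qed (use eps half Np in auto)
    then have "\<epsilon>\<^sup>2 * real (card F) * (4 * real q ^ 3 * ?lg) \<le> 2 ^ (s + 8) * real n * sqrt (2 ^ p * real k) * (4 * real q ^ 3 * ?lg)"
      using lg1 by (intro mult_right_mono) auto
    moreover have "\<epsilon>\<^sup>2 * (real k * \<delta> * real n) \<le> \<epsilon>\<^sup>2 * (4 * real q ^ 3 * ?lg * real (card F))"
      using sz_F by (intro mult_left_mono) auto
    ultimately have "real n * (\<epsilon>\<^sup>2 * real k * \<delta>) \<le> real n * (2 ^ (s + 8) * sqrt (2 ^ p * real k) * (4 * real q ^ 3 * ?lg))"
      by (simp add: mult_ac)
    then have "\<epsilon>\<^sup>2 * real k * \<delta> \<le> 2 ^ (s + 8) * sqrt (2 ^ p * real k) * (4 * real q ^ 3 * ?lg)"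
      using npos by (simp only: mult_le_cancel_left_pos)
    also have "\<dots> \<le> 2 ^ (q + 8) * sqrt (real l * real q * ?lg * real k) * (4 * real q ^ 3 * ?lg)"
    proof -
      have "real (l * s) * ?lg \<le> real l * real q * ?lg"
        using st r lg1 by (simp add: mult_left_mono mult_right_mono)
      moreover have "1 \<le> real l * real q * ?lg"
      proof -
        have "1 * 1 * 1 \<le> real l * real q * ?lg" using l q lg1 by (intro mult_mono) auto
        then show ?thesis by simp
      qed
      ultimately have "2 ^ p \<le> real l * real q * ?lg" using p(2) by simp
      then have "sqrt (2 ^ p * real k) \<le> sqrt (real l * real q * ?lg * real k)"
        by (intro real_sqrt_le_mono mult_right_mono) auto
      moreover have "(2::real) ^ (s + 8) \<le> 2 ^ (q + 8)" using st r by (intro power_increasing) auto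
      ultimately show ?thesis using lg1 by (intro mult_right_mono mult_mono) auto
    qed
    \<comment> \<open>The left side is linear in \<open>k\<close> and the right side grows like its
      square root, so squaring and cancelling one \<open>k\<close> isolates it.\<close>
    finally have "(\<epsilon>\<^sup>2 * real k * \<delta>)\<^sup>2 \<le> (2 ^ (q + 8) * sqrt (real l * real q * ?lg * real k) * (4 * real q ^ 3 * ?lg))\<^sup>2"
      using eps del by (intro power_mono) auto
    also have "\<dots> = (2 ^ (q + 8))\<^sup>2 * (real l * real q * ?lg * real k) * (4 * real q ^ 3 * ?lg)\<^sup>2"
      using lg1 by (simp add: power_mult_distrib)
    also have "\<dots> = real k * (2 ^ (2 * q + 20) * real q ^ 7 * ?lg ^ 3 * real l)"
      by (simp add: power_mult_distrib power_add power_mult[symmetric] power2_eq_square eval_nat_numeral mult_ac)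
    finally have "real k * (real k * (\<epsilon> ^ 4 * \<delta>\<^sup>2)) \<le> real k * (2 ^ (2 * q + 20) * real q ^ 7 * ?lg ^ 3 * real l)"
      by (simp add: power_mult_distrib power2_eq_square eval_nat_numeral mult_ac)
    then show ?thesis using k by (simp only: mult_le_cancel_left_pos of_nat_0_less_iff)
  qed
qed

text \<open>Two messages with the same codeword that differ at \<open>i\<close> would both be
  decoded there with probability above 1/2, although these events are disjoint. So \<open>E\<close>
  is injective on the cube.\<close>

lemma ldc_message_le_length:
  assumes E: "E \<in> cube k \<rightarrow> cube n" and eps: "\<epsilon> > 0"
    and dec: "\<And>i b. i < k \<Longrightarrow> b \<in> cube k \<Longrightarrow> measure_pmf.prob (Dec i) {t. run t (E b) = b i} \<ge> 1 / 2 + \<epsilon>"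
  shows "k \<le> n"
proof -
  have "inj_on E (cube k)"
  proof (rule inj_onI)
    fix b b' assume b: "b \<in> cube k" "b' \<in> cube k" "E b = E b'"
    show "b = b'"
    proof (rule PiE_ext[of _ "{..<k}" "\<lambda>_. {-1, 1}"])
      fix i assume "i \<in> {..<k}"
      then have i: "i < k" by simp
      show "b i = b' i"
      proof (rule ccontr)
        assume ne: "b i \<noteq> b' i"
        let ?A = "{t. run t (E b) = b i}" and ?B = "{t. run t (E b) = b' i}"
        have "measure_pmf.prob (Dec i) (?A \<union> ?B) = measure_pmf.prob (Dec i) ?A + measure_pmf.prob (Dec i) ?B"
          using ne by (intro measure_pmf.finite_measure_Union) auto
        moreover have "measure_pmf.prob (Dec i) (?A \<union> ?B) \<le> 1" by simp
        ultimately show False using dec[OF i b(1)] dec[OF i b(2)] b(3) eps by simp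
      qed
    qed (use b in \<open>auto simp: cube_def\<close>)
  qed
  then have "card (cube k) \<le> card (cube n)"
    using E by (intro card_inj_on_le[of E]) auto
  then show ?thesis by (simp add: card_cube)
qed

text \<open>\<open>n\<^sup>2 (l / n) ^ q \<ge> 1\<close> means
  \<open>l \<ge> n powr (1 - 2 / q)\<close>. That power is at least 1, so rounding up at most
  doubles it.\<close>

lemma kikuchi_level:
  fixes n q :: nat
  assumes "q \<ge> 3" "n \<ge> 2"
  obtains l where "0 < l" "l \<le> n" "1 \<le> (real n)\<^sup>2 * (real l / real n) ^ q"
    "real l \<le> 2 * real n powr (1 - 2 / real q)"
proof -
  let ?x = "real n powr (1 - 2 / real q)"
  define l where "l = nat \<lceil>?x\<rceil>"
  have n: "real n \<ge> 1" using assms by simp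
  have "2 / real q \<le> 1" using assms by simp
  then have x1: "?x \<ge> 1" using n by (intro ge_one_powr_ge_zero) auto
  have lx: "real l \<ge> ?x" unfolding l_def using x1 by linarith
  have "real l \<le> ?x + 1" unfolding l_def using x1 by linarith
  then have l2: "real l \<le> 2 * ?x" using x1 by simp
  have "?x \<le> real n powr 1" using n assms by (intro powr_mono) auto
  then have "?x \<le> of_int (int n)" using n by simp
  then have "\<lceil>?x\<rceil> \<le> int n" by (simp only: ceiling_le_iff)
  then have ln: "l \<le> n" unfolding l_def by linarith
  have "real n powr (- (2 / real q)) = ?x / real n"
    using n by (simp add: powr_diff powr_minus divide_inverse)
  also have "\<dots> \<le> real l / real n" using lx by (intro divide_right_mono) auto
  finally have "(real n powr (- (2 / real q))) ^ q \<le> (real l / real n) ^ q" by (intro power_mono) auto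
  moreover have "(real n powr (- (2 / real q))) ^ q = inverse ((real n)\<^sup>2)"
  proof -
    have "(real n powr (- (2 / real q))) ^ q = (real n powr (- (2 / real q))) powr real q"
      using n by (intro powr_realpow[symmetric]) simp
    also have "\<dots> = real n powr (- (2 / real q) * real q)" by (rule powr_powr)
    also have "- (2 / real q) * real q = - 2" using assms by simp
    finally show ?thesis using n by (simp add: powr_minus powr_numeral)
  qed
  ultimately have "(real n)\<^sup>2 * inverse ((real n)\<^sup>2) \<le> (real n)\<^sup>2 * (real l / real n) ^ q"
    by (intro mult_left_mono) auto
  then have "1 \<le> (real n)\<^sup>2 * (real l / real n) ^ q" using n by simp
  moreover have "0 < l" using lx x1 by (cases l) auto
  ultimately show ?thesis using that ln l2 by blast
qed

theorem theorem4p1: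
  "\<exists>c::real. \<forall>(q::nat) (k::nat) (n::nat) (\<delta>::real) (\<epsilon>::real) (E :: (nat \<Rightarrow> real) \<Rightarrow> (nat \<Rightarrow> real)).
     q \<ge> 3 \<longrightarrow> n \<ge> 2 \<longrightarrow> \<delta> > 0 \<longrightarrow> \<epsilon> > 0 \<longrightarrow>
     E \<in> cube k \<rightarrow> cube n \<longrightarrow> locally_decodable q \<delta> \<epsilon> k n E \<longrightarrow>
     real k \<le> real n powr (1 - 2 / real q)
              * (2 powr (c * real q) * (log 2 (real n)) ^ 4 / (\<epsilon> ^ 6 * \<delta> ^ 2))"
proof (intro exI[of _ 20] allI impI)
  fix q k n :: nat and \<delta> \<epsilon> :: real and E :: "(nat \<Rightarrow> real) \<Rightarrow> (nat \<Rightarrow> real)"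
  assume q: "q \<ge> 3" and n: "n \<ge> 2" and d: "\<delta> > 0" and e: "\<epsilon> > 0" and E: "E \<in> cube k \<rightarrow> cube n"
    and ldc: "locally_decodable q \<delta> \<epsilon> k n E"
  let ?x = "real n powr (1 - 2 / real q)" and ?lg = "log 2 (real n)"
  have lg1: "?lg \<ge> 1" using n by simp
  have x0: "?x \<ge> 0" by simp
  have goal: "real k \<le> ?x * (2 powr (20 * real q) * ?lg ^ 4 / (\<epsilon> ^ 6 * \<delta> ^ 2))"
    if "real k * (\<epsilon> ^ 6 * \<delta>\<^sup>2) \<le> ?x * 2 ^ (20 * q) * ?lg ^ 4"
  proof -
    have "2 powr (20 * real q) = (2::real) ^ (20 * q)"
      using powr_realpow[of 2 "20 * q"] by simp
    then show ?thesis using that e d by (simp add: field_simps)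
  qed
  show "real k \<le> ?x * (2 powr (20 * real q) * ?lg ^ 4 / (\<epsilon> ^ 6 * \<delta> ^ 2))"
  proof (cases "k = 0")
    case True
    then show ?thesis using lg1 e by simp
  next
    case False
    then have k: "1 \<le> k" "0 < k" by auto
    from ldc obtain Dec where Dec: "\<And>i. i < k \<Longrightarrow> query_bounded q n (Dec i)"
      and dec: "\<And>i b y. i < k \<Longrightarrow> b \<in> cube k \<Longrightarrow> y \<in> cube n \<Longrightarrow> real (hamming n y (E b)) \<le> \<delta> * real n \<Longrightarrow>
        measure_pmf.prob (Dec i) {t. run t y = b i} \<ge> 1 / 2 + \<epsilon>"
      unfolding locally_decodable_def by blast
    have dec0: "measure_pmf.prob (Dec i) {t. run t (E b) = b i} \<ge> 1 / 2 + \<epsilon>" if "i < k" "b \<in> cube k" for i b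
      using dec[OF that funcset_mem[OF E that(2)]] d by simp
    have kn: "k \<le> n" by (rule ldc_message_le_length[OF E e dec0])
    have e1: "\<epsilon> \<le> 1"
    proof -
      obtain b where "b \<in> cube k" using cube_nonempty by blast
      from dec0[OF k(2) this] have "1 / 2 + \<epsilon> \<le> 1" by (rule order_trans) simp
      then show ?thesis by simp
    qed
    define P where "P i H \<longleftrightarrow> disjoint H \<and> real q * real (card H) \<ge> \<delta> * real n \<and> \<delta> * real n < real n \<and>
      (\<forall>C\<in>H. C \<subseteq> {..<n} \<and> C \<noteq> {} \<and> card C \<le> q \<and> \<bar>\<Sum>b\<in>cube k. b i * chi C (E b)\<bar> \<ge> 2 ^ k * (\<epsilon> / 2 ^ q))" for i H
    have "\<exists>H. P i H" if i: "i < k" for i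
    proof (rule ldc_normal_form[OF E i d e Dec[OF i]])
      fix H assume "disjoint H" "real q * real (card H) \<ge> \<delta> * real n" "\<delta> * real n < real n"
        "\<And>C. C \<in> H \<Longrightarrow> C \<subseteq> {..<n} \<and> C \<noteq> {} \<and> card C \<le> q \<and> \<bar>\<Sum>b\<in>cube k. b i * chi C (E b)\<bar> \<ge> 2 ^ k * (\<epsilon> / 2 ^ q)"
      then show ?thesis unfolding P_def by blast
    qed (rule dec[OF i])
    then have "\<forall>i\<in>{..<k}. \<exists>H. P i H" by simp
    from bchoice[OF this] obtain H where "\<forall>i\<in>{..<k}. P i (H i)" ..
    then have H: "P i (H i)" if "i < k" for i using that by simp
    have d1: "\<delta> \<le> 1" using H[OF k(2)] n unfolding P_def by simp
    obtain l where l: "0 < l" "l \<le> n" "1 \<le> (real n)\<^sup>2 * (real l / real n) ^ q" "real l \<le> 2 * ?x"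
      by (rule kikuchi_level[OF q n])
    let ?e = "\<epsilon> / 2 ^ q"
    have q2: "real q \<le> 2 ^ q" using less_exp[of q] by (metis less_imp_le of_nat_le_iff of_nat_numeral of_nat_power)
    have e46: "\<epsilon> ^ 6 * \<delta>\<^sup>2 \<le> \<epsilon> ^ 4 * \<delta>\<^sup>2" using e e1 by (intro mult_right_mono power_decreasing) auto
    \<comment> \<open>If the inequality fails, \<open>k\<close> is already at most a multiple of
      \<open>l\<close> with the required dependence on the parameters.\<close>
    show ?thesis
    proof (cases "8 * (real q)\<^sup>2 * real l \<le> real k * \<delta> * ?e\<^sup>2")
      case True
      have "?e \<le> 1" using e e1 by (simp add: divide_le_eq) (smt (verit) one_le_power)
      then have "real k * (?e ^ 4 * \<delta>\<^sup>2) \<le> 2 ^ (2 * q + 20) * real q ^ 7 * ?lg ^ 3 * real l"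
        using e d q l True H n k kn
        by (intro matchings_bound[OF E, where H = H]) (auto simp: P_def)
      also have "\<dots> \<le> 2 ^ (2 * q + 20) * (2 ^ q) ^ 7 * ?lg ^ 4 * (2 * ?x)"
        using q2 lg1 l x0 by (intro mult_mono power_mono power_increasing) auto
      finally have "2 ^ (4 * q) * (real k * (?e ^ 4 * \<delta>\<^sup>2)) \<le> 2 ^ (4 * q) * (2 ^ (2 * q + 20) * (2 ^ q) ^ 7 * ?lg ^ 4 * (2 * ?x))"
        by (intro mult_left_mono) auto
      also have "2 ^ (4 * q) * (real k * (?e ^ 4 * \<delta>\<^sup>2)) = real k * (\<epsilon> ^ 4 * \<delta>\<^sup>2)"
        by (simp add: power_divide power_mult[symmetric] mult.commute)
      also have "2 ^ (4 * q) * (2 ^ (2 * q + 20) * (2 ^ q) ^ 7 * ?lg ^ 4 * (2 * ?x)) = 2 ^ (4 * q + (2 * q + 20) + q * 7 + 1) * (?lg ^ 4 * ?x)"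
        by (simp only: power_add power_mult[symmetric] power_one_right mult_ac)
      \<comment> \<open>The constant 20 comes from here: the exponent is \<open>13 * q + 21\<close>,
        which is at most \<open>20 * q\<close> exactly when \<open>q \<ge> 3\<close>.\<close>
      also have "\<dots> \<le> 2 ^ (20 * q) * (?lg ^ 4 * ?x)"
        using q lg1 x0 by (intro mult_right_mono power_increasing mult_nonneg_nonneg) auto
      finally have "real k * (\<epsilon> ^ 4 * \<delta>\<^sup>2) \<le> ?x * 2 ^ (20 * q) * ?lg ^ 4" by (simp only: mult_ac)
      \<comment> \<open>The argument yields \<open>\<epsilon> ^ 4\<close>; since
        \<open>\<epsilon> \<le> 1\<close>, the sixth power is a weakening.\<close>
      moreover have "real k * (\<epsilon> ^ 6 * \<delta>\<^sup>2) \<le> real k * (\<epsilon> ^ 4 * \<delta>\<^sup>2)" using e46 by (intro mult_left_mono) auto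
      ultimately show ?thesis by (intro goal) linarith
    next
      case False
      have "real k * (\<epsilon> ^ 6 * \<delta>\<^sup>2) \<le> real k * (\<epsilon>\<^sup>2 * \<delta>)"
      proof -
        have "\<epsilon> ^ 6 \<le> \<epsilon>\<^sup>2" using e e1 by (intro power_decreasing) auto
        moreover have "\<delta>\<^sup>2 \<le> \<delta>" using power_decreasing[of 1 2 \<delta>] d d1 by simp
        ultimately show ?thesis using e d by (intro mult_left_mono mult_mono) auto
      qed
      also have "\<dots> = 2 ^ (2 * q) * (real k * \<delta> * ?e\<^sup>2)"
        by (simp add: power_divide power_mult[symmetric] mult.commute)
      also have "\<dots> \<le> 2 ^ (2 * q) * (8 * (real q)\<^sup>2 * real l)" using False by (intro mult_left_mono) auto
      also have "\<dots> \<le> 2 ^ (2 * q) * (8 * (2 ^ q)\<^sup>2 * (2 * ?x))"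
        using q2 l x0 by (intro mult_left_mono mult_mono power_mono) auto
      also have "\<dots> = 2 ^ (2 * q + 4 + q * 2) * ?x"
      proof -
        have "(2::real) ^ (2 * q + 4 + q * 2) = 2 ^ (2 * q) * 2 ^ 4 * (2 ^ q)\<^sup>2"
          by (simp only: power_add power_mult)
        then show ?thesis by simp
      qed
      also have "\<dots> \<le> 2 ^ (20 * q) * ?x"
        using q x0 by (intro mult_right_mono power_increasing) auto
      also have "\<dots> \<le> (2 ^ (20 * q) * ?x) * ?lg ^ 4"
      proof -
        have "1 \<le> ?lg ^ 4" using lg1 by (rule one_le_power)
        then have "(2 ^ (20 * q) * ?x) * 1 \<le> (2 ^ (20 * q) * ?x) * ?lg ^ 4" using x0 by (intro mult_left_mono) auto
        then show ?thesis by simp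
      qed
      finally show ?thesis by (intro goal) (simp only: mult_ac)
    qed
  qed
qed

end
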